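(* Let $F\subset E$ and assume that, as $n\to\infty$: (1) $k_n\uparrow\infty$ and $n\nu_n\to\infty$; (2) $0<m\le M<+\infty$ and $\delta_n:=\max_{1\le r\le k_n}\nu_{n,r}(M_{n,r}-m_{n,r})=o(1/n)$; (3) for each $(x_1,\dots,x_p)\subset F$ there exists a covariance matrix $\Sigma_{(x_1,\dots,x_p)}=[\sigma(x_i,x_j)]_{1\le i,j\le p}$ in $\mathbb{R}^p$ such that for all $1\le i,j\le p$, $\sum_{r=1}^{k_n}w_{n,r}(x_i)w_{n,r}(x_j)\to\sigma(x_i,x_j)$; (4) for all $x\in F$, $\max_{1\le r\le k_n}|w_{n,r}(x)|\to 0$; (5) for all $x\in F$, $\left|\sum_{r=1}^{k_n}\nu_{n,r}\kappa_{n,r}(x)f_{n,r}-f(x)\right|=o\left(\kappa_n(x)/n\right)$; (6) for all $x\in F$, $\left(\sum_{r=1}^{k_n}|w_{n,r}(x)|\right)\max\left((n\delta_n)^2,\;n\nu_n\exp(-mcn\nu_n),\;\Delta_n\right)\to 0$. Then for all $(x_1,\dots,x_p)\subset F$, $$\left\{\frac{nc}{\kappa_n(x_j)}\left(\widehat f_n(x_j)-f(x_j)\right):1\le j\le p\right\}\underset{\mathcal D}{\to}N\left(0,\Sigma_{(x_1,\dots,x_p)}\right)\quad\text{as } n\to\infty,$$ where $\underset{\mathcal D}{\to}$ denotes convergence in distribution and $N(0,\Sigma)$ is the centered Gaussian distribution in $\mathbb{R}^p$ with covariance matrix $\Sigma$.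
   Context: $(E,\mathcal{E},\nu)$ is a probability space, $f:E\to\mathbb{R}^+$ is measurable, $S=\{(x,y)\in E\times\mathbb{R}:0\le y\le f(x)\}$, $c>0$ is a constant and $\lambda$ is Lebesgue measure on $\mathbb{R}^+$. For each $n\ge1$, $N_n$ is a Poisson point process on $E\times\mathbb{R}^+$ with intensity measure $nc(\nu\otimes\lambda)\mathbf{1}_S$, and $\{(X_{n,i},Y_{n,i}):1\le i\le N_n(S)\}$ is its set of points. $(k_n)$ is a sequence of positive integers and, for each $n$, $\{I_{n,r}:1\le r\le k_n\}$ is a measurable partition of $E$. Put $\nu_{n,r}=\nu(I_{n,r})>0$, $\nu_n=\min_{1\le r\le k_n}\nu_{n,r}$, $D_{n,r}=\{(x,y):x\in I_{n,r},\,0\le y\le f(x)\}$, $N_{n,r}=N_n(D_{n,r})$, and $Y^*_{n,r}=\max\{Y_{n,i}:(X_{n,i},Y_{n,i})\in D_{n,r}\}$ if $N_{n,r}\ne0$, $Y^*_{n,r}=0$ otherwise. The convention $0\times\infty=0$ is used, so $(1+1/N_{n,r})Y^*_{n,r}=0$ when $N_{n,r}=0$. Let $m=\sup\{\alpha>0:\nu(\{f<\alpha\})=0\}$ and $M=\inf\{\alpha>0:\nu(\{f>\alpha\})=0\}$ be the $\nu$-essential infimum and supremum of $f$; $m_{n,r}=\sup\{\alpha>0:\nu(\{f<\alpha\}\cap I_{n,r})=0\}$ and $M_{n,r}=\inf\{\alpha>0:\nu(\{f>\alpha\}\cap I_{n,r})=0\}$ those on $I_{n,r}$; $f_{n,r}=\nu_{n,r}^{-1}\int_{I_{n,r}}f\,d\nu$;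 $\Delta_n=\max_{1\le r\le k_n}(M_{n,r}-m_{n,r})$. $\kappa_{n,r}:E\to\mathbb{R}$ ($1\le r\le k_n$) are given (deterministic) weight functions, $\kappa_n(x)=\left(\sum_{r=1}^{k_n}\kappa_{n,r}^2(x)\right)^{1/2}$ (assumed positive for $x\in F$), $w_{n,r}(x)=\kappa_{n,r}(x)/\kappa_n(x)$. The estimator is $$\widehat f_n(x)=\sum_{r=1}^{k_n}\nu_{n,r}\kappa_{n,r}(x)\left(1+\frac1{N_{n,r}}\right)Y^*_{n,r},\quad x\in E.$$ *)

theory Defs
  imports "HOL-Probability.Probability" "HOL-Library.Landau_Symbols"
begin

section \<open>Poisson point processes\<close>

text \<open>A point process is a random measure with values in the extended natural numbers; its
  multiplicities are kept, so nothing is assumed about measurability of singletons.\<close>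

definition poisson_point_process ::
    "'w measure \<Rightarrow> 'b measure \<Rightarrow> ('w \<Rightarrow> 'b measure) \<Rightarrow> bool" where
  "poisson_point_process P \<mu> N \<longleftrightarrow>
     (\<forall>\<omega>\<in>space P. sets (N \<omega>) = sets \<mu> \<and>
        (\<forall>A\<in>sets \<mu>. emeasure (N \<omega>) A \<in> insert \<infinity> (range of_nat))) \<and>
     (\<forall>A\<in>sets \<mu>. (\<lambda>\<omega>. emeasure (N \<omega>) A) \<in> borel_measurable P) \<and>
     (\<forall>A\<in>sets \<mu>. emeasure \<mu> A < \<infinity> \<longrightarrow>
        (\<forall>j::nat. measure P {\<omega>\<in>space P. emeasure (N \<omega>) A = of_nat j}
                  = exp (- measure \<mu> A) * measure \<mu> A ^ j / fact j)) \<and>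
     (\<forall>A\<in>sets \<mu>. emeasure \<mu> A = \<infinity> \<longrightarrow> (AE \<omega> in P. emeasure (N \<omega>) A = \<infinity>)) \<and>
     (\<forall>A :: nat \<Rightarrow> 'b set. range A \<subseteq> sets \<mu> \<longrightarrow> disjoint_family A \<longrightarrow>
        prob_space.indep_vars P (\<lambda>_. borel :: ennreal measure)
          (\<lambda>i \<omega>. emeasure (N \<omega>) (A i)) UNIV)"

definition hypograph :: "('e \<Rightarrow> real) \<Rightarrow> 'e set \<Rightarrow> ('e \<times> real) set" where
  "hypograph f A = {(x, y). x \<in> A \<and> 0 \<le> y \<and> y \<le> f x}"

definition intensity :: "'e measure \<Rightarrow> ('e \<Rightarrow> real) \<Rightarrow> real \<Rightarrow> ('e \<times> real) measure" where
  "intensity \<nu> f t =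
     density (\<nu> \<Otimes>\<^sub>M restrict_space lborel {0..})
       (\<lambda>z. ennreal t * indicator (hypograph f (space \<nu>)) z)"

text \<open>Indices of the points of a configuration N lying in S that fall into A, for the enumeration
  (X i, Y i) with i running from 1 to N(S). The bound N(S) may be infinite.\<close>

definition point_indices ::
    "('e \<times> real) measure \<Rightarrow> ('e \<times> real) set \<Rightarrow> (nat \<Rightarrow> 'e) \<Rightarrow> (nat \<Rightarrow> real) \<Rightarrow>
     ('e \<times> real) set \<Rightarrow> nat set" where
  "point_indices N S X Y A = {i. 1 \<le> i \<and> of_nat i \<le> emeasure N S \<and> (X i, Y i) \<in> A}"

definition enumerates_points ::
    "('e \<times> real) measure \<Rightarrow> ('e \<times> real) set \<Rightarrow> (nat \<Rightarrow> 'e) \<Rightarrow> (nat \<Rightarrow> real) \<Rightarrow> bool" where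
  "enumerates_points N S X Y \<longleftrightarrow>
     (\<forall>A\<in>sets N. emeasure N A = emeasure (count_space UNIV) (point_indices N S X Y A))"

text \<open>The measure of an infinite count is 0 as a real number. Under the assumptions of the theorem
  this only happens on a null set.\<close>

definition Y_star ::
    "('e \<times> real) measure \<Rightarrow> ('e \<times> real) set \<Rightarrow> (nat \<Rightarrow> 'e) \<Rightarrow> (nat \<Rightarrow> real) \<Rightarrow>
     ('e \<times> real) set \<Rightarrow> real" where
  "Y_star N S X Y D =
     (if measure N D \<noteq> 0 then Max (Y ` point_indices N S X Y D) else 0)"


section \<open>Essential bounds and cell averages\<close>

text \<open>The values are in the extended half line, where the supremum of the empty set is 0 and the
  infimum of the empty set is infinite.\<close>

definition ess_inf_on :: "'e measure \<Rightarrow> ('e \<Rightarrow> real) \<Rightarrow> 'e set \<Rightarrow> ennreal" where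
  "ess_inf_on \<nu> f A =
     Sup {ennreal \<alpha> | \<alpha>. \<alpha> > 0 \<and> emeasure \<nu> ({x\<in>space \<nu>. f x < \<alpha>} \<inter> A) = 0}"

definition ess_sup_on :: "'e measure \<Rightarrow> ('e \<Rightarrow> real) \<Rightarrow> 'e set \<Rightarrow> ennreal" where
  "ess_sup_on \<nu> f A =
     Inf {ennreal \<alpha> | \<alpha>. \<alpha> > 0 \<and> emeasure \<nu> ({x\<in>space \<nu>. f x > \<alpha>} \<inter> A) = 0}"

definition ess_osc :: "'e measure \<Rightarrow> ('e \<Rightarrow> real) \<Rightarrow> 'e set \<Rightarrow> real" where
  "ess_osc \<nu> f A = enn2real (ess_sup_on \<nu> f A) - enn2real (ess_inf_on \<nu> f A)"

definition nu_min :: "'e measure \<Rightarrow> nat \<Rightarrow> (nat \<Rightarrow> 'e set) \<Rightarrow> real" where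
  "nu_min \<nu> k I = Min ((\<lambda>r. measure \<nu> (I r)) ` {1..k})"

definition Delta_max :: "'e measure \<Rightarrow> ('e \<Rightarrow> real) \<Rightarrow> nat \<Rightarrow> (nat \<Rightarrow> 'e set) \<Rightarrow> real" where
  "Delta_max \<nu> f k I = Max ((\<lambda>r. ess_osc \<nu> f (I r)) ` {1..k})"

definition delta_max :: "'e measure \<Rightarrow> ('e \<Rightarrow> real) \<Rightarrow> nat \<Rightarrow> (nat \<Rightarrow> 'e set) \<Rightarrow> real" where
  "delta_max \<nu> f k I = Max ((\<lambda>r. measure \<nu> (I r) * ess_osc \<nu> f (I r)) ` {1..k})"

definition cell_mean :: "'e measure \<Rightarrow> ('e \<Rightarrow> real) \<Rightarrow> 'e set \<Rightarrow> real" where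
  "cell_mean \<nu> f A = (LINT x:A|\<nu>. f x) / measure \<nu> A"


section \<open>Weights and estimator\<close>

definition kappa_norm :: "nat \<Rightarrow> (nat \<Rightarrow> 'e \<Rightarrow> real) \<Rightarrow> 'e \<Rightarrow> real" where
  "kappa_norm k \<kappa> x = sqrt (\<Sum>r=1..k. (\<kappa> r x)\<^sup>2)"

definition weight :: "nat \<Rightarrow> (nat \<Rightarrow> 'e \<Rightarrow> real) \<Rightarrow> nat \<Rightarrow> 'e \<Rightarrow> real" where
  "weight k \<kappa> r x = \<kappa> r x / kappa_norm k \<kappa> x"

text \<open>An empty cell contributes 0, since both the inverse of 0 and its maximum are 0.\<close>

definition estimator ::
    "'e measure \<Rightarrow> ('e \<Rightarrow> real) \<Rightarrow> nat \<Rightarrow> (nat \<Rightarrow> 'e set) \<Rightarrow> (nat \<Rightarrow> 'e \<Rightarrow> real) \<Rightarrow>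
     ('e \<times> real) measure \<Rightarrow> (nat \<Rightarrow> 'e) \<Rightarrow> (nat \<Rightarrow> real) \<Rightarrow> 'e \<Rightarrow> real" where
  "estimator \<nu> f k I \<kappa> N X Y x =
     (\<Sum>r=1..k. measure \<nu> (I r) * \<kappa> r x *
        ((1 + 1 / measure N (hypograph f (I r))) *
         Y_star N (hypograph f (space \<nu>)) X Y (hypograph f (I r))))"


section \<open>Gaussian vectors and convergence in distribution\<close>

definition has_covariance_matrix :: "(real^'p) measure \<Rightarrow> real^'p^'p \<Rightarrow> bool" where
  "has_covariance_matrix \<mu> A \<longleftrightarrow>
     (\<forall>i. integrable \<mu> (\<lambda>v. (v $ i)\<^sup>2)) \<and>
     (\<forall>i j. A $ i $ j =
        (LINT v|\<mu>. (v $ i - (LINT u|\<mu>. u $ i)) * (v $ j - (LINT u|\<mu>. u $ j))))"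

definition covariance_matrix :: "real^'p^'p \<Rightarrow> bool" where
  "covariance_matrix A \<longleftrightarrow>
     (\<exists>\<mu> :: (real^'p) measure. prob_space \<mu> \<and> sets \<mu> = sets borel \<and> has_covariance_matrix \<mu> A)"

text \<open>Degenerate laws (Dirac measures) count as Gaussian, since covariance matrices may be
  singular.\<close>

definition gaussian_real :: "real measure \<Rightarrow> bool" where
  "gaussian_real \<mu> \<longleftrightarrow>
     (\<exists>a. \<mu> = return borel a) \<or>
     (\<exists>a s. s > 0 \<and> \<mu> = density lborel (\<lambda>t. ennreal (normal_density a s t)))"

definition centered_gaussian :: "real^'p^'p \<Rightarrow> (real^'p) measure \<Rightarrow> bool" where
  "centered_gaussian A \<mu> \<longleftrightarrow>
     prob_space \<mu> \<and> sets \<mu> = sets borel \<and>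
     (\<forall>a. gaussian_real (distr \<mu> borel (\<lambda>v. a \<bullet> v))) \<and>
     (\<forall>i. (LINT v|\<mu>. v $ i) = 0) \<and>
     has_covariance_matrix \<mu> A"

text \<open>The random vectors need not live on a common probability space.\<close>

definition converges_in_distribution ::
    "(nat \<Rightarrow> 'w measure) \<Rightarrow> (nat \<Rightarrow> 'w \<Rightarrow> 'b::metric_space) \<Rightarrow> 'b measure \<Rightarrow> bool" where
  "converges_in_distribution P Z \<mu> \<longleftrightarrow>
     (\<forall>\<^sub>F n in sequentially. Z n \<in> borel_measurable (P n)) \<and>
     (\<forall>g :: 'b \<Rightarrow> real. continuous_on UNIV g \<longrightarrow> bounded (range g) \<longrightarrow>
        (\<lambda>n. LINT \<omega>|P n. g (Z n \<omega>)) \<longlonglongrightarrow> (LINT v|\<mu>. g v))"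

end

theory Submission
  imports Defs
begin

text \<open>
  Fix a cell with mass \<open>v\<close>, mean value \<open>f\<close> and Poisson rate \<open>a = n c v\<close>, and let \<open>N\<close> and \<open>Y\<close> be the
  number of points and the highest point above that cell. The whole proof rests on the size of the
  rescaled error \<open>zeta = a ((1 + 1/N) Y - f)\<close>.

  The number of points above level \<open>y\<close> is Poisson, so \<open>Y \<le> y\<close> has probability \<open>exp (- a (f - g y))\<close>,
  where \<open>g y\<close> is the mean of \<open>min y f\<close> over the cell. Below the essential infimum \<open>g y = y\<close>, hence
  \<open>a (f - Y)\<close> has exactly an exponential tail there; the range between the essential infimum and
  the essential supremum only has length \<open>a (hi - lo)\<close>, which tends to 0. As \<open>N\<close> is close to \<open>a f\<close>,
  the correction \<open>a Y / N\<close> is close to 1 in mean square. So \<open>zeta\<close> is close in mean square to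
  \<open>1 - X\<close> with \<open>X\<close> standard exponential: mean 0 and variance 1 (lemmas \<open>gap_law\<close>, \<open>gap_moments\<close>,
  \<open>remainder_second_moment\<close>).

  Closeness in mean square does not control the mean well enough, because the means of all cells
  add up with weights whose absolute sum may diverge. This is where the factor \<open>1 + 1/N\<close> matters:
  given \<open>N = j\<close> and \<open>f\<close> constant, \<open>Y\<close> is the maximum of \<open>j\<close> uniform variables on \<open>[0, f]\<close>, whose mean
  is \<open>f j / (j + 1)\<close>. So the only bias comes from the empty cell and is \<open>lam exp (- lam)\<close> with
  \<open>lam = a f\<close>, and for a nonconstant function the additional bias is quadratic in the oscillation
  (lemma \<open>bias_bound\<close>). This is what the growth condition on the weights absorbs.

  Different cells are independent: events about the pair \<open>(N, Y)\<close> are events about the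
  numbers of points above and below a level, and the pieces cut out by one level per cell are
  disjoint (lemmas \<open>indep_cells\<close>, \<open>indep_cell_estimates\<close>). A central limit theorem for weighted sums
  with small weights (lemma \<open>weighted_sum_clt\<close>) then applies to every linear combination of the
  coordinates. A multivariate continuity theorem (\<open>multivariate_levy_continuity\<close>) turns convergence
  of the characteristic functions into convergence in distribution. The limit covariance matrix is
  positive semidefinite as a limit of Gram matrices, and a Gaussian law with this covariance is the
  image of independent standard normal variables (\<open>exists_measure_with_gaussian_char\<close>,
  \<open>centered_gaussian_if_char\<close>).
\<close>


section \<open>Characteristic functions and convergence in distribution on Euclidean space\<close>

inductive trig_polynomial :: "('a::euclidean_space \<Rightarrow> real) \<Rightarrow> bool" where
  wave: "trig_polynomial (\<lambda>x. c * cos (t \<bullet> x + b))"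
| add: "trig_polynomial g \<Longrightarrow> trig_polynomial h \<Longrightarrow> trig_polynomial (\<lambda>x. g x + h x)"

lemma trig_polynomial_const: "trig_polynomial (\<lambda>x. c)"
  using trig_polynomial.wave[of c 0 0] by simp

lemma trig_polynomial_sin: "trig_polynomial (\<lambda>x. sin (t \<bullet> x))"
  using trig_polynomial.wave[of 1 t "- (pi / 2)"] by (simp add: cos_diff)

text \<open>The product formula for cosines makes trigonometric polynomials an algebra, as the
  Stone-Weierstrass theorem requires.\<close>

lemma trig_polynomial_mult:
  assumes "trig_polynomial g" "trig_polynomial h"
  shows "trig_polynomial (\<lambda>x. g x * h x)"
  using assms(1)
proof induction
  case (wave c t b)
  show ?case using assms(2)
  proof induction
    case (wave c' t' b')
    have "(\<lambda>x. c * cos (t \<bullet> x + b) * (c' * cos (t' \<bullet> x + b'))) =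
      (\<lambda>x. c * c' / 2 * cos ((t - t') \<bullet> x + (b - b')) + c * c' / 2 * cos ((t + t') \<bullet> x + (b + b')))"
    proof
      fix x
      have "cos (t \<bullet> x + b) * cos (t' \<bullet> x + b') =
          (cos ((t - t') \<bullet> x + (b - b')) + cos ((t + t') \<bullet> x + (b + b'))) / 2"
        unfolding cos_times_cos by (simp add: inner_diff_left inner_add_left algebra_simps)
      then show "c * cos (t \<bullet> x + b) * (c' * cos (t' \<bullet> x + b')) =
         c * c' / 2 * cos ((t - t') \<bullet> x + (b - b')) + c * c' / 2 * cos ((t + t') \<bullet> x + (b + b'))"
        by (simp add: field_simps)
    qed
    then show ?case by (simp only:) (intro trig_polynomial.intros)
  next
    case (add g h)
    then show ?case by (simp only: distrib_left) (intro trig_polynomial.intros)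
  qed
next
  case (add g g')
  then show ?case by (simp only: distrib_right) (intro trig_polynomial.intros)
qed

lemma trig_polynomial_continuous: "trig_polynomial g \<Longrightarrow> continuous_on UNIV g"
  by (induction rule: trig_polynomial.induct) (auto intro!: continuous_intros)

lemma trig_polynomial_bounded: "trig_polynomial g \<Longrightarrow> \<exists>B. \<forall>x. \<bar>g x\<bar> \<le> B"
proof (induction rule: trig_polynomial.induct)
  case (wave c t b)
  show ?case by (intro exI[of _ "\<bar>c\<bar>"]) (auto simp: abs_mult mult_left_le)
next
  case (add g h)
  then obtain A B where "\<forall>x. \<bar>g x\<bar> \<le> A" "\<forall>x. \<bar>h x\<bar> \<le> B" by auto
  then have "\<bar>g x + h x\<bar> \<le> A + B" for x
    using abs_triangle_ineq[of "g x" "h x"] by (smt (verit))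
  then show ?case by blast
qed

lemma (in prob_space) integrable_trig_polynomial:
  assumes "trig_polynomial g" and [measurable]: "Z \<in> borel_measurable M"
  shows "integrable M (\<lambda>\<omega>. g (Z \<omega>))"
proof -
  obtain B where "\<forall>x. \<bar>g x\<bar> \<le> B" using trig_polynomial_bounded assms by blast
  moreover have [measurable]: "g \<in> borel_measurable borel"
    using trig_polynomial_continuous assms by (intro borel_measurable_continuous_onI) auto
  ultimately show ?thesis
    by (intro integrable_const_bound[where B=B]) auto
qed

text \<open>A cosine wave with phase is the real part of a multiple of a character, so its expectation
  is read off the characteristic function.\<close>

lemma (in prob_space) expectation_wave:
  fixes Y :: "'a \<Rightarrow> 'b::euclidean_space"
  assumes [measurable]: "Y \<in> borel_measurable M"
  shows "expectation (\<lambda>\<omega>. c * cos (t \<bullet> Y \<omega> + b)) = Re (c * iexp b * (CLINT \<omega>|M. iexp (t \<bullet> Y \<omega>)))"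
proof -
  have int: "integrable M (\<lambda>\<omega>. iexp (t \<bullet> Y \<omega>))"
    by (intro integrable_const_bound[where B=1]) auto
  have "Re (c * iexp b * (CLINT \<omega>|M. iexp (t \<bullet> Y \<omega>))) = Re (CLINT \<omega>|M. c * iexp b * iexp (t \<bullet> Y \<omega>))"
    by simp
  also have "\<dots> = expectation (\<lambda>\<omega>. Re (c * iexp b * iexp (t \<bullet> Y \<omega>)))"
    using int by (intro integral_Re[symmetric]) auto
  also have "\<dots> = expectation (\<lambda>\<omega>. c * cos (t \<bullet> Y \<omega> + b))"
    by (intro Bochner_Integration.integral_cong)
       (auto simp: Re_exp Im_exp cos_add algebra_simps exp_add[symmetric])
  finally show ?thesis by simp
qed

lemma trig_polynomial_expectation_converges:
  fixes Z :: "nat \<Rightarrow> 'w \<Rightarrow> 'a::euclidean_space"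
  assumes P: "\<And>n. prob_space (P n)" and Z: "\<And>n. Z n \<in> borel_measurable (P n)"
    and G: "prob_space G" "sets G = sets borel"
    and char: "\<And>t. (\<lambda>n. LINT \<omega>|P n. iexp (t \<bullet> Z n \<omega>)) \<longlonglongrightarrow> (LINT v|G. iexp (t \<bullet> v))"
    and h: "trig_polynomial h"
  shows "(\<lambda>n. LINT \<omega>|P n. h (Z n \<omega>)) \<longlonglongrightarrow> (LINT v|G. h v)"
  using h
proof induction
  case (wave c t b)
  have Gm: "(\<lambda>v. v) \<in> borel_measurable G"
    using G(2) by (simp add: measurable_ident_sets)
  show ?case
    unfolding prob_space.expectation_wave[OF P Z] prob_space.expectation_wave[OF G(1) Gm]
    by (intro tendsto_intros char)
next
  case (add g h)
  have "(LINT v|G. g v + h v) = (LINT v|G. g v) + (LINT v|G. h v)"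
    using add prob_space.integrable_trig_polynomial[OF G(1), of _ "\<lambda>v. v"] G(2)
    by (intro Bochner_Integration.integral_add) (simp_all add: measurable_ident_sets)
  moreover have "(LINT v|P n. g (Z n v) + h (Z n v)) = (LINT v|P n. g (Z n v)) + (LINT v|P n. h (Z n v))" for n
    using add prob_space.integrable_trig_polynomial[OF P _ Z]
    by (intro Bochner_Integration.integral_add) simp_all
  ultimately show ?case using add by (auto intro!: tendsto_intros)
qed

lemma vec_nth_borel_measurable: "(\<lambda>v::real^'p. v $ j) \<in> borel_measurable borel"
  by (intro borel_measurable_continuous_onI continuous_intros)

text \<open>A continuous substitute for the indicator of the tail \<open>\<bar>x\<bar> > K\<close>: it is 0 up to \<open>K\<close> and 1 from \<open>K + 1\<close> on.\<close>

definition excess :: "real \<Rightarrow> real \<Rightarrow> real" where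
  "excess K x = min 1 (max 0 (\<bar>x\<bar> - K))"

lemma excess_bounds: "0 \<le> excess K x" "excess K x \<le> 1"
  by (auto simp: excess_def)

lemma isCont_excess: "isCont (excess K) x"
  unfolding excess_def[abs_def] by (intro continuous_intros)

lemma excess_measurable [measurable]: "excess K \<in> borel_measurable borel"
  unfolding excess_def[abs_def] by measurable

text \<open>Tightness enters through this lemma: the tails of each coordinate converge by the
  one-dimensional continuity theorem.\<close>

lemma coordinate_excess_converges:
  fixes Z :: "nat \<Rightarrow> 'w \<Rightarrow> real^'p"
  assumes P: "\<And>n. prob_space (P n)" and Z: "\<And>n. Z n \<in> borel_measurable (P n)"
    and G: "prob_space G" "sets G = sets borel"
    and char: "\<And>t. (\<lambda>n. LINT \<omega>|P n. iexp (t \<bullet> Z n \<omega>)) \<longlonglongrightarrow> (LINT v|G. iexp (t \<bullet> v))"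
  shows "(\<lambda>n. LINT \<omega>|P n. excess K (Z n \<omega> $ j)) \<longlonglongrightarrow> (LINT v|G. excess K (v $ j))"
proof -
  note Z[measurable]
  have Gm[measurable]: "(\<lambda>v. v) \<in> borel_measurable G"
    using G(2) by (simp add: measurable_ident_sets)
  have Gj[measurable]: "(\<lambda>v. v $ j) \<in> borel_measurable G"
    using measurable_compose[OF Gm vec_nth_borel_measurable] .
  have Zj[measurable]: "(\<lambda>\<omega>. Z n \<omega> $ j) \<in> borel_measurable (P n)" for n
    using measurable_compose[OF Z vec_nth_borel_measurable] .
  let ?M = "\<lambda>n. distr (P n) borel (\<lambda>\<omega>. Z n \<omega> $ j)"
  let ?M' = "distr G borel (\<lambda>v. v $ j)"
  have rd: "real_distribution (?M n)" for n
    using prob_space.prob_space_distr[OF P Zj, of n] by (simp add: real_distribution_def real_distribution_axioms_def)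
  have rd': "real_distribution ?M'"
    using prob_space.prob_space_distr[OF G(1) Gj] by (simp add: real_distribution_def real_distribution_axioms_def)
  have inner: "(t *\<^sub>R axis j 1) \<bullet> v = t * v $ j" for t and v :: "real^'p"
    by (simp add: inner_axis' )
  have "weak_conv_m ?M ?M'"
  proof (rule levy_continuity[OF rd rd'])
    fix t
    show "(\<lambda>n. char (?M n) t) \<longlonglongrightarrow> char ?M' t"
      using char[of "t *\<^sub>R axis j 1"] unfolding char_def inner
      by (subst (1 2) integral_distr) auto
  qed
  then have "(\<lambda>n. integral\<^sup>L (?M n) (excess K)) \<longlonglongrightarrow> integral\<^sup>L ?M' (excess K)"
    using rd rd'
    by (intro weak_conv_imp_integral_bdd_continuous_conv[where B=1])
       (auto simp: excess_bounds isCont_excess)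
  then show ?thesis
    by (subst (asm) (1 2) integral_distr) auto
qed

lemma (in prob_space) expectation_diff_le:
  fixes g h s :: "'b::topological_space \<Rightarrow> real"
  assumes [measurable]: "V \<in> borel_measurable M" "g \<in> borel_measurable borel" "h \<in> borel_measurable borel"
      "s \<in> borel_measurable borel"
    and bounded: "\<And>v. \<bar>g v\<bar> \<le> B" "\<And>v. \<bar>h v\<bar> \<le> B'" "\<And>v. \<bar>s v\<bar> \<le> B''"
    and le: "\<And>v. \<bar>g v - h v\<bar> \<le> e + b * s v"
  shows "\<bar>expectation (\<lambda>\<omega>. g (V \<omega>)) - expectation (\<lambda>\<omega>. h (V \<omega>))\<bar> \<le> e + b * expectation (\<lambda>\<omega>. s (V \<omega>))"
proof -
  have int: "integrable M (\<lambda>\<omega>. g (V \<omega>))" "integrable M (\<lambda>\<omega>. h (V \<omega>))" "integrable M (\<lambda>\<omega>. s (V \<omega>))"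
    by (rule integrable_const_bound[where B=B] integrable_const_bound[where B=B'] integrable_const_bound[where B=B''],
        simp add: bounded, measurable)+
  have "\<bar>expectation (\<lambda>\<omega>. g (V \<omega>)) - expectation (\<lambda>\<omega>. h (V \<omega>))\<bar> \<le> expectation (\<lambda>\<omega>. \<bar>g (V \<omega>) - h (V \<omega>)\<bar>)"
    unfolding Bochner_Integration.integral_diff[OF int(1,2), symmetric] by (rule integral_abs_bound)
  also have "\<dots> \<le> expectation (\<lambda>\<omega>. e + b * s (V \<omega>))"
    using int by (intro integral_mono le) auto
  also have "\<dots> = e + b * expectation (\<lambda>\<omega>. s (V \<omega>))" using int by (simp add: prob_space)
  finally show ?thesis .
qed

text \<open>On a large cube a test function \<open>g\<close> is a continuous function of the sines \<open>sin (v $ j / L)\<close>,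
  because the sine is invertible near 0. A polynomial in these sines that approximates this
  function on \<open>[-1, 1]\<^sup>p\<close> is a trigonometric polynomial and is close to a bounded function on the whole space,
  not only on the cube; so the mass outside the cube contributes little.\<close>

theorem multivariate_levy_continuity:
  fixes Z :: "nat \<Rightarrow> 'w \<Rightarrow> real^'p"
  assumes P: "\<And>n. prob_space (P n)" and Z: "\<And>n. Z n \<in> borel_measurable (P n)"
    and G: "prob_space G" "sets G = sets borel"
    and char: "\<And>t. (\<lambda>n. LINT \<omega>|P n. iexp (t \<bullet> Z n \<omega>)) \<longlonglongrightarrow> (LINT v|G. iexp (t \<bullet> v))"
    and g: "continuous_on UNIV g" "bounded (range g)"
  shows "(\<lambda>n. LINT \<omega>|P n. g (Z n \<omega>)) \<longlonglongrightarrow> (LINT v|G. (g v :: real))"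
proof -
  note Z[measurable]
  have Gm[measurable]: "(\<lambda>v. v) \<in> borel_measurable G"
    using G(2) by (simp add: measurable_ident_sets)
  have Gj[measurable]: "(\<lambda>v. v $ j) \<in> borel_measurable G" for j
    using measurable_compose[OF Gm vec_nth_borel_measurable] .
  have Zj[measurable]: "(\<lambda>\<omega>. Z n \<omega> $ j) \<in> borel_measurable (P n)" for n j
    using measurable_compose[OF Z vec_nth_borel_measurable] .
  have gm[measurable]: "g \<in> borel_measurable borel"
    using g(1) by (rule borel_measurable_continuous_onI)
  interpret G: prob_space G by fact
  interpret P: prob_space "P n" for n by (rule P)
  obtain B where B: "\<And>x. \<bar>g x\<bar> \<le> B"
    using g(2) unfolding bounded_iff by (metis rangeI real_norm_def)
  then have B0: "0 \<le> B" using abs_ge_zero order_trans by blast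
  have tight: "(\<lambda>m. LINT v|G. (\<Sum>j\<in>UNIV. excess (real m) (v $ j))) \<longlonglongrightarrow> (LINT v|G. 0)"
  proof (rule integral_dominated_convergence[where w="\<lambda>_. CARD('p)"])
    have "(\<lambda>m. \<Sum>j\<in>(UNIV::'p set). excess (real m) (v $ j)) \<longlonglongrightarrow> (\<Sum>j\<in>(UNIV::'p set). 0)" for v
    proof (intro tendsto_sum tendsto_eventually)
      fix j :: 'p
      show "\<forall>\<^sub>F m in sequentially. excess (real m) (v $ j) = 0"
        using eventually_ge_at_top[of "nat \<lceil>\<bar>v $ j\<bar>\<rceil>"]
      proof eventually_elim
        case (elim m)
        then have "\<bar>v $ j\<bar> \<le> real m" by linarith
        then show ?case by (simp add: excess_def)
      qed
    qed
    then show "AE v in G. (\<lambda>m. \<Sum>j\<in>UNIV. excess (real m) (v $ j)) \<longlonglongrightarrow> 0" by simp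
    show "AE v in G. norm (\<Sum>j\<in>UNIV. excess (real i) (v $ j)) \<le> real CARD('p)" for i
    proof (rule AE_I2)
      fix v :: "real^'p"
      have "(\<Sum>j\<in>UNIV. excess (real i) (v $ j)) \<le> (\<Sum>j\<in>(UNIV::'p set). 1)"
        by (intro sum_mono excess_bounds)
      then show "norm (\<Sum>j\<in>UNIV. excess (real i) (v $ j)) \<le> real CARD('p)"
        by (simp add: sum_nonneg excess_bounds)
    qed
  qed auto
  show ?thesis
  proof (rule LIMSEQ_I)
    fix r :: real assume r: "0 < r"
    \<comment> \<open>Chosen so that the three sources of error below, \<open>3 e + 6 B e\<close> in total, stay below \<open>r\<close>.\<close>
    define e where "e = r / (4 + 6 * B)"
    have e: "e > 0" using r B0 by (simp add: e_def)
    obtain m where m: "(LINT v|G. (\<Sum>j\<in>UNIV. excess (real m) (v $ j))) < e"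
      using order_tendstoD(2)[OF tight, of e] e by (auto simp: eventually_sequentially)
    define S where "S = (LINT v|G. (\<Sum>j\<in>UNIV. excess (real m) (v $ j)))"
    define Sn where "Sn n = (LINT \<omega>|P n. (\<Sum>j\<in>UNIV. excess (real m) (Z n \<omega> $ j)))" for n
    \<comment> \<open>For \<open>\<bar>v $ j\<bar> \<le> L\<close> the argument of the sine is at most \<open>1 < pi / 2\<close>, so the arcsine inverts it.\<close>
    define L where "L = real m + 1"
    have L: "L > 0" by (simp add: L_def)
    define s :: "real^'p \<Rightarrow> real^'p" where "s v = (\<chi> j. sin (v $ j / L))" for v
    define g' where "g' u = g (\<chi> j. L * arcsin (u $ j))" for u :: "real^'p"
    define C :: "(real^'p) set" where "C = cbox (\<chi> j. -1) (\<chi> j. 1)"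
    have C: "u \<in> C \<longleftrightarrow> (\<forall>j. -1 \<le> u $ j \<and> u $ j \<le> 1)" for u
      unfolding C_def mem_box_cart by simp
    have sC: "s v \<in> C" for v unfolding C by (simp add: s_def)
    have cg': "continuous_on C g'"
      unfolding g'_def
      by (rule continuous_on_compose2[OF g(1)])
         (auto intro!: continuous_intros continuous_on_arcsin simp: C)
    obtain q where q: "trig_polynomial (\<lambda>v. q (s v))" "\<And>u. u \<in> C \<Longrightarrow> \<bar>g' u - q u\<bar> < e"
    proof -
      have "\<exists>q. (continuous_on C q \<and> trig_polynomial (\<lambda>v. q (s v))) \<and> (\<forall>u\<in>C. \<bar>g' u - q u\<bar> < e)"
      proof (rule Stone_Weierstrass_HOL[OF _ _ _ _ _ _ cg' e])
        show "compact C" unfolding C_def by simp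
        fix x y :: "real^'p" assume "x \<in> C \<and> y \<in> C \<and> x \<noteq> y"
        then obtain j where j: "x $ j \<noteq> y $ j" by (auto simp: vec_eq_iff)
        have "(\<lambda>v. s v $ j) = (\<lambda>v. sin (((1 / L) *\<^sub>R axis j 1) \<bullet> v))"
          by (auto simp: s_def inner_axis' fun_eq_iff)
        then have "trig_polynomial (\<lambda>v. s v $ j)"
          by (simp only:) (rule trig_polynomial_sin)
        then show "\<exists>f. (continuous_on C f \<and> trig_polynomial (\<lambda>v. f (s v))) \<and> f x \<noteq> f y"
          using j by (intro exI[of _ "\<lambda>u. u $ j"]) (auto intro!: continuous_intros)
      qed (auto intro!: continuous_intros trig_polynomial_mult trig_polynomial.add trig_polynomial_const)
      then show thesis using that by blast
    qed
    define h where "h v = q (s v)" for v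
    have h: "trig_polynomial h" using q(1) by (simp add: h_def[abs_def])
    have hm[measurable]: "h \<in> borel_measurable borel"
      using trig_polynomial_continuous[OF h] by (rule borel_measurable_continuous_onI)
    have bound: "\<bar>g v - h v\<bar> \<le> e + 2 * B * (\<Sum>j\<in>UNIV. excess (real m) (v $ j))" for v
    proof (cases "\<forall>j. \<bar>v $ j\<bar> \<le> L")
      case True
      have "arcsin (sin (v $ j / L)) = v $ j / L" for j
      proof (rule arcsin_sin)
        have "\<bar>v $ j / L\<bar> \<le> 1" using True L by (simp add: abs_div)
        then have "- 1 \<le> v $ j / L" "v $ j / L \<le> 1" by linarith+
        then show "- (pi / 2) \<le> v $ j / L" "v $ j / L \<le> pi / 2"
          using pi_ge_two by linarith+
      qed
      then have "(\<chi> j. L * arcsin (s v $ j)) = v"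
        using L by (simp add: s_def vec_eq_iff)
      then have "g' (s v) = g v" by (simp add: g'_def)
      then have "\<bar>g v - h v\<bar> < e" using q(2)[OF sC, of v] by (simp add: h_def)
      moreover have "0 \<le> 2 * B * (\<Sum>j\<in>UNIV. excess (real m) (v $ j))"
        using B0 by (intro mult_nonneg_nonneg sum_nonneg excess_bounds) auto
      ultimately show ?thesis by linarith
    next
      case False
      then obtain j where "\<bar>v $ j\<bar> > L" unfolding not_all not_le by blast
      then have "1 \<le> excess (real m) (v $ j)" by (auto simp: excess_def L_def)
      also have "\<dots> \<le> (\<Sum>j\<in>UNIV. excess (real m) (v $ j))"
        by (rule member_le_sum) (auto simp: excess_bounds)
      finally have "2 * B * 1 \<le> 2 * B * (\<Sum>j\<in>UNIV. excess (real m) (v $ j))"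
        using B0 by (intro mult_left_mono) auto
      moreover have "\<bar>g v - g' (s v)\<bar> \<le> 2 * B"
        using B[of v] B[of "\<chi> j. L * arcsin (s v $ j)"] unfolding g'_def by linarith
      moreover have "\<bar>g' (s v) - h v\<bar> < e" using q(2)[OF sC, of v] by (simp add: h_def)
      ultimately show ?thesis by linarith
    qed
    obtain Bh where Bh: "\<And>x. \<bar>h x\<bar> \<le> Bh" using trig_polynomial_bounded[OF h] by auto
    have eb: "\<bar>\<Sum>j\<in>UNIV. excess (real m) (v $ j)\<bar> \<le> CARD('p)" for v :: "real^'p"
      using sum_mono[of UNIV "\<lambda>j. excess (real m) (v $ j)" "\<lambda>_. 1"]
      by (simp add: sum_nonneg excess_bounds)
    have em: "(\<lambda>v::real^'p. \<Sum>j\<in>UNIV. excess (real m) (v $ j)) \<in> borel_measurable borel"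
      by (intro borel_measurable_sum measurable_compose[OF vec_nth_borel_measurable excess_measurable])
    note est = gm hm em B Bh eb bound
    have G_est: "\<bar>(LINT v|G. g v) - (LINT v|G. h v)\<bar> \<le> e + 2 * B * S"
      unfolding S_def by (rule G.expectation_diff_le[OF Gm est])
    have P_est: "\<bar>(LINT \<omega>|P n. g (Z n \<omega>)) - (LINT \<omega>|P n. h (Z n \<omega>))\<bar> \<le> e + 2 * B * Sn n" for n
      unfolding Sn_def by (rule P.expectation_diff_le[OF Z est])
    have "Sn \<longlonglongrightarrow> S"
    proof -
      have "Sn = (\<lambda>n. \<Sum>j\<in>UNIV. LINT \<omega>|P n. excess (real m) (Z n \<omega> $ j))"
        unfolding Sn_def
        by (intro ext Bochner_Integration.integral_sum P.integrable_const_bound[where B=1])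
           (auto simp: excess_bounds)
      moreover have "S = (\<Sum>j\<in>UNIV. LINT v|G. excess (real m) (v $ j))"
        unfolding S_def
        by (intro Bochner_Integration.integral_sum G.integrable_const_bound[where B=1])
           (auto simp: excess_bounds)
      ultimately show ?thesis
        using coordinate_excess_converges[OF P Z G char] by (simp add: tendsto_sum)
    qed
    then have "\<forall>\<^sub>F n in sequentially. Sn n < 2 * e"
      using m e by (intro order_tendstoD) (auto simp: S_def)
    moreover have "\<forall>\<^sub>F n in sequentially. dist (LINT \<omega>|P n. h (Z n \<omega>)) (LINT v|G. h v) < e"
      using trig_polynomial_expectation_converges[OF P Z G char h] e by (rule tendstoD)
    ultimately have "\<forall>\<^sub>F n in sequentially. norm ((LINT \<omega>|P n. g (Z n \<omega>)) - (LINT v|G. g v)) < r"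
    proof eventually_elim
      case (elim n)
      have "S \<le> e" using m by (simp add: S_def)
      then have "2 * B * S \<le> 2 * B * e" using B0 by (intro mult_left_mono) auto
      moreover have "2 * B * Sn n \<le> 2 * B * (2 * e)" using elim(1) B0 by (intro mult_left_mono) auto
      moreover have "\<bar>(LINT \<omega>|P n. g (Z n \<omega>)) - (LINT v|G. g v)\<bar> < e + (e + 2 * B * S) + (e + 2 * B * Sn n)"
        using P_est[of n] elim(2) G_est unfolding dist_real_def by linarith
      ultimately have "\<bar>(LINT \<omega>|P n. g (Z n \<omega>)) - (LINT v|G. g v)\<bar> < e + (e + 2 * B * e) + (e + 2 * B * (2 * e))"
        by linarith
      also have "\<dots> \<le> (4 + 6 * B) * e" using e by (simp add: algebra_simps)
      also have "\<dots> = r" using B0 by (simp add: e_def)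
      finally show ?case by simp
    qed
    then show "\<exists>no. \<forall>n\<ge>no. norm ((LINT \<omega>|P n. g (Z n \<omega>)) - (LINT v|G. g v)) < r"
      by (simp add: eventually_sequentially)
  qed
qed


section \<open>Centred Gaussian laws with a given covariance matrix\<close>

text \<open>One step of a Cholesky decomposition: if \<open>A $ i $ i > 0\<close>, subtract the square of the linear form
  given by row \<open>i\<close> divided by the root of \<open>A $ i $ i\<close>. What remains is the minimum of the quadratic form along the
  \<open>i\<close>-th axis, so it is positive semidefinite, and it has one more zero on the diagonal.\<close>

lemma psd_sum_of_squares:
  fixes A :: "real^'p^'p"
  assumes "\<And>i j. A $ i $ j = A $ j $ i" and "\<And>a. 0 \<le> a \<bullet> (A *v a)"
  shows "\<exists>(K::nat) b :: nat \<Rightarrow> real^'p. \<forall>i j. A $ i $ j = (\<Sum>k<K. b k $ i * b k $ j)"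
  using assms
proof (induction "card {i. A $ i $ i \<noteq> 0}" arbitrary: A rule: less_induct)
  case less
  note sym = less.prems(1) and psd = less.prems(2)
  have entry: "axis i 1 \<bullet> (A *v axis j 1) = A $ i $ j" for i j
    by (simp add: inner_axis' matrix_vector_mult_basis column_def)
  show ?case
  proof (cases "\<forall>i. A $ i $ i = 0")
    case True
    have "A $ i $ j = 0" for i j
    proof -
      have "(axis i 1 + axis j 1) \<bullet> (A *v (axis i 1 + axis j 1)) = 2 * A $ i $ j"
        using True sym[of j i] by (simp add: matrix_vector_right_distrib inner_add_left inner_add_right entry)
      moreover have "(axis i 1 - axis j 1) \<bullet> (A *v (axis i 1 - axis j 1)) = - 2 * A $ i $ j"
        using True sym[of j i] by (simp add: matrix_vector_mult_diff_distrib inner_diff_left inner_diff_right entry)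
      ultimately show ?thesis
        using psd[of "axis i 1 + axis j 1"] psd[of "axis i 1 - axis j 1"] by linarith
    qed
    then show ?thesis by (intro exI[of _ 0]) auto
  next
    case False
    then obtain i where i: "A $ i $ i \<noteq> 0" by auto
    define c where "c = A $ i $ i"
    have c: "c > 0" using psd[of "axis i 1"] i unfolding entry c_def by simp
    \<comment> \<open>The Schur complement of the entry \<open>c\<close>.\<close>
    define A' :: "real^'p^'p" where "A' = (\<chi> j l. A $ j $ l - A $ i $ j * A $ i $ l / c)"
    have A'_row: "A' *v a = A *v a - ((A $ i \<bullet> a) / c) *\<^sub>R A $ i" for a
      by (simp add: vec_eq_iff A'_def matrix_vector_mult_def inner_vec_def sum_subtractf left_diff_distrib
          sum_divide_distrib sum_distrib_left sum_distrib_right algebra_simps)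
    have "0 \<le> a \<bullet> (A' *v a)" for a
    proof -
      define s where "s = (A $ i \<bullet> a) / c"
      have 1: "axis i 1 \<bullet> (A *v a) = A $ i \<bullet> a"
        by (simp add: inner_axis' matrix_vector_mul_component)
      have 2: "A *v axis i 1 = A $ i"
        by (simp add: matrix_vector_mult_basis column_def vec_eq_iff sym[of _ i])
      have "(a - s *\<^sub>R axis i 1) \<bullet> (A *v (a - s *\<^sub>R axis i 1)) =
          a \<bullet> (A *v a) - 2 * s * (A $ i \<bullet> a) + s * s * c"
        by (simp add: matrix_vector_mult_diff_distrib matrix_vector_mult_scaleR inner_diff_left inner_diff_right
            1[unfolded matrix_vector_mul_component] 2 inner_commute[of a] c_def matrix_vector_mul_component inner_axis inner_axis' algebra_simps)
      also have "\<dots> = a \<bullet> (A' *v a)"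
        using c by (simp add: A'_row inner_diff_right s_def inner_commute[of a] field_simps)
      finally show ?thesis using psd by metis
    qed
    moreover have "A' $ j $ l = A' $ l $ j" for j l
      using sym[of j l] by (simp add: A'_def)
    moreover have "card {j. A' $ j $ j \<noteq> 0} < card {j. A $ j $ j \<noteq> 0}"
    proof (rule psubset_card_mono)
      have "A' $ j $ j = 0" if "A $ j $ j = 0" for j
      proof -
        have "0 \<le> axis j 1 \<bullet> (A' *v axis j 1)" by fact
        also have "\<dots> = - (A $ i $ j)\<^sup>2 / c"
          using that by (simp add: inner_axis' matrix_vector_mult_basis column_def A'_def power2_eq_square)
        finally have "(A $ i $ j)\<^sup>2 \<le> 0" using c by (simp add: divide_le_0_iff)
        then have "A $ i $ j = 0" by simp
        then show ?thesis using that by (simp add: A'_def)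
      qed
      moreover have "A' $ i $ i = 0" using c by (simp add: A'_def c_def)
      ultimately show "{j. A' $ j $ j \<noteq> 0} \<subset> {j. A $ j $ j \<noteq> 0}"
        using i by blast
    qed simp
    ultimately obtain K and b :: "nat \<Rightarrow> real^'p"
      where b: "\<And>j l. A' $ j $ l = (\<Sum>k<K. b k $ j * b k $ l)"
      using less.hyps[of A'] by blast
    have "A $ j $ l = (\<Sum>k<Suc K. (b(K := (1 / sqrt c) *\<^sub>R A $ i)) k $ j * (b(K := (1 / sqrt c) *\<^sub>R A $ i)) k $ l)" for j l
    proof -
      have "(\<Sum>k<K. (b(K := (1 / sqrt c) *\<^sub>R A $ i)) k $ j * (b(K := (1 / sqrt c) *\<^sub>R A $ i)) k $ l) = A' $ j $ l"
        unfolding b by (intro sum.cong) auto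
      then show ?thesis using c by (simp add: A'_def)
    qed
    then show ?thesis by blast
  qed
qed

text \<open>Writing \<open>A\<close> as a sum of \<open>b k (b k)\<^sup>T\<close>, the vector \<open>\<Sum>k. \<eta> k *\<^sub>R b k\<close> with independent standard normal
  \<open>\<eta> k\<close> has the required characteristic function.\<close>

lemma exists_measure_with_gaussian_char:
  fixes A :: "real^'p^'p"
  assumes "\<And>i j. A $ i $ j = A $ j $ i" and "\<And>a. 0 \<le> a \<bullet> (A *v a)"
  shows "\<exists>G. prob_space G \<and> sets G = sets borel \<and>
    (\<forall>t. (LINT v|G. iexp (t \<bullet> v)) = complex_of_real (exp (- (t \<bullet> (A *v t)) / 2)))"
proof -
  obtain K :: nat and b :: "nat \<Rightarrow> real^'p" where b: "\<And>i j. A $ i $ j = (\<Sum>k<K. b k $ i * b k $ j)"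
    using psd_sum_of_squares[of A] assms by blast
  define B where "B = Pi\<^sub>M {..<K} (\<lambda>_. std_normal_distribution)"
  interpret N: real_distribution std_normal_distribution by (rule real_dist_normal_dist)
  have int: "integrable std_normal_distribution (\<lambda>x. iexp (s * x))" for s
    by (intro N.integrable_const_bound[where B=1]) (auto simp: norm_exp_i_times simp del: of_real_mult)
  interpret product_prob_space "\<lambda>_::nat. std_normal_distribution" "{..<K}" ..
  interpret B: prob_space B unfolding B_def by (rule prob_space_PiM) unfold_locales
  define V where "V \<eta> = (\<Sum>k<K. \<eta> k *\<^sub>R b k)" for \<eta> :: "nat \<Rightarrow> real"
  have V[measurable]: "V \<in> borel_measurable B"
    unfolding V_def[abs_def] B_def by measurable
  define G where "G = distr B borel V"
  have q: "t \<bullet> (A *v t) = (\<Sum>k<K. (t \<bullet> b k)\<^sup>2)" for t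
  proof -
    have "(\<Sum>k<K. (t \<bullet> b k)\<^sup>2) = (\<Sum>k<K. \<Sum>i\<in>UNIV. \<Sum>j\<in>UNIV. t $ i * b k $ i * (t $ j * b k $ j))"
      by (simp add: power2_eq_square inner_vec_def sum_product)
    also have "\<dots> = (\<Sum>i\<in>UNIV. \<Sum>j\<in>UNIV. \<Sum>k<K. t $ i * b k $ i * (t $ j * b k $ j))"
      by (subst sum.swap) (intro sum.cong refl sum.swap)
    also have "\<dots> = t \<bullet> (A *v t)"
      by (simp add: inner_vec_def matrix_vector_mult_def b sum_distrib_left sum_distrib_right ac_simps)
    finally show ?thesis ..
  qed
  have "(LINT v|G. iexp (t \<bullet> v)) = complex_of_real (exp (- (t \<bullet> (A *v t)) / 2))" for t
  proof -
    have "(LINT v|G. iexp (t \<bullet> v)) = (LINT \<eta>|B. iexp (t \<bullet> V \<eta>))"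
      unfolding G_def by (subst integral_distr) auto
    also have "\<dots> = (LINT \<eta>|B. (\<Prod>k<K. iexp ((t \<bullet> b k) * \<eta> k)))"
      by (simp add: V_def inner_sum_right exp_sum[symmetric] sum_distrib_left ac_simps)
    also have "\<dots> = (\<Prod>k<K. (LINT x|std_normal_distribution. iexp ((t \<bullet> b k) * x)))"
      unfolding B_def
      using int by (intro product_integral_prod) auto
    also have "\<dots> = (\<Prod>k<K. complex_of_real (exp (- (t \<bullet> b k)\<^sup>2 / 2)))"
      unfolding char_def[symmetric] char_std_normal_distribution ..
    also have "\<dots> = complex_of_real (exp (- (t \<bullet> (A *v t)) / 2))"
      by (simp add: q exp_sum[symmetric] of_real_prod[symmetric] sum_negf sum_divide_distrib[symmetric] del: of_real_prod)
    finally show ?thesis .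
  qed
  moreover have "prob_space G" unfolding G_def by (rule B.prob_space_distr) simp
  moreover have "sets G = sets borel" by (simp add: G_def)
  ultimately show ?thesis by blast
qed

lemma gaussian_real_scaled_normal: "gaussian_real (distr std_normal_distribution borel (\<lambda>x. s * x))"
proof (cases "s = 0")
  case True
  interpret real_distribution std_normal_distribution by (rule real_dist_normal_dist)
  have "distr std_normal_distribution borel (\<lambda>x. s * x) = return borel 0"
    using True by simp
  then show ?thesis unfolding gaussian_real_def by blast
next
  case False
  interpret real_distribution std_normal_distribution by (rule real_dist_normal_dist)
  have "distributed std_normal_distribution lborel (\<lambda>x. x) (normal_density 0 1)"
    unfolding distributed_def by (auto intro!: distr_id2 simp: normal_density_nonneg)
  from normal_density_affine[OF this, of s 0] False
  have "distributed std_normal_distribution lborel (\<lambda>x. s * x) (normal_density 0 \<bar>s\<bar>)" by simp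
  then have "distr std_normal_distribution lborel (\<lambda>x. s * x) = density lborel (normal_density 0 \<bar>s\<bar>)"
    by (simp add: distributed_def)
  moreover have "distr std_normal_distribution lborel (\<lambda>x. s * x) = distr std_normal_distribution borel (\<lambda>x. s * x)"
    by (intro distr_cong) auto
  ultimately show ?thesis
    using False unfolding gaussian_real_def by (intro disjI2 exI[of _ 0] exI[of _ "\<bar>s\<bar>"]) auto
qed

text \<open>Every linear form \<open>a \<bullet> v\<close> has the law of \<open>sqrt (a \<bullet> (A *v a))\<close> times a standard normal variable,
  by uniqueness of characteristic functions; second moments of linear forms determine the
  covariances by polarization.\<close>

lemma centered_gaussian_if_char:
  fixes A :: "real^'p^'p"
  assumes G: "prob_space G" "sets G = sets borel"
    and sym: "\<And>i j. A $ i $ j = A $ j $ i" and psd: "\<And>a. 0 \<le> a \<bullet> (A *v a)"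
    and char: "\<And>t. (LINT v|G. iexp (t \<bullet> v)) = complex_of_real (exp (- (t \<bullet> (A *v t)) / 2))"
  shows "centered_gaussian A G"
proof -
  interpret N: real_distribution std_normal_distribution by (rule real_dist_normal_dist)
  interpret G: prob_space G by fact
  have Gm[measurable]: "(\<lambda>v. v) \<in> borel_measurable G"
    using G(2) by (simp add: measurable_ident_sets)
  have am[measurable]: "(\<lambda>v. a \<bullet> v) \<in> borel_measurable G" for a
    by measurable
  have law: "distr G borel (\<lambda>v. a \<bullet> v) = distr std_normal_distribution borel (\<lambda>x. sqrt (a \<bullet> (A *v a)) * x)" (is "?D = ?E") for a
  proof (rule Levy_uniqueness)
    show "real_distribution ?D"
      using G.prob_space_distr[OF am] by (simp add: real_distribution_def real_distribution_axioms_def)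
    show "real_distribution ?E"
      using N.prob_space_distr[of "\<lambda>x. sqrt (a \<bullet> (A *v a)) * x" borel]
      by (simp add: real_distribution_def real_distribution_axioms_def)
    show "char ?D = char ?E"
    proof
      fix t
      have "char ?D t = (LINT v|G. iexp ((t *\<^sub>R a) \<bullet> v))"
        unfolding char_def by (subst integral_distr) auto
      also have "\<dots> = complex_of_real (exp (- (t * sqrt (a \<bullet> (A *v a)))\<^sup>2 / 2))"
        unfolding char using psd[of a]
        by (simp add: matrix_vector_mult_scaleR power_mult_distrib) (simp add: power2_eq_square ac_simps)
      also have "\<dots> = char std_normal_distribution (t * sqrt (a \<bullet> (A *v a)))"
        unfolding char_std_normal_distribution ..
      also have "\<dots> = char ?E t"
        unfolding char_def by (subst integral_distr) (auto simp: ac_simps)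
      finally show "char ?D t = char ?E t" .
    qed
  qed
  have N2: "integrable std_normal_distribution (\<lambda>x. (s * x)\<^sup>2)" "(LINT x|std_normal_distribution. (s * x)\<^sup>2) = s\<^sup>2"
    and N1: "integrable std_normal_distribution (\<lambda>x. s * x)" "(LINT x|std_normal_distribution. s * x) = 0" for s
    using std_normal_distribution_even_moments[of 1] integrable_std_normal_distribution_moment[of 1]
      integral_std_normal_distribution_moment_odd[of 1]
    by (auto simp: power_mult_distrib)
  have i1: "integrable G (\<lambda>v. a \<bullet> v)" for a
    using N1(1)[of "sqrt (a \<bullet> (A *v a))"] integrable_distr_eq[OF am, of "\<lambda>x. x" a] law[of a]
    by (simp add: integrable_distr_eq)
  have e1: "(LINT v|G. a \<bullet> v) = 0" for a
  proof -
    have "(LINT v|G. a \<bullet> v) = (LINT x|distr G borel (\<lambda>v. a \<bullet> v). x)"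
      by (subst integral_distr) auto
    also have "\<dots> = (LINT x|std_normal_distribution. sqrt (a \<bullet> (A *v a)) * x)"
      unfolding law by (subst integral_distr) auto
    finally show ?thesis unfolding N1(2) .
  qed
  have i2: "integrable G (\<lambda>v. (a \<bullet> v)\<^sup>2)" for a
    using N2(1)[of "sqrt (a \<bullet> (A *v a))"] integrable_distr_eq[OF am, of "\<lambda>x. x\<^sup>2" a] law[of a]
    by (simp add: integrable_distr_eq)
  have e2: "(LINT v|G. (a \<bullet> v)\<^sup>2) = a \<bullet> (A *v a)" for a
    using N2(2)[of "sqrt (a \<bullet> (A *v a))"] integral_distr[OF am, of "\<lambda>x. x\<^sup>2" a] law[of a] psd[of a]
    by (simp add: integral_distr)
  have nth: "v $ i = axis i 1 \<bullet> v" for v :: "real^'p" and i by (simp add: inner_axis')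
  have entry: "axis i 1 \<bullet> (A *v axis j 1) = A $ i $ j" for i j
    by (simp add: inner_axis' matrix_vector_mult_basis column_def)
  have cov: "(LINT v|G. v $ i * v $ j) = A $ i $ j" for i j
  proof -
    have "(LINT v|G. v $ i * v $ j) =
      (LINT v|G. (((axis i 1 + axis j 1) \<bullet> v)\<^sup>2 - (axis i 1 \<bullet> v)\<^sup>2 - (axis j 1 \<bullet> v)\<^sup>2) / 2)"
      unfolding nth by (intro Bochner_Integration.integral_cong) (auto simp: inner_add_left power2_eq_square algebra_simps)
    also have "\<dots> = ((axis i 1 + axis j 1) \<bullet> (A *v (axis i 1 + axis j 1)) - A $ i $ i - A $ j $ j) / 2"
      using i2 by (simp add: e2 entry)
    also have "\<dots> = A $ i $ j"
      by (simp add: matrix_vector_right_distrib inner_add_left inner_add_right entry sym[of j i])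
    finally show ?thesis .
  qed
  have m: "(LINT v|G. v $ i) = 0" for i using e1[of "axis i 1"] by (simp add: inner_axis')
  have "has_covariance_matrix G A"
    unfolding has_covariance_matrix_def m using i2 cov by (simp add: nth)
  then show ?thesis
    unfolding centered_gaussian_def law using G m gaussian_real_scaled_normal by auto
qed


section \<open>A central limit theorem for weighted sums of independent variables\<close>

lemma exp_minus_quadratic_bound:
  fixes x :: real
  assumes "0 \<le> x"
  shows "\<bar>(1 - x) - exp (- x)\<bar> \<le> x\<^sup>2 / 2"
proof -
  have "1 + x + x\<^sup>2 / 2 \<le> exp x" using exp_lower_Taylor_quadratic assms by auto
  then have "1 * exp (- x) \<le> (1 + x\<^sup>2 * x\<^sup>2 / 4) * exp (- x)"
    by (intro mult_right_mono) auto
  also have "1 + x\<^sup>2 * x\<^sup>2 / 4 = (1 - x + x\<^sup>2 / 2) * (1 + x + x\<^sup>2 / 2)"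
    by (simp add: power2_eq_square field_simps)
  also have "\<dots> * exp (- x) \<le> (1 - x + x\<^sup>2 / 2) * exp x * exp (- x)"
  proof (intro mult_right_mono mult_left_mono)
    have "0 \<le> (1 - x)\<^sup>2 / 2" by simp
    then show "0 \<le> 1 - x + x\<^sup>2 / 2" by (simp add: power2_eq_square algebra_simps)
  qed (use \<open>1 + x + x\<^sup>2 / 2 \<le> exp x\<close> in auto)
  also have "\<dots> = 1 - x + x\<^sup>2 / 2" by (simp add: mult.assoc exp_minus_inverse)
  finally have "exp (- x) \<le> 1 - x + x\<^sup>2 / 2" by simp
  moreover have "1 - x \<le> exp (- x)" using exp_ge_add_one_self[of "- x"] by simp
  ultimately show ?thesis by (simp add: abs_le_iff)
qed

text \<open>A second-order expansion for a centred variable that is only known up to a small error \<open>V\<close> in mean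
  square. Where \<open>V\<close> dominates, the quadratic bound on the remainder of the exponential is used, and where
  \<open>U\<close> dominates, the cubic one; so no third moment of \<open>V\<close> occurs.\<close>

lemma (in prob_space) char_approx_perturbed:
  fixes U V X :: "'a \<Rightarrow> real"
  assumes m[measurable]: "U \<in> borel_measurable M" "V \<in> borel_measurable M"
    and X: "X = (\<lambda>\<omega>. U \<omega> + V \<omega>)"
    and mean: "expectation X = 0"
    and int: "integrable M (\<lambda>\<omega>. U \<omega> ^ 2)" "integrable M (\<lambda>\<omega>. V \<omega> ^ 2)" "integrable M (\<lambda>\<omega>. \<bar>U \<omega>\<bar> ^ 3)"
    and \<eta>: "0 < \<eta>" "\<eta> \<le> 1" "\<bar>expectation (\<lambda>\<omega>. U \<omega> ^ 2) - 1\<bar> \<le> \<eta>" "expectation (\<lambda>\<omega>. V \<omega> ^ 2) \<le> \<eta>\<^sup>2"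
    and C: "expectation (\<lambda>\<omega>. \<bar>U \<omega>\<bar> ^ 3) \<le> C"
  shows "cmod (char (distr M borel X) t - exp (- t\<^sup>2 / 2)) \<le> t\<^sup>2 * (7 * \<eta> + 2 * C * \<bar>t\<bar> + t\<^sup>2)"
proof -
  have Xm[measurable]: "X \<in> borel_measurable M" unfolding X by measurable
  have i2: "integrable M (\<lambda>\<omega>. X \<omega> ^ 2)"
  proof (rule Bochner_Integration.integrable_bound)
    show "integrable M (\<lambda>\<omega>. 2 * U \<omega> ^ 2 + 2 * V \<omega> ^ 2)" using int by auto
    have "(u + v)\<^sup>2 \<le> 2 * u\<^sup>2 + 2 * v\<^sup>2" for u v :: real
      using sum_squares_bound[of u v] by (simp add: power2_sum)
    then show "AE \<omega> in M. norm (X \<omega> ^ 2) \<le> norm (2 * U \<omega> ^ 2 + 2 * V \<omega> ^ 2)"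
      by (intro AE_I2) (simp add: X)
  qed simp
  have i1: "integrable M X" using square_integrable_imp_integrable[OF Xm i2] .
  have iUV: "integrable M (\<lambda>\<omega>. U \<omega> * V \<omega>)"
  proof (rule Bochner_Integration.integrable_bound)
    show "integrable M (\<lambda>\<omega>. U \<omega> ^ 2 + V \<omega> ^ 2)" using int by auto
    have "\<bar>u * v\<bar> \<le> u\<^sup>2 + v\<^sup>2" for u v :: real
      using sum_squares_bound[of "\<bar>u\<bar>" "\<bar>v\<bar>"] mult_nonneg_nonneg[OF abs_ge_zero abs_ge_zero, of u v]
      by (simp only: abs_mult power2_abs)
    then show "AE \<omega> in M. norm (U \<omega> * V \<omega>) \<le> norm (U \<omega> ^ 2 + V \<omega> ^ 2)"
      by (intro AE_I2) simp
  qed simp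
  define s2 where "s2 = expectation (\<lambda>\<omega>. X \<omega> ^ 2)"
  have "cmod (char (distr M borel X) t - (1 - t\<^sup>2 * s2 / 2)) \<le>
      (t\<^sup>2 / 6) * expectation (\<lambda>\<omega>. min (6 * X \<omega> ^ 2) (\<bar>t\<bar> * \<bar>X \<omega>\<bar> ^ 3))"
    using i1 i2 mean by (intro char_approx3') (auto simp: s2_def)
  also have "expectation (\<lambda>\<omega>. min (6 * X \<omega> ^ 2) (\<bar>t\<bar> * \<bar>X \<omega>\<bar> ^ 3)) \<le>
      expectation (\<lambda>\<omega>. 24 * V \<omega> ^ 2 + 8 * \<bar>t\<bar> * \<bar>U \<omega>\<bar> ^ 3)"
  proof (rule integral_mono)
    show "integrable M (\<lambda>\<omega>. min (6 * X \<omega> ^ 2) (\<bar>t\<bar> * \<bar>X \<omega>\<bar> ^ 3))"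
      by (rule Bochner_Integration.integrable_bound[where f="\<lambda>\<omega>. 6 * X \<omega> ^ 2"]) (use i2 in auto)
    fix \<omega>
    let ?u = "U \<omega>" and ?v = "V \<omega>"
    show "min (6 * X \<omega> ^ 2) (\<bar>t\<bar> * \<bar>X \<omega>\<bar> ^ 3) \<le> 24 * V \<omega> ^ 2 + 8 * \<bar>t\<bar> * \<bar>U \<omega>\<bar> ^ 3"
    proof (cases "\<bar>?v\<bar> \<le> \<bar>?u\<bar>")
      case True
      then have "\<bar>X \<omega>\<bar> \<le> 2 * \<bar>?u\<bar>" unfolding X by linarith
      then have "\<bar>X \<omega>\<bar> ^ 3 \<le> (2 * \<bar>?u\<bar>) ^ 3" by (intro power_mono) auto
      then have "\<bar>t\<bar> * \<bar>X \<omega>\<bar> ^ 3 \<le> \<bar>t\<bar> * (2 * \<bar>?u\<bar>) ^ 3" by (intro mult_left_mono) auto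
      also have "\<dots> = 8 * \<bar>t\<bar> * \<bar>U \<omega>\<bar> ^ 3" by (simp add: power_mult_distrib)
      finally have "min (6 * X \<omega> ^ 2) (\<bar>t\<bar> * \<bar>X \<omega>\<bar> ^ 3) \<le> 8 * \<bar>t\<bar> * \<bar>U \<omega>\<bar> ^ 3" by linarith
      moreover have "0 \<le> 24 * V \<omega> ^ 2" by simp
      ultimately show ?thesis by linarith
    next
      case False
      then have "\<bar>X \<omega>\<bar> \<le> 2 * \<bar>?v\<bar>" unfolding X by linarith
      then have "\<bar>X \<omega>\<bar> ^ 2 \<le> (2 * \<bar>?v\<bar>) ^ 2" by (intro power_mono) auto
      then have "6 * X \<omega> ^ 2 \<le> 24 * V \<omega> ^ 2" by (simp add: power_mult_distrib)
      moreover have "0 \<le> 8 * \<bar>t\<bar> * \<bar>U \<omega>\<bar> ^ 3" by simp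
      ultimately show ?thesis by linarith
    qed
  qed (use int in auto)
  also have "\<dots> = 24 * expectation (\<lambda>\<omega>. V \<omega> ^ 2) + 8 * \<bar>t\<bar> * expectation (\<lambda>\<omega>. \<bar>U \<omega>\<bar> ^ 3)"
    using int by simp
  also have "\<dots> \<le> 24 * \<eta>\<^sup>2 + 8 * \<bar>t\<bar> * C"
    using \<eta>(4) C by (intro add_mono mult_left_mono) auto
  finally have 1: "cmod (char (distr M borel X) t - (1 - t\<^sup>2 * s2 / 2)) \<le> (t\<^sup>2 / 6) * (24 * \<eta>\<^sup>2 + 8 * \<bar>t\<bar> * C)"
    by (simp add: mult_left_mono)
  have "s2 = expectation (\<lambda>\<omega>. U \<omega> ^ 2 + 2 * (U \<omega> * V \<omega>) + V \<omega> ^ 2)"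
    unfolding s2_def X by (simp add: power2_sum ac_simps)
  also have "\<dots> = expectation (\<lambda>\<omega>. U \<omega> ^ 2) + 2 * expectation (\<lambda>\<omega>. U \<omega> * V \<omega>) + expectation (\<lambda>\<omega>. V \<omega> ^ 2)"
    using int iUV by simp
  finally have s2: "s2 = expectation (\<lambda>\<omega>. U \<omega> ^ 2) + 2 * expectation (\<lambda>\<omega>. U \<omega> * V \<omega>) + expectation (\<lambda>\<omega>. V \<omega> ^ 2)" .
  have "\<bar>2 * expectation (\<lambda>\<omega>. U \<omega> * V \<omega>)\<bar> = \<bar>expectation (\<lambda>\<omega>. 2 * (U \<omega> * V \<omega>))\<bar>" by simp
  also have "\<dots> \<le> expectation (\<lambda>\<omega>. \<bar>2 * (U \<omega> * V \<omega>)\<bar>)" by (rule integral_abs_bound)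
  also have "\<dots> \<le> expectation (\<lambda>\<omega>. \<eta> * U \<omega> ^ 2 + (1 / \<eta>) * V \<omega> ^ 2)"
  proof (rule integral_mono)
    fix \<omega>
    \<comment> \<open>Weighted arithmetic-geometric mean inequality, balanced for a second moment of \<open>V\<close> of size \<open>\<eta>\<^sup>2\<close>.\<close>
    have "0 \<le> (\<eta> * \<bar>U \<omega>\<bar> - \<bar>V \<omega>\<bar>)\<^sup>2 / \<eta>" using \<eta>(1) by simp
    also have "\<dots> = \<eta> * U \<omega> ^ 2 + (1 / \<eta>) * V \<omega> ^ 2 - \<bar>2 * (U \<omega> * V \<omega>)\<bar>"
      using \<eta>(1) by (simp add: power2_diff power_mult_distrib abs_mult field_simps) (simp add: power2_eq_square)
    finally show "\<bar>2 * (U \<omega> * V \<omega>)\<bar> \<le> \<eta> * U \<omega> ^ 2 + (1 / \<eta>) * V \<omega> ^ 2" by simp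
  qed (use int iUV in auto)
  also have "\<dots> = \<eta> * expectation (\<lambda>\<omega>. U \<omega> ^ 2) + (1 / \<eta>) * expectation (\<lambda>\<omega>. V \<omega> ^ 2)"
    using int by simp
  also have "\<dots> \<le> \<eta> * 2 + (1 / \<eta>) * \<eta>\<^sup>2"
    using \<eta> by (intro add_mono mult_left_mono) auto
  also have "\<dots> = 3 * \<eta>" using \<eta>(1) by (simp add: power2_eq_square)
  finally have "\<bar>2 * expectation (\<lambda>\<omega>. U \<omega> * V \<omega>)\<bar> \<le> 3 * \<eta>" .
  moreover have "0 \<le> expectation (\<lambda>\<omega>. V \<omega> ^ 2)" by simp
  moreover have \<eta>2: "\<eta>\<^sup>2 \<le> \<eta>" using \<eta>(1,2) by (simp add: power2_eq_square mult_left_le)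
  ultimately have "\<bar>s2 - 1\<bar> \<le> 5 * \<eta>" unfolding s2 using \<eta> by linarith
  then have "t\<^sup>2 / 2 * \<bar>1 - s2\<bar> \<le> t\<^sup>2 / 2 * (5 * \<eta>)" by (intro mult_left_mono) auto
  moreover have "cmod ((1 - t\<^sup>2 * s2 / 2) - (1 - t\<^sup>2 / 2)) = t\<^sup>2 / 2 * \<bar>1 - s2\<bar>"
  proof -
    have "(1 - t\<^sup>2 * s2 / 2) - (1 - t\<^sup>2 / 2) = (t\<^sup>2 / 2) * (1 - s2)" by (simp add: field_simps)
    then have "cmod ((1 - t\<^sup>2 * s2 / 2) - (1 - t\<^sup>2 / 2)) = \<bar>(t\<^sup>2 / 2) * (1 - s2)\<bar>"
      by (metis norm_of_real)
    then show ?thesis by (simp add: abs_mult)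
  qed
  ultimately have 2: "cmod ((1 - t\<^sup>2 * s2 / 2) - (1 - t\<^sup>2 / 2)) \<le> t\<^sup>2 / 2 * (5 * \<eta>)" by simp
  have "cmod (complex_of_real (1 - t\<^sup>2 / 2) - exp (- t\<^sup>2 / 2)) \<le> (t\<^sup>2 / 2)\<^sup>2 / 2"
    using exp_minus_quadratic_bound[of "t\<^sup>2 / 2"] by (simp flip: of_real_diff)
  then have 3: "cmod (complex_of_real (1 - t\<^sup>2 / 2) - exp (- t\<^sup>2 / 2)) \<le> t\<^sup>2 * (t\<^sup>2 / 8)"
    by (simp add: power2_eq_square)
  have "cmod (char (distr M borel X) t - exp (- t\<^sup>2 / 2)) \<le>
     (t\<^sup>2 / 6) * (24 * \<eta>\<^sup>2 + 8 * \<bar>t\<bar> * C) + t\<^sup>2 / 2 * (5 * \<eta>) + t\<^sup>2 * (t\<^sup>2 / 8)"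
  proof -
    have "norm (a - d) \<le> norm (a - b) + norm (b - c) + norm (c - d)" for a b c d :: complex
      using norm_triangle_ineq[of "a - b" "b - c"] norm_triangle_ineq[of "a - c" "c - d"] by simp
    from this[of "char (distr M borel X) t" "exp (- t\<^sup>2 / 2)" "1 - t\<^sup>2 * s2 / 2" "1 - t\<^sup>2 / 2"] 1 2 3
    show ?thesis by (simp only: of_real_diff of_real_1)
  qed
  also have "\<dots> = t\<^sup>2 * (4 * \<eta>\<^sup>2 + 4 / 3 * (C * \<bar>t\<bar>) + 5 / 2 * \<eta> + t\<^sup>2 / 8)"
    by (simp add: algebra_simps)
  also have "\<dots> \<le> t\<^sup>2 * (7 * \<eta> + 2 * C * \<bar>t\<bar> + t\<^sup>2)"
  proof (rule mult_left_mono)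
    have "0 \<le> expectation (\<lambda>\<omega>. \<bar>U \<omega>\<bar> ^ 3)" by simp
    then have "0 \<le> C" using C by linarith
    then have "0 \<le> C * \<bar>t\<bar>" by simp
    moreover have "0 \<le> t\<^sup>2" by simp
    ultimately show "4 * \<eta>\<^sup>2 + 4 / 3 * (C * \<bar>t\<bar>) + 5 / 2 * \<eta> + t\<^sup>2 / 8 \<le> 7 * \<eta> + 2 * C * \<bar>t\<bar> + t\<^sup>2"
      using \<eta>2 \<eta>(1) by linarith
  qed simp
  finally show ?thesis .
qed

text \<open>The characteristic function of the sum is a product, which is compared factor by factor with the
  product of the Gaussian factors; the total error is at most \<open>\<Sum>r. (u n r)\<^sup>2\<close>, which is bounded, times a
  quantity that tends to 0.\<close>

lemma weighted_sum_clt: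
  fixes \<xi> :: "nat \<Rightarrow> nat \<Rightarrow> 'w \<Rightarrow> real" and u :: "nat \<Rightarrow> nat \<Rightarrow> real"
  assumes P: "\<And>n. prob_space (P n)"
    and indep: "\<And>n. prob_space.indep_vars (P n) (\<lambda>_. borel) (\<xi> n) {1..k n}"
    and bound: "\<forall>\<^sub>F n in sequentially. \<forall>r\<in>{1..k n}. \<forall>t.
      cmod (char (distr (P n) borel (\<xi> n r)) t - exp (- t\<^sup>2 / 2)) \<le> t\<^sup>2 * (b n + C * \<bar>t\<bar> + t\<^sup>2)"
    and b: "b \<longlonglongrightarrow> 0" and C: "0 \<le> C"
    and u: "\<And>n r. r \<in> {1..k n} \<Longrightarrow> \<bar>u n r\<bar> \<le> \<mu> n" "\<mu> \<longlonglongrightarrow> 0"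
    and s: "(\<lambda>n. \<Sum>r=1..k n. (u n r)\<^sup>2) \<longlonglongrightarrow> s"
  shows "(\<lambda>n. LINT \<omega>|P n. iexp (\<Sum>r=1..k n. u n r * \<xi> n r \<omega>)) \<longlonglongrightarrow> complex_of_real (exp (- s / 2))"
proof -
  define S where "S n = (\<Sum>r=1..k n. (u n r)\<^sup>2)" for n
  have eq: "(LINT \<omega>|P n. iexp (\<Sum>r=1..k n. u n r * \<xi> n r \<omega>)) =
     (\<Prod>r=1..k n. char (distr (P n) borel (\<xi> n r)) (u n r))" for n
  proof -
    interpret prob_space "P n" by (rule P)
    have m: "\<xi> n r \<in> borel_measurable (P n)" if "r \<in> {1..k n}" for r
      using indep[of n] that unfolding indep_vars_def2 by auto
    have "indep_vars (\<lambda>_. borel) (\<lambda>r \<omega>. u n r * \<xi> n r \<omega>) {1..k n}"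
      by (rule indep_vars_compose2[OF indep]) auto
    from char_distr_sum[OF this, of 1]
    have "char (distr (P n) borel (\<lambda>\<omega>. \<Sum>r=1..k n. u n r * \<xi> n r \<omega>)) 1 =
      (\<Prod>r=1..k n. char (distr (P n) borel (\<lambda>\<omega>. u n r * \<xi> n r \<omega>)) 1)" .
    moreover have "char (distr (P n) borel (\<lambda>\<omega>. \<Sum>r=1..k n. u n r * \<xi> n r \<omega>)) 1 =
       (LINT \<omega>|P n. iexp (\<Sum>r=1..k n. u n r * \<xi> n r \<omega>))"
      unfolding char_def using m by (subst integral_distr) (auto intro!: borel_measurable_sum)
    moreover have "char (distr (P n) borel (\<lambda>\<omega>. u n r * \<xi> n r \<omega>)) 1 = char (distr (P n) borel (\<xi> n r)) (u n r)"
      if "r \<in> {1..k n}" for r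
      unfolding char_def using m[OF that] by (subst (1 2) integral_distr) auto
    ultimately show ?thesis by simp
  qed
  have char_le: "cmod (char (distr (P n) borel (\<xi> n r)) t) \<le> 1" if "r \<in> {1..k n}" for n r t
  proof -
    interpret prob_space "P n" by (rule P)
    have m: "\<xi> n r \<in> borel_measurable (P n)"
      using indep[of n] that unfolding indep_vars_def2 by auto
    interpret D: real_distribution "distr (P n) borel (\<xi> n r)"
      using prob_space_distr[OF m] by (simp add: real_distribution_def real_distribution_axioms_def)
    show ?thesis by (rule D.cmod_char_le_1)
  qed
  have est: "\<forall>\<^sub>F n in sequentially. cmod ((LINT \<omega>|P n. iexp (\<Sum>r=1..k n. u n r * \<xi> n r \<omega>)) - exp (- S n / 2))
      \<le> S n * (\<bar>b n\<bar> + C * \<bar>\<mu> n\<bar> + (\<mu> n)\<^sup>2)"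
    using bound
  proof eventually_elim
    case (elim n)
    have "complex_of_real (exp (- S n / 2)) = (\<Prod>r=1..k n. complex_of_real (exp (- (u n r)\<^sup>2 / 2)))"
      by (simp add: S_def exp_sum[symmetric] of_real_prod[symmetric] sum_negf sum_divide_distrib[symmetric] del: of_real_prod)
    then have "cmod ((LINT \<omega>|P n. iexp (\<Sum>r=1..k n. u n r * \<xi> n r \<omega>)) - exp (- S n / 2)) \<le>
        (\<Sum>r=1..k n. cmod (char (distr (P n) borel (\<xi> n r)) (u n r) - exp (- (u n r)\<^sup>2 / 2)))"
      unfolding eq by (simp only:) (intro norm_prod_diff char_le, auto)
    also have "\<dots> \<le> (\<Sum>r=1..k n. (u n r)\<^sup>2 * (\<bar>b n\<bar> + C * \<bar>\<mu> n\<bar> + (\<mu> n)\<^sup>2))"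
    proof (rule sum_mono)
      fix r assume r: "r \<in> {1..k n}"
      have "\<bar>u n r\<bar> \<le> \<bar>\<mu> n\<bar>" using u(1)[OF r] by linarith
      moreover then have "(u n r)\<^sup>2 \<le> (\<mu> n)\<^sup>2" by (simp add: abs_le_square_iff)
      ultimately have "(u n r)\<^sup>2 * (b n + C * \<bar>u n r\<bar> + (u n r)\<^sup>2) \<le> (u n r)\<^sup>2 * (\<bar>b n\<bar> + C * \<bar>\<mu> n\<bar> + (\<mu> n)\<^sup>2)"
        using C by (intro mult_left_mono add_mono) auto
      then show "cmod (char (distr (P n) borel (\<xi> n r)) (u n r) - exp (- (u n r)\<^sup>2 / 2)) \<le>
          (u n r)\<^sup>2 * (\<bar>b n\<bar> + C * \<bar>\<mu> n\<bar> + (\<mu> n)\<^sup>2)"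
        using elim[rule_format, OF r, of "u n r"] by (rule order_trans[rotated])
    qed
    also have "\<dots> = S n * (\<bar>b n\<bar> + C * \<bar>\<mu> n\<bar> + (\<mu> n)\<^sup>2)"
      by (simp add: S_def sum_distrib_right)
    finally show ?case .
  qed
  have S: "S \<longlonglongrightarrow> s" using s by (simp add: S_def[abs_def])
  have "(\<lambda>n. S n * (\<bar>b n\<bar> + C * \<bar>\<mu> n\<bar> + (\<mu> n)\<^sup>2)) \<longlonglongrightarrow> s * (\<bar>0\<bar> + C * \<bar>0\<bar> + 0\<^sup>2)"
    by (intro tendsto_intros S b u(2))
  then have "(\<lambda>n. S n * (\<bar>b n\<bar> + C * \<bar>\<mu> n\<bar> + (\<mu> n)\<^sup>2)) \<longlonglongrightarrow> 0" by simp
  from Lim_null_comparison[OF est this]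
  have "(\<lambda>n. (LINT \<omega>|P n. iexp (\<Sum>r=1..k n. u n r * \<xi> n r \<omega>)) - exp (- S n / 2)) \<longlonglongrightarrow> 0" .
  moreover have "(\<lambda>n. complex_of_real (exp (- S n / 2))) \<longlonglongrightarrow> exp (- s / 2)"
    by (intro tendsto_intros S)  simp
  ultimately have "(\<lambda>n. ((LINT \<omega>|P n. iexp (\<Sum>r=1..k n. u n r * \<xi> n r \<omega>)) - exp (- S n / 2)) + exp (- S n / 2))
     \<longlonglongrightarrow> 0 + complex_of_real (exp (- s / 2))"
    by (rule tendsto_add)
  then show ?thesis by simp
qed


section \<open>Poisson weights and the exponential law\<close>

definition poisson_weight :: "real \<Rightarrow> nat \<Rightarrow> real" where
  "poisson_weight l j = exp (- l) * l ^ j / fact j"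

lemma poisson_weight_nonneg: "0 \<le> l \<Longrightarrow> 0 \<le> poisson_weight l j"
  by (simp add: poisson_weight_def)

lemma poisson_weight_Suc: "real (Suc j) * poisson_weight l (Suc j) = l * poisson_weight l j"
  by (simp add: poisson_weight_def field_simps del: of_nat_Suc)

lemma poisson_weight_sums: "poisson_weight l sums 1"
proof -
  have "(\<lambda>j. exp (- l) * (l ^ j /\<^sub>R fact j)) sums (exp (- l) * exp l)"
    by (intro sums_mult exp_converges)
  then show ?thesis
    by (simp add: poisson_weight_def[abs_def] exp_minus_inverse field_simps)
qed

lemma poisson_mean_sums: "(\<lambda>j. real j * poisson_weight l j) sums l"
proof -
  have "(\<lambda>j. real (Suc j) * poisson_weight l (Suc j)) sums (l * 1)"
    unfolding poisson_weight_Suc by (intro sums_mult poisson_weight_sums)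
  from sums_Suc[OF this[folded]] show ?thesis by simp
qed

lemma poisson_second_factorial_moment_sums:
  "(\<lambda>j. real j * (real j - 1) * poisson_weight l j) sums (l * l)"
proof -
  have "(\<lambda>j. real (Suc j) * (real (Suc j) - 1) * poisson_weight l (Suc j)) sums (l * l)"
  proof -
    have "(\<lambda>j. l * (real j * poisson_weight l j)) sums (l * l)"
      by (intro sums_mult poisson_mean_sums)
    moreover have "real (Suc j) * (real (Suc j) - 1) * poisson_weight l (Suc j) = l * (real j * poisson_weight l j)" for j
      using arg_cong[OF poisson_weight_Suc[of j l], of "\<lambda>x. real j * x"] by (simp add: algebra_simps)
    ultimately show ?thesis by (simp only:)
  qed
  from sums_Suc[OF this] show ?thesis by simp
qed

text \<open>The sum is the second moment of a Poisson variable about \<open>l + 2\<close>; the shift by 2 matches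
  \<open>inverse_square_poisson_weight_le\<close>.\<close>

lemma poisson_shifted_variance_sums:
  "(\<lambda>j. (l + 2 - real j)\<^sup>2 * poisson_weight l j) sums (l + 4)"
proof -
  have "(\<lambda>j. (l + 2)\<^sup>2 * poisson_weight l j - 2 * (l + 2) * (real j * poisson_weight l j)
        + real j * (real j - 1) * poisson_weight l j + real j * poisson_weight l j) sums
      ((l + 2)\<^sup>2 * 1 - 2 * (l + 2) * l + l * l + l)"
    by (intro sums_add sums_diff sums_mult poisson_weight_sums poisson_mean_sums
        poisson_second_factorial_moment_sums)
  moreover have "(\<lambda>j. (l + 2)\<^sup>2 * poisson_weight l j - 2 * (l + 2) * (real j * poisson_weight l j)
        + real j * (real j - 1) * poisson_weight l j + real j * poisson_weight l j) =
      (\<lambda>j. (l + 2 - real j)\<^sup>2 * poisson_weight l j)"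
    by (auto simp: fun_eq_iff power2_eq_square algebra_simps)
  moreover have "(l + 2)\<^sup>2 * 1 - 2 * (l + 2) * l + l * l + l = l + 4"
    by (simp add: power2_eq_square algebra_simps)
  ultimately show ?thesis by (simp only:)
qed

text \<open>Dividing a Poisson weight by \<open>(j + 1) (j + 2)\<close> shifts it by two places, and \<open>j\<^sup>2\<close> is comparable to
  that product for \<open>j \<ge> 1\<close>. For \<open>j = 0\<close> the left-hand side is 0, since division by 0 gives 0. In this way negative
  moments of a Poisson variable reduce to ordinary ones.\<close>

lemma inverse_square_poisson_weight_le:
  assumes "0 < l"
  shows "poisson_weight l j / (real j)\<^sup>2 \<le> 6 / l\<^sup>2 * poisson_weight l (j + 2)"
proof (cases "j = 0")
  case True
  then show ?thesis using assms by (simp add: poisson_weight_nonneg)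
next
  case False
  have r: "real (Suc (Suc j)) = real j + 2" "real (Suc j) = real j + 1" and n: "j + 2 = Suc (Suc j)"
    by simp_all
  have step2: "(real j + 2) * poisson_weight l (j + 2) = l * poisson_weight l (Suc j)"
    using poisson_weight_Suc[of "Suc j" l] unfolding n r .
  have step1: "(real j + 1) * poisson_weight l (Suc j) = l * poisson_weight l j"
    using poisson_weight_Suc[of j l] unfolding r .
  have "poisson_weight l (j + 2) * ((real j + 1) * (real j + 2)) = (real j + 1) * ((real j + 2) * poisson_weight l (j + 2))"
    by (simp only: mult_ac)
  also have "\<dots> = l * ((real j + 1) * poisson_weight l (Suc j))"
    unfolding step2 by (simp only: mult_ac)
  also have "\<dots> = l\<^sup>2 * poisson_weight l j"
    unfolding step1 by (simp only: power2_eq_square mult_ac)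
  finally have "poisson_weight l (j + 2) * ((real j + 1) * (real j + 2)) = l\<^sup>2 * poisson_weight l j" .
  then have eq: "poisson_weight l (j + 2) = l\<^sup>2 * poisson_weight l j / ((real j + 1) * (real j + 2))"
    by (intro eq_divide_imp) simp_all
  have "1 \<le> real j" using False by simp
  then have "real j \<le> real j * real j" using mult_left_mono[of 1 "real j" "real j"] by simp
  moreover have "(real j + 1) * (real j + 2) = real j * real j + 3 * real j + 2" by (simp add: algebra_simps)
  ultimately have le: "(real j + 1) * (real j + 2) \<le> 6 * (real j)\<^sup>2"
    using \<open>1 \<le> real j\<close> unfolding power2_eq_square by linarith
  have "6 / (6 * (real j)\<^sup>2) \<le> 6 / ((real j + 1) * (real j + 2))"
    using False by (intro divide_left_mono le mult_pos_pos) auto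
  then have "1 / (real j)\<^sup>2 \<le> 6 / ((real j + 1) * (real j + 2))" by simp
  from mult_left_mono[OF this, of "poisson_weight l j"] show ?thesis
    using assms unfolding eq by (simp add: poisson_weight_nonneg mult.commute[of 6])
qed

abbreviation exponential_law :: "real measure" where
  "exponential_law \<equiv> density lborel (exponential_density 1)"

lemma prob_space_exponential_law: "prob_space exponential_law"
  by (rule prob_space_exponential_density) simp

lemma exponential_law_moment:
  "integrable exponential_law (\<lambda>x. x ^ i)" "(LINT x|exponential_law. x ^ i) = fact i"
proof -
  interpret prob_space exponential_law by (rule prob_space_exponential_law)
  have "distributed exponential_law lborel (\<lambda>x. x) (erlang_density 0 1)"
    unfolding distributed_def by (auto intro!: distr_id2 simp: erlang_density_def)
  from erlang_ith_moment[OF _ this] erlang_ith_moment_integrable[OF _ this]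
  show "integrable exponential_law (\<lambda>x. x ^ i)" "(LINT x|exponential_law. x ^ i) = fact i" by simp_all
qed

lemma exponential_law_tail:
  assumes "0 \<le> x"
  shows "measure exponential_law {x..} = exp (- x)"
proof -
  interpret prob_space exponential_law by (rule prob_space_exponential_law)
  have "distributed exponential_law lborel (\<lambda>x. x) (exponential_density 1)"
    unfolding distributed_def by (auto intro!: distr_id2 simp: exponential_density_def)
  from exponential_distributedD_gt[OF this assms]
  have "measure exponential_law {x<..} = exp (- x)" by (simp add: greaterThan_def)
  moreover have "measure exponential_law {x..} = measure exponential_law {x<..}"
  proof (rule measure_eq_AE)
    have "AE y in lborel. y \<noteq> x" by (rule AE_lborel_singleton)
    then show "AE y in exponential_law. y \<in> {x..} \<longleftrightarrow> y \<in> {x<..}"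
      by (subst AE_density) auto
  qed auto
  ultimately show ?thesis by simp
qed

lemma AE_exponential_law_nonneg: "AE x in exponential_law. 0 \<le> x"
  by (subst AE_density) (auto simp: exponential_density_def)


section \<open>Count and highest point of one Poisson cell\<close>

text \<open>The joint law of the count \<open>N\<close> and the maximum \<open>Y\<close> of a Poisson number of independent variables
  with distribution function \<open>g / f\<close>. The parameters \<open>lo\<close> and \<open>hi\<close> are bounds on the cell for the function
  under whose graph the points lie, \<open>f\<close> is the mean of that function, \<open>a\<close> the intensity times the mass
  of the cell, and \<open>g y\<close> the mean of the minimum of \<open>y\<close> and that function. Between \<open>lo\<close> and \<open>hi\<close> nothing is known about \<open>g\<close> except that
  it stays close to its value \<open>min y f\<close> for a constant function.\<close>

locale poisson_cell = prob_space M for M :: "'a measure" +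
  fixes N Y :: "'a \<Rightarrow> real" and a f lo hi :: real and g :: "real \<Rightarrow> real"
  assumes N_meas[measurable]: "N \<in> borel_measurable M"
    and Y_meas[measurable]: "Y \<in> borel_measurable M"
    and N_nat: "\<And>\<omega>. \<omega> \<in> space M \<Longrightarrow> N \<omega> \<in> \<nat>"
    and Y_nonneg: "\<And>\<omega>. \<omega> \<in> space M \<Longrightarrow> 0 \<le> Y \<omega>"
    and Y_zero: "\<And>\<omega>. \<omega> \<in> space M \<Longrightarrow> N \<omega> = 0 \<Longrightarrow> Y \<omega> = 0"
    and a_pos: "0 < a" and lo_pos: "0 < lo" and lo_le: "lo \<le> f" and le_hi: "f \<le> hi"
    and g_meas[measurable]: "g \<in> borel_measurable borel"
    and g_nonneg: "\<And>y. 0 \<le> y \<Longrightarrow> 0 \<le> g y"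
    and g_le: "\<And>y. 0 \<le> y \<Longrightarrow> g y \<le> min y f"
    and g_ge: "\<And>y. 0 \<le> y \<Longrightarrow> min y f - (hi - lo) \<le> g y"
    and g_lo: "\<And>y. 0 \<le> y \<Longrightarrow> y \<le> lo \<Longrightarrow> g y = y"
    and g_hi: "\<And>y. hi \<le> y \<Longrightarrow> g y = f"
    and prob_N: "\<And>j. prob {\<omega> \<in> space M. N \<omega> = real j} = poisson_weight (a * f) j"
    and prob_joint: "\<And>j y. 0 \<le> y \<Longrightarrow>
       prob {\<omega> \<in> space M. N \<omega> = real j \<and> Y \<omega> \<le> y} = poisson_weight (a * f) j * (g y / f) ^ j"
    and prob_Y: "\<And>y. 0 \<le> y \<Longrightarrow> prob {\<omega> \<in> space M. Y \<omega> \<le> y} = exp (- (a * (f - g y)))"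
begin

definition "lam = a * f"

lemma f_pos: "0 < f" using lo_pos lo_le by linarith
lemma lam_pos: "0 < lam" using a_pos f_pos by (simp add: lam_def)

lemma expectation_sums:
  fixes H :: "'a \<Rightarrow> real"
  assumes "integrable M H"
  shows "(\<lambda>j. expectation (\<lambda>\<omega>. if N \<omega> = real j then H \<omega> else 0)) sums expectation H"
proof -
  have [measurable]: "H \<in> borel_measurable M" using assms by simp
  have int: "integrable M (\<lambda>\<omega>. if N \<omega> = real j then H \<omega> else 0)" for j
    by (rule Bochner_Integration.integrable_bound[OF assms]) auto
  have sum: "(\<Sum>j<n. expectation (\<lambda>\<omega>. if N \<omega> = real j then H \<omega> else 0)) =
      expectation (\<lambda>\<omega>. if N \<omega> < real n then H \<omega> else 0)" for n
  proof -
    have "(\<Sum>j<n. expectation (\<lambda>\<omega>. if N \<omega> = real j then H \<omega> else 0)) =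
      expectation (\<lambda>\<omega>. \<Sum>j<n. if N \<omega> = real j then H \<omega> else 0)"
      using int by (simp add: Bochner_Integration.integral_sum)
    also have "\<dots> = expectation (\<lambda>\<omega>. if N \<omega> < real n then H \<omega> else 0)"
    proof (rule Bochner_Integration.integral_cong[OF refl])
      fix \<omega> assume "\<omega> \<in> space M"
      then obtain i where i: "N \<omega> = real i" using N_nat by (auto elim: Nats_cases)
      show "(\<Sum>j<n. if N \<omega> = real j then H \<omega> else 0) = (if N \<omega> < real n then H \<omega> else 0)"
        by (simp add: i)
    qed
    finally show ?thesis .
  qed
  show ?thesis
    unfolding sums_def sum
  proof (rule integral_dominated_convergence[where w="\<lambda>\<omega>. norm (H \<omega>)"])
    show "AE \<omega> in M. (\<lambda>n. if N \<omega> < real n then H \<omega> else 0) \<longlonglongrightarrow> H \<omega>"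
    proof (intro AE_I2 tendsto_eventually)
      fix \<omega> assume "\<omega> \<in> space M"
      show "\<forall>\<^sub>F n in sequentially. (if N \<omega> < real n then H \<omega> else 0) = H \<omega>"
        using eventually_gt_at_top[of "nat \<lceil>N \<omega>\<rceil>"]
      proof eventually_elim
        case (elim n)
        then have "N \<omega> < real n" by linarith
        then show ?case by simp
      qed
    qed
  qed (use assms in auto)
qed

lemma expectation_N_sums:
  fixes h :: "real \<Rightarrow> real"
  assumes [measurable]: "h \<in> borel_measurable borel" and B: "\<And>j. \<bar>h (real j)\<bar> \<le> B"
  shows "(\<lambda>j. h (real j) * poisson_weight lam j) sums expectation (\<lambda>\<omega>. h (N \<omega>))"
    and "integrable M (\<lambda>\<omega>. h (N \<omega>))"
proof -
  show int: "integrable M (\<lambda>\<omega>. h (N \<omega>))"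
  proof (rule integrable_const_bound[where B=B])
    show "AE \<omega> in M. norm (h (N \<omega>)) \<le> B"
      by (intro AE_I2) (auto dest!: N_nat elim!: Nats_cases simp: B)
  qed measurable
  have "expectation (\<lambda>\<omega>. if N \<omega> = real j then h (N \<omega>) else 0) = h (real j) * poisson_weight lam j" for j
  proof -
    have "expectation (\<lambda>\<omega>. if N \<omega> = real j then h (N \<omega>) else 0) =
      expectation (\<lambda>\<omega>. h (real j) * indicator {\<omega> \<in> space M. N \<omega> = real j} \<omega>)"
      by (intro Bochner_Integration.integral_cong) auto
    also have "\<dots> = h (real j) * poisson_weight lam j"
      by (simp add: prob_N lam_def)
    finally show ?thesis .
  qed
  then show "(\<lambda>j. h (real j) * poisson_weight lam j) sums expectation (\<lambda>\<omega>. h (N \<omega>))"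
    using expectation_sums[OF int] by simp
qed

text \<open>In the two uses below, \<open>t\<close> is a Poisson weight or one of the terms of \<open>poisson_shifted_variance_sums\<close>.
  Division by 0 removes the empty cell from the expectation.\<close>

lemma expectation_over_square_le:
  assumes [measurable]: "h \<in> borel_measurable borel" and B: "\<And>j. \<bar>h (real j) / (real j)\<^sup>2\<bar> \<le> B"
    and h: "\<And>j. 0 \<le> h (real j)" "\<And>j. h (real j) * poisson_weight lam (j + 2) = t (j + 2)"
    and t: "\<And>j. 0 \<le> t j" "t sums s"
  shows "integrable M (\<lambda>\<omega>. h (N \<omega>) / (N \<omega>)\<^sup>2)"
    and "expectation (\<lambda>\<omega>. h (N \<omega>) / (N \<omega>)\<^sup>2) \<le> 6 / lam\<^sup>2 * s"
proof -
  have m: "(\<lambda>x. h x / x\<^sup>2) \<in> borel_measurable borel" by measurable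
  note e = expectation_N_sums[OF m B]
  show "integrable M (\<lambda>\<omega>. h (N \<omega>) / (N \<omega>)\<^sup>2)" by (rule e(2))
  have shifted: "(\<lambda>j. 6 / lam\<^sup>2 * t (j + 2)) sums (6 / lam\<^sup>2 * (s - (\<Sum>i<2. t i)))"
    by (intro sums_mult sums_split_initial_segment t)
  have "h (real j) / (real j)\<^sup>2 * poisson_weight lam j \<le> 6 / lam\<^sup>2 * t (j + 2)" for j
    using mult_left_mono[OF inverse_square_poisson_weight_le[OF lam_pos, of j] h(1)[of j]] h(2)[of j, symmetric]
    by (simp add: ac_simps)
  from sums_le[OF this e(1) shifted]
  have "expectation (\<lambda>\<omega>. h (N \<omega>) / (N \<omega>)\<^sup>2) \<le> 6 / lam\<^sup>2 * (s - (\<Sum>i<2. t i))" .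
  also have "\<dots> \<le> 6 / lam\<^sup>2 * s"
    by (intro mult_left_mono) (auto intro: sum_nonneg t)
  finally show "expectation (\<lambda>\<omega>. h (N \<omega>) / (N \<omega>)\<^sup>2) \<le> 6 / lam\<^sup>2 * s" .
qed

lemma expectation_centred_ratio_le:
  "integrable M (\<lambda>\<omega>. (lam - N \<omega>)\<^sup>2 / (N \<omega>)\<^sup>2)"
  "expectation (\<lambda>\<omega>. (lam - N \<omega>)\<^sup>2 / (N \<omega>)\<^sup>2) \<le> 6 / lam\<^sup>2 * (lam + 4)"
proof -
  have B: "\<bar>(lam - real j)\<^sup>2 / (real j)\<^sup>2\<bar> \<le> (lam + 1)\<^sup>2" for j
  proof (cases "j = 0")
    case False
    then have j: "1 \<le> real j" by simp
    have "lam \<le> lam * real j" using j lam_pos by simp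
    then have "\<bar>lam - real j\<bar> \<le> lam * real j + real j" using j lam_pos by linarith
    then have "\<bar>lam - real j\<bar> \<le> (lam + 1) * real j" by (simp add: distrib_right)
    then have "\<bar>(lam - real j) / real j\<bar> \<le> lam + 1" using j by (simp add: field_simps)
    then have "\<bar>(lam - real j) / real j\<bar>\<^sup>2 \<le> (lam + 1)\<^sup>2" by (intro power_mono) auto
    then show ?thesis by (simp add: power_divide)
  qed simp
  have p: "0 \<le> (lam + 2 - real j)\<^sup>2 * poisson_weight lam j" for j
    using lam_pos by (simp add: poisson_weight_nonneg)
  have shift: "(lam - real j)\<^sup>2 * poisson_weight lam (j + 2) = (lam + 2 - real (j + 2))\<^sup>2 * poisson_weight lam (j + 2)" for j
    by simp
  have m: "(\<lambda>x::real. (lam - x)\<^sup>2) \<in> borel_measurable borel" by measurable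
  note e = expectation_over_square_le[where h="\<lambda>x. (lam - x)\<^sup>2", OF m B zero_le_power2 shift p poisson_shifted_variance_sums]
  show "integrable M (\<lambda>\<omega>. (lam - N \<omega>)\<^sup>2 / (N \<omega>)\<^sup>2)" by (rule e(1))
  show "expectation (\<lambda>\<omega>. (lam - N \<omega>)\<^sup>2 / (N \<omega>)\<^sup>2) \<le> 6 / lam\<^sup>2 * (lam + 4)" by (rule e(2))
qed

lemma expectation_inverse_square_le:
  "integrable M (\<lambda>\<omega>. 1 / (N \<omega>)\<^sup>2)"
  "expectation (\<lambda>\<omega>. 1 / (N \<omega>)\<^sup>2) \<le> 6 / lam\<^sup>2"
proof -
  have B: "\<bar>1 / (real j)\<^sup>2\<bar> \<le> 1" for j
    by (cases "j = 0") (auto simp: divide_le_eq)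
  have p: "0 \<le> poisson_weight lam j" for j using lam_pos by (simp add: poisson_weight_nonneg)
  from expectation_over_square_le[of "\<lambda>_. 1", OF _ B _ _ p poisson_weight_sums]
  show "integrable M (\<lambda>\<omega>. 1 / (N \<omega>)\<^sup>2)" "expectation (\<lambda>\<omega>. 1 / (N \<omega>)\<^sup>2) \<le> 6 / lam\<^sup>2"
    by simp_all
qed

lemma AE_Y_le_hi: "AE \<omega> in M. Y \<omega> \<le> hi"
proof -
  have hi: "0 \<le> hi" using f_pos le_hi by linarith
  have "prob {\<omega> \<in> space M. Y \<omega> \<le> hi} = 1"
    using prob_Y[OF hi] g_hi[of hi] by simp
  then show ?thesis by (subst (asm) prob_Collect_eq_1) auto
qed

lemma integrable_Y_term: "integrable M (\<lambda>\<omega>. if N \<omega> = real j then Y \<omega> else 0)"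
proof (rule integrable_const_bound[where B=hi])
  show "AE \<omega> in M. norm (if N \<omega> = real j then Y \<omega> else 0) \<le> hi"
    using AE_Y_le_hi AE_space
  proof eventually_elim
    case (elim \<omega>)
    then show ?case using Y_nonneg[of \<omega>] f_pos le_hi by auto
  qed
qed measurable

text \<open>Fubini's theorem for the region between 0 and \<open>Y\<close>; it makes the joint law, which is given by
  distribution functions, usable for expectations.\<close>

lemma layer_cake:
  "ennreal (expectation (\<lambda>\<omega>. if N \<omega> = real j then Y \<omega> else 0)) =
    (\<integral>\<^sup>+y. ennreal (poisson_weight lam j * (1 - (g y / f) ^ j)) * indicator {0..} y \<partial>lborel)"
proof -
  interpret PS: pair_sigma_finite M lborel ..
  have "ennreal (expectation (\<lambda>\<omega>. if N \<omega> = real j then Y \<omega> else 0)) =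
      (\<integral>\<^sup>+\<omega>. ennreal (if N \<omega> = real j then Y \<omega> else 0) \<partial>M)"
    using integrable_Y_term Y_nonneg by (intro nn_integral_eq_integral[symmetric] AE_I2) auto
  also have "\<dots> = (\<integral>\<^sup>+\<omega>. (\<integral>\<^sup>+y. (if N \<omega> = real j \<and> 0 \<le> y \<and> y < Y \<omega> then 1 else 0) \<partial>lborel) \<partial>M)"
  proof (rule nn_integral_cong)
    fix \<omega> assume "\<omega> \<in> space M"
    then have Y: "0 \<le> Y \<omega>" by (rule Y_nonneg)
    have "(\<integral>\<^sup>+y. (if N \<omega> = real j \<and> 0 \<le> y \<and> y < Y \<omega> then 1 else 0) \<partial>lborel) =
      (\<integral>\<^sup>+y. indicator (if N \<omega> = real j then {0..<Y \<omega>} else {}) y \<partial>lborel)"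
      by (intro nn_integral_cong) auto
    also have "\<dots> = emeasure lborel (if N \<omega> = real j then {0..<Y \<omega>} else {})"
      by (rule nn_integral_indicator) auto
    also have "\<dots> = ennreal (if N \<omega> = real j then Y \<omega> else 0)"
      using Y by auto
    finally show "ennreal (if N \<omega> = real j then Y \<omega> else 0) =
      (\<integral>\<^sup>+y. (if N \<omega> = real j \<and> 0 \<le> y \<and> y < Y \<omega> then 1 else 0) \<partial>lborel)" ..
  qed
  also have "\<dots> = (\<integral>\<^sup>+y. (\<integral>\<^sup>+\<omega>. (if N \<omega> = real j \<and> 0 \<le> y \<and> y < Y \<omega> then 1 else 0) \<partial>M) \<partial>lborel)"
    by (rule PS.Fubini'[symmetric]) measurable
  also have "\<dots> = (\<integral>\<^sup>+y. ennreal (poisson_weight lam j * (1 - (g y / f) ^ j)) * indicator {0..} y \<partial>lborel)"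
  proof (rule nn_integral_cong)
    fix y :: real
    show "(\<integral>\<^sup>+\<omega>. (if N \<omega> = real j \<and> 0 \<le> y \<and> y < Y \<omega> then 1 else 0) \<partial>M) =
      ennreal (poisson_weight lam j * (1 - (g y / f) ^ j)) * indicator {0..} y"
    proof (cases "0 \<le> y")
      case True
      have "(\<integral>\<^sup>+\<omega>. (if N \<omega> = real j \<and> 0 \<le> y \<and> y < Y \<omega> then 1 else 0) \<partial>M) =
         (\<integral>\<^sup>+\<omega>. indicator ({\<omega> \<in> space M. N \<omega> = real j} - {\<omega> \<in> space M. N \<omega> = real j \<and> Y \<omega> \<le> y}) \<omega> \<partial>M)"
        using True by (intro nn_integral_cong) (auto split: split_indicator)
      also have "\<dots> = emeasure M ({\<omega> \<in> space M. N \<omega> = real j} - {\<omega> \<in> space M. N \<omega> = real j \<and> Y \<omega> \<le> y})"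
        by (rule nn_integral_indicator) measurable
      also have "\<dots> = ennreal (prob {\<omega> \<in> space M. N \<omega> = real j} - prob {\<omega> \<in> space M. N \<omega> = real j \<and> Y \<omega> \<le> y})"
        unfolding emeasure_eq_measure by (subst finite_measure_Diff) auto
      finally show ?thesis using True unfolding prob_N prob_joint[OF True] lam_def
        by (simp add: right_diff_distrib)
    qed simp
  qed
  finally show ?thesis .
qed

lemma power_gap_le:
  fixes p q :: real
  assumes "0 \<le> p" "p \<le> q" "q \<le> 1"
  shows "q ^ j - p ^ j \<le> real j * (q - p)"
  using norm_power_diff[of q p j] assms by simp

text \<open>For \<open>g y = min y f\<close> the layer-cake integral is the mean \<open>f j / (j + 1)\<close> of the maximum of \<open>j\<close> uniform
  variables. The two integrands differ only on \<open>[lo, hi]\<close>, and there by at most \<open>j (hi - lo) / f\<close>, which makes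
  the difference quadratic in \<open>hi - lo\<close>.\<close>

lemma expectation_Y_on_count:
  "poisson_weight lam j * (f * real j / (real j + 1)) \<le> expectation (\<lambda>\<omega>. if N \<omega> = real j then Y \<omega> else 0)"
  "expectation (\<lambda>\<omega>. if N \<omega> = real j then Y \<omega> else 0) \<le>
     poisson_weight lam j * (f * real j / (real j + 1) + real j * (hi - lo)\<^sup>2 / f)"
proof -
  let ?p = "poisson_weight lam j" and ?E = "expectation (\<lambda>\<omega>. if N \<omega> = real j then Y \<omega> else 0)"
  have p: "0 \<le> ?p" using lam_pos by (simp add: poisson_weight_nonneg)
  have E0: "0 \<le> ?E" using Y_nonneg by (intro integral_nonneg_AE AE_I2) auto
  have uniform: "(\<integral>\<^sup>+y. ennreal (?p * (1 - (y / f) ^ j)) * indicator {0..f} y \<partial>lborel)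
      = ennreal (?p * (f * real j / (real j + 1)))"
  proof -
    \<comment> \<open>An antiderivative of the integrand.\<close>
    define Q where "Q y = ?p * (y - f * (y / f) ^ Suc j / real (Suc j))" for y
    have "(\<integral>\<^sup>+y. ennreal (?p * (1 - (y / f) ^ j)) * indicator {0..f} y \<partial>lborel) = Q f - Q 0"
    proof (rule nn_integral_FTC_Icc)
      fix y assume "y \<in> {0..f}"
      then have y: "0 \<le> y" "y \<le> f" by auto
      show "DERIV Q y :> ?p * (1 - (y / f) ^ j)"
      proof -
        have "DERIV (\<lambda>y. (y / f) ^ Suc j) y :> (1 + real j) * ((1 / f) * (y / f) ^ j)"
          by (rule DERIV_power_Suc[OF DERIV_cdivide[OF DERIV_ident]])
        then have "DERIV Q y :> ?p * (1 - f * ((1 + real j) * ((1 / f) * (y / f) ^ j)) / real (Suc j))"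
          unfolding Q_def by (intro DERIV_cmult DERIV_diff DERIV_ident DERIV_cdivide)
        moreover have "f \<noteq> 0" using f_pos by simp
        then have "f * ((1 + real j) * ((1 / f) * (y / f) ^ j)) / real (Suc j) = (y / f) ^ j"
          by simp
        ultimately show ?thesis by simp
      qed
      have "(y / f) ^ j \<le> 1" using y f_pos by (intro power_le_one) auto
      then show "0 \<le> ?p * (1 - (y / f) ^ j)" using p by simp
    qed (use f_pos in auto)
    also have "Q f - Q 0 = ?p * (f * real j / (real j + 1))"
      using f_pos by (simp add: Q_def field_simps)
    finally show ?thesis .
  qed
  have "ennreal (?p * (f * real j / (real j + 1))) \<le> ennreal ?E"
    unfolding layer_cake uniform[symmetric]
  proof (rule nn_integral_mono)
    fix y :: real
    show "ennreal (?p * (1 - (y / f) ^ j)) * indicator {0..f} y \<le>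
      ennreal (?p * (1 - (g y / f) ^ j)) * indicator {0..} y"
    proof (cases "0 \<le> y \<and> y \<le> f")
      case True
      then have "(g y / f) ^ j \<le> (y / f) ^ j"
        using g_le[of y] g_nonneg[of y] f_pos by (intro power_mono divide_right_mono) auto
      then have "?p * (1 - (y / f) ^ j) \<le> ?p * (1 - (g y / f) ^ j)"
        using p by (intro mult_left_mono) auto
      then show ?thesis using True by (simp add: ennreal_leI)
    qed auto
  qed
  then show "?p * (f * real j / (real j + 1)) \<le> ?E" using E0 by (subst (asm) ennreal_le_iff) auto
  have "ennreal ?E \<le> (\<integral>\<^sup>+y. ennreal (?p * (1 - (y / f) ^ j)) * indicator {0..f} y +
       ennreal (?p * (real j * (hi - lo) / f)) * indicator {lo..hi} y \<partial>lborel)"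
    unfolding layer_cake
  proof (rule nn_integral_mono)
    fix y :: real
    show "ennreal (?p * (1 - (g y / f) ^ j)) * indicator {0..} y \<le>
      ennreal (?p * (1 - (y / f) ^ j)) * indicator {0..f} y + ennreal (?p * (real j * (hi - lo) / f)) * indicator {lo..hi} y"
    proof -
      consider "y < 0" | "0 \<le> y" "y < lo" | "hi < y" | "lo \<le> y" "y \<le> hi" by linarith
      then show ?thesis
      proof cases
        case 1 then show ?thesis by simp
      next
        case 2 then show ?thesis using g_lo[of y] lo_le by simp
      next
        case 3
        then have "g y / f = 1" using g_hi[of y] f_pos by simp
        then show ?thesis by simp
      next
        case 4
        then have y: "0 \<le> y" using lo_pos by simp
        let ?q = "min y f / f"
        have q: "0 \<le> g y / f" "g y / f \<le> ?q" "?q \<le> 1" "?q - g y / f \<le> (hi - lo) / f"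
          using g_nonneg[OF y] g_le[OF y] g_ge[OF y] f_pos
          by (auto simp: divide_right_mono diff_divide_distrib[symmetric] divide_le_eq)
        have "?q ^ j - (g y / f) ^ j \<le> real j * (?q - g y / f)"
          using power_gap_le q by blast
        also have "\<dots> \<le> real j * ((hi - lo) / f)" using q by (intro mult_left_mono) auto
        finally have "1 - (g y / f) ^ j \<le> (1 - ?q ^ j) + real j * (hi - lo) / f" by simp
        from mult_left_mono[OF this p]
        have "?p * (1 - (g y / f) ^ j) \<le> ?p * (1 - ?q ^ j) + ?p * (real j * (hi - lo) / f)"
          by (simp only: distrib_left)
        then have "ennreal (?p * (1 - (g y / f) ^ j)) \<le> ennreal (?p * (1 - ?q ^ j)) + ennreal (?p * (real j * (hi - lo) / f))"
          using p q y lo_le le_hi f_pos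
          by (subst ennreal_plus[symmetric]) (auto intro!: ennreal_leI mult_nonneg_nonneg power_le_one divide_nonneg_nonneg)
        moreover have "ennreal (?p * (1 - ?q ^ j)) = ennreal (?p * (1 - (y / f) ^ j)) * indicator {0..f} y"
          using y f_pos by (cases "y \<le> f") (auto simp: min_def)
        ultimately show ?thesis using 4 y by simp
      qed
    qed
  qed
  also have "\<dots> = ennreal (?p * (f * real j / (real j + 1))) + ennreal (?p * (real j * (hi - lo) / f)) * ennreal (hi - lo)"
    unfolding uniform[symmetric] using lo_le le_hi
    by (subst nn_integral_add) (auto simp: nn_integral_cmult_indicator)
  also have "\<dots> = ennreal (?p * (f * real j / (real j + 1)) + ?p * (real j * (hi - lo) / f) * (hi - lo))"
    using p lo_le le_hi f_pos by (simp add: ennreal_plus[symmetric] ennreal_mult[symmetric] del: ennreal_plus)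
  also have "?p * (f * real j / (real j + 1)) + ?p * (real j * (hi - lo) / f) * (hi - lo) =
     ?p * (f * real j / (real j + 1) + real j * (hi - lo)\<^sup>2 / f)"
    by (simp add: power2_eq_square algebra_simps)
  finally have "ennreal ?E \<le> ennreal (?p * (f * real j / (real j + 1) + real j * (hi - lo)\<^sup>2 / f))" .
  then show "?E \<le> ?p * (f * real j / (real j + 1) + real j * (hi - lo)\<^sup>2 / f)"
    using p f_pos by (subst (asm) ennreal_le_iff) (auto intro!: mult_nonneg_nonneg add_nonneg_nonneg divide_nonneg_nonneg)
qed

definition "zeta \<omega> = a * ((1 + 1 / N \<omega>) * Y \<omega> - f)"

lemma zeta_measurable [measurable]: "zeta \<in> borel_measurable M"
  unfolding zeta_def[abs_def] by measurable

lemma inflation_bounds: "\<omega> \<in> space M \<Longrightarrow> 0 \<le> 1 / N \<omega> \<and> 1 / N \<omega> \<le> 1"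
  by (drule N_nat, elim Nats_cases, rename_tac i, case_tac i) auto

lemma integrable_estimate: "integrable M (\<lambda>\<omega>. (1 + 1 / N \<omega>) * Y \<omega>)"
proof (rule integrable_const_bound[where B="2 * hi"])
  show "AE \<omega> in M. norm ((1 + 1 / N \<omega>) * Y \<omega>) \<le> 2 * hi"
    using AE_Y_le_hi AE_space
  proof eventually_elim
    case (elim \<omega>)
    then have "(1 + 1 / N \<omega>) * Y \<omega> \<le> 2 * hi"
      using inflation_bounds[of \<omega>] Y_nonneg[of \<omega>] by (intro mult_mono) auto
    then show ?case using elim inflation_bounds[of \<omega>] Y_nonneg[of \<omega>] by (simp add: abs_mult)
  qed
qed measurable

lemma integrable_zeta: "integrable M zeta"
  unfolding zeta_def[abs_def] using integrable_estimate by simp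

text \<open>The factor \<open>1 + 1/j\<close> cancels \<open>j / (j + 1)\<close>, so up to the quadratic error each event \<open>N = j\<close> with \<open>j \<ge> 1\<close>
  contributes its probability times \<open>f\<close>; what is missing is the empty cell.\<close>

lemma bias_bound:
  assumes "1 \<le> lam"
  shows "\<bar>expectation zeta\<bar> \<le> lam * exp (- lam) + 2 * (a * (hi - lo))\<^sup>2"
proof -
  let ?H = "\<lambda>\<omega>. (1 + 1 / N \<omega>) * Y \<omega>"
  let ?p = "poisson_weight lam"
  define d where "d = (hi - lo)\<^sup>2 / f"
  have d: "0 \<le> d" using f_pos by (simp add: d_def)
  have p: "0 \<le> ?p j" for j using lam_pos by (simp add: poisson_weight_nonneg)
  have p0: "?p 0 = exp (- lam)" by (simp add: poisson_weight_def)
  define term_at where "term_at j = expectation (\<lambda>\<omega>. if N \<omega> = real j then ?H \<omega> else 0)" for j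
  have sums: "term_at sums expectation ?H"
    unfolding term_at_def by (rule expectation_sums[OF integrable_estimate])
  have term_eq: "term_at j = (1 + 1 / real j) * expectation (\<lambda>\<omega>. if N \<omega> = real j then Y \<omega> else 0)" for j
  proof -
    have "term_at j = expectation (\<lambda>\<omega>. (1 + 1 / real j) * (if N \<omega> = real j then Y \<omega> else 0))"
      unfolding term_at_def by (intro Bochner_Integration.integral_cong) auto
    then show ?thesis by simp
  qed
  \<comment> \<open>The contribution of \<open>j\<close> points in the case of a constant function; the empty cell contributes 0.\<close>
  define lower where "lower j = f * (?p j - (if j = 0 then ?p 0 else 0))" for j
  have lower_sums: "lower sums (f * (1 - exp (- lam)))"
    unfolding lower_def p0[symmetric]
    by (intro sums_mult sums_diff poisson_weight_sums sums_single[of 0 "\<lambda>_. ?p 0"])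
  have upper_sums: "(\<lambda>j. lower j + d * (real j * ?p j + ?p j)) sums (f * (1 - exp (- lam)) + d * (lam + 1))"
    by (intro sums_add sums_mult lower_sums poisson_mean_sums poisson_weight_sums)
  have term_bounds: "lower j \<le> term_at j" "term_at j \<le> lower j + d * (real j * ?p j + ?p j)" for j
  proof -
    have "lower j \<le> term_at j \<and> term_at j \<le> lower j + d * (real j * ?p j + ?p j)"
    proof (cases "j = 0")
      case True
      have "expectation (\<lambda>\<omega>. if N \<omega> = real j then Y \<omega> else 0) = expectation (\<lambda>\<omega>. 0)"
        using True Y_zero by (intro Bochner_Integration.integral_cong) auto
      then have "term_at j = 0" unfolding term_eq by simp
      then show ?thesis using True d p[of 0] by (simp add: lower_def)
    next
      case False
      have c: "0 \<le> 1 + 1 / real j" by simp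
      have e1: "(1 + 1 / real j) * (?p j * (f * real j / (real j + 1))) = lower j"
      proof -
        have "1 + 1 / real j = (real j + 1) / real j" using False by (simp add: add_divide_distrib)
        moreover have "real j + 1 \<noteq> 0" by linarith
        ultimately show ?thesis using False by (simp add: lower_def)
      qed
      have e2: "(1 + 1 / real j) * (?p j * (f * real j / (real j + 1) + real j * (hi - lo)\<^sup>2 / f)) =
         lower j + d * (real j * ?p j + ?p j)"
      proof -
        have "(1 + 1 / real j) * (?p j * (real j * (hi - lo)\<^sup>2 / f)) = ((1 + 1 / real j) * real j) * ?p j * d"
          by (simp add: d_def)
        also have "(1 + 1 / real j) * real j = real j + 1" using False by (simp add: field_simps)
        finally have "(1 + 1 / real j) * (?p j * (real j * (hi - lo)\<^sup>2 / f)) = d * (real j * ?p j + ?p j)"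
          by (simp only: distrib_right mult_1_left distrib_left mult.commute[of _ d])
        then show ?thesis unfolding e1[symmetric] by (simp only: distrib_left)
      qed
      show ?thesis
        using mult_left_mono[OF expectation_Y_on_count(1)[of j] c] mult_left_mono[OF expectation_Y_on_count(2)[of j] c]
        unfolding e1 e2 term_eq by simp
    qed
    then show "lower j \<le> term_at j" "term_at j \<le> lower j + d * (real j * ?p j + ?p j)" by auto
  qed
  have l: "f * (1 - exp (- lam)) \<le> expectation ?H"
    using term_bounds(1) lower_sums sums by (rule sums_le)
  have u: "expectation ?H \<le> f * (1 - exp (- lam)) + d * (lam + 1)"
    using term_bounds(2) sums upper_sums by (rule sums_le)
  have z: "expectation zeta = a * (expectation ?H - f)"
    unfolding zeta_def[abs_def] using integrable_estimate by (simp add: prob_space)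
  have "a * (expectation ?H - f) \<le> a * (d * (lam + 1) - f * exp (- lam))"
    using u a_pos by (intro mult_left_mono) (auto simp: algebra_simps)
  also have "\<dots> = a * (d * (lam + 1)) - lam * exp (- lam)"
    by (simp add: lam_def algebra_simps)
  finally have "expectation zeta \<le> a * (d * (lam + 1)) - lam * exp (- lam)"
    unfolding z .
  moreover have "- (lam * exp (- lam)) \<le> expectation zeta"
    using mult_left_mono[of "- (f * exp (- lam))" "expectation ?H - f" a] l a_pos
    unfolding z by (simp add: lam_def algebra_simps)
  moreover have "a * (d * (lam + 1)) \<le> 2 * (a * (hi - lo))\<^sup>2"
  proof -
    have "a * d = (a * (hi - lo))\<^sup>2 / lam"
      using a_pos f_pos by (simp add: d_def lam_def power2_eq_square)
    then have "a * (d * (lam + 1)) = (a * (hi - lo))\<^sup>2 * ((lam + 1) / lam)" by (simp add: mult.assoc[symmetric])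
    also have "\<dots> \<le> (a * (hi - lo))\<^sup>2 * 2"
      using assms by (intro mult_left_mono) (auto simp: divide_le_eq)
    finally show ?thesis by simp
  qed
  moreover have "0 \<le> lam * exp (- lam)" using lam_pos by simp
  moreover have "0 \<le> (a * (hi - lo))\<^sup>2" by simp
  ultimately show ?thesis by linarith
qed


text \<open>Capping at \<open>- \<epsilon>\<close> discards the range of \<open>Y\<close> above \<open>lo\<close>, where its law is not explicit. What is left is a
  function of an exponential variable in law.\<close>

definition "gap \<epsilon> \<omega> = min (- \<epsilon>) (a * (Y \<omega> - f))"

lemma gap_measurable [measurable]: "gap \<epsilon> \<in> borel_measurable M"
  unfolding gap_def[abs_def] by measurable

lemma gap_bounds:
  assumes "\<omega> \<in> space M" "0 \<le> \<epsilon>" "\<epsilon> \<le> lam"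
  shows "- lam \<le> gap \<epsilon> \<omega>" "gap \<epsilon> \<omega> \<le> - \<epsilon>"
  using Y_nonneg[OF assms(1)] a_pos assms(2,3) by (auto simp: gap_def lam_def right_diff_distrib)

text \<open>The events \<open>gap \<epsilon> \<omega> \<le> s\<close> with \<open>s < - \<epsilon>\<close> concern levels of \<open>Y\<close> below \<open>lo\<close> only. There \<open>g y = y\<close>, and
  \<open>prob_Y\<close> becomes an exponential tail.\<close>

lemma gap_law:
  assumes \<epsilon>: "0 \<le> \<epsilon>" "\<epsilon> \<le> lam" "a * (hi - lo) \<le> \<epsilon>"
  shows "distr M borel (gap \<epsilon>) = distr exponential_law borel (\<lambda>x. max (- lam) (min (- \<epsilon>) (- x)))" (is "?L = ?R")
proof (rule cdf_unique)
  interpret E: prob_space exponential_law by (rule prob_space_exponential_law)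
  have Km: "(\<lambda>x. max (- lam) (min (- \<epsilon>) (- x))) \<in> borel_measurable exponential_law" by measurable
  show "real_distribution ?L"
    using prob_space_distr[OF gap_measurable] by (simp add: real_distribution_def real_distribution_axioms_def)
  show "real_distribution ?R"
    using E.prob_space_distr[OF Km] by (simp add: real_distribution_def real_distribution_axioms_def)
  show "cdf ?L = cdf ?R"
  proof
    fix s
    have L: "cdf ?L s = prob {\<omega> \<in> space M. gap \<epsilon> \<omega> \<le> s}"
      unfolding cdf_def by (subst measure_distr) (auto intro!: arg_cong[where f=prob])
    have R: "cdf ?R s = measure exponential_law {x. max (- lam) (min (- \<epsilon>) (- x)) \<le> s}"
      unfolding cdf_def by (subst measure_distr) (auto intro!: arg_cong[where f="measure exponential_law"])
    consider "- \<epsilon> \<le> s" | "s < - \<epsilon>" "- lam \<le> s" | "s < - \<epsilon>" "s < - lam" by linarith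
    then show "cdf ?L s = cdf ?R s"
    proof cases
      case 1
      then have "{\<omega> \<in> space M. gap \<epsilon> \<omega> \<le> s} = space M" "{x. max (- lam) (min (- \<epsilon>) (- x)) \<le> s} = space exponential_law"
        using \<epsilon> by (auto simp: gap_def)
      then show ?thesis unfolding L R by (simp only: prob_space E.prob_space)
    next
      case 2
      have y: "0 \<le> f + s / a" "f + s / a \<le> lo"
      proof -
        have "0 \<le> (lam + s) / a" using 2 a_pos by simp
        then show "0 \<le> f + s / a" using a_pos by (simp add: lam_def add_divide_distrib)
        have "a * (f + s / a) \<le> a * lo"
        proof -
          have "a * f \<le> a * hi" using le_hi a_pos by simp
          then have "a * f + s \<le> a * lo" using 2 \<epsilon>(3) unfolding right_diff_distrib by linarith
          then show ?thesis using a_pos by (simp add: distrib_left)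
        qed
        then show "f + s / a \<le> lo" using a_pos by simp
      qed
      have "{\<omega> \<in> space M. gap \<epsilon> \<omega> \<le> s} = {\<omega> \<in> space M. Y \<omega> \<le> f + s / a}"
        using 2 a_pos by (auto simp: gap_def min_le_iff_disj field_simps)
      then have "cdf ?L s = exp (- (a * (f - (f + s / a))))"
        unfolding L using prob_Y[OF y(1)] g_lo[OF y] by simp
      also have "a * (f - (f + s / a)) = - s" using a_pos by (simp add: field_simps)
      also have "exp (- (- s)) = measure exponential_law {- s..}"
        using exponential_law_tail[of "- s"] 2 \<epsilon> by simp
      also have "{- s..} = {x. max (- lam) (min (- \<epsilon>) (- x)) \<le> s}"
        using 2 by (auto simp: min_le_iff_disj)
      finally show ?thesis unfolding R .
    next
      case 3
      then have "{\<omega> \<in> space M. gap \<epsilon> \<omega> \<le> s} = {}" "{x. max (- lam) (min (- \<epsilon>) (- x)) \<le> s} = {}"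
        using gap_bounds[OF _ \<epsilon>(1,2)] by fastforce+
      then show ?thesis unfolding L R by (simp only: measure_empty)
    qed
  qed
qed

lemma expectation_gap_le:
  fixes h H :: "real \<Rightarrow> real"
  assumes \<epsilon>: "0 \<le> \<epsilon>" "\<epsilon> \<le> lam" "a * (hi - lo) \<le> \<epsilon>"
    and h: "continuous_on UNIV h" and H: "integrable exponential_law H"
    and le: "\<And>x. 0 \<le> x \<Longrightarrow> h (max (- lam) (min (- \<epsilon>) (- x))) \<le> H x"
  shows "expectation (\<lambda>\<omega>. h (gap \<epsilon> \<omega>)) \<le> (LINT x|exponential_law. H x)"
proof -
  interpret E: prob_space exponential_law by (rule prob_space_exponential_law)
  let ?K = "\<lambda>x. max (- lam) (min (- \<epsilon>) (- x))"
  have hm[measurable]: "h \<in> borel_measurable borel" using h by (rule borel_measurable_continuous_onI)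
  have "bounded (h ` {- lam..0})"
    by (intro compact_imp_bounded compact_continuous_image continuous_on_subset[OF h]) auto
  then obtain B where "\<And>y. y \<in> {- lam..0} \<Longrightarrow> \<bar>h y\<bar> \<le> B"
    unfolding bounded_iff by (metis image_eqI real_norm_def)
  then have B: "\<bar>h (?K x)\<bar> \<le> B" for x using \<epsilon> lam_pos by simp
  have "expectation (\<lambda>\<omega>. h (gap \<epsilon> \<omega>)) = (LINT x|distr M borel (gap \<epsilon>). h x)"
    by (subst integral_distr) auto
  also have "\<dots> = (LINT x|exponential_law. h (?K x))"
    unfolding gap_law[OF \<epsilon>] by (subst integral_distr) auto
  also have "\<dots> \<le> (LINT x|exponential_law. H x)"
  proof (rule integral_mono_AE[OF _ H])
    show "integrable exponential_law (\<lambda>x. h (?K x))"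
      by (rule E.integrable_const_bound[where B=B]) (simp add: B, measurable)
    show "AE x in exponential_law. h (?K x) \<le> H x"
      using AE_exponential_law_nonneg by eventually_elim (rule le)
  qed
  finally show ?thesis .
qed

text \<open>The truncation of the exponential variable at \<open>\<epsilon>\<close> and \<open>lam\<close> moves it by at most \<open>\<epsilon> + x\<^sup>2 / lam\<close>, so its moments
  are compared with the moments \<open>fact i\<close> of the exponential law.\<close>

lemma gap_moments:
  assumes \<epsilon>: "0 \<le> \<epsilon>" "\<epsilon> \<le> 1" "1 \<le> lam" "a * (hi - lo) \<le> \<epsilon>"
  shows "\<bar>expectation (\<lambda>\<omega>. (1 + gap \<epsilon> \<omega>)\<^sup>2) - 1\<bar> \<le> 5 * \<epsilon> + 18 / lam"
    and "expectation (\<lambda>\<omega>. \<bar>1 + gap \<epsilon> \<omega>\<bar> ^ 3) \<le> 38"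
    and "expectation (\<lambda>\<omega>. (\<bar>gap \<epsilon> \<omega>\<bar> + 2) ^ 4) \<le> 393"
proof -
  interpret E: prob_space exponential_law by (rule prob_space_exponential_law)
  define K where "K x = max (- lam) (min (- \<epsilon>) (- x))" for x
  have le: "expectation (\<lambda>\<omega>. h (gap \<epsilon> \<omega>)) \<le> (LINT x|exponential_law. H x)"
    if "continuous_on UNIV h" "integrable exponential_law H" "\<And>x. 0 \<le> x \<Longrightarrow> h (K x) \<le> H x" for h H :: "real \<Rightarrow> real"
    using \<epsilon> that unfolding K_def by (intro expectation_gap_le) auto
  have K_abs: "\<bar>K x\<bar> \<le> x + \<epsilon>" if "0 \<le> x" for x using that \<epsilon> by (auto simp: K_def)
  have K_dist: "\<bar>K x + x\<bar> \<le> \<epsilon> + x\<^sup>2 / lam" if x: "0 \<le> x" for x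
  proof (cases "x \<le> lam")
    case True
    then have "\<bar>K x + x\<bar> \<le> \<epsilon>" using x \<epsilon> by (auto simp: K_def)
    moreover have "0 \<le> x\<^sup>2 / lam" using lam_pos by simp
    ultimately show ?thesis by linarith
  next
    case False
    then have "\<bar>K x + x\<bar> \<le> x" using x \<epsilon> by (auto simp: K_def)
    also have "x \<le> x\<^sup>2 / lam" using False lam_pos by (simp add: field_simps power2_eq_square)
    finally show ?thesis using \<epsilon> by linarith
  qed
  have i: "integrable exponential_law (\<lambda>x. x ^ n)" for n by (rule exponential_law_moment)
  have i1: "integrable exponential_law (\<lambda>x. x)" "(LINT x|exponential_law. x) = 1"
    using exponential_law_moment[of 1] by simp_all
  note ints = i[of 2] i[of 3] i[of 4] i1 E.prob_space
  have f4: "fact 4 = (24::real)" "fact 3 = (6::real)" by (simp_all add: fact_numeral)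
  define err where "err x = 3 * \<epsilon> + 2 * \<epsilon> * x + 3 / lam * x ^ 2 + 2 / lam * x ^ 3" for x
  have err: "integrable exponential_law err" "(LINT x|exponential_law. err x) = 5 * \<epsilon> + 18 / lam"
    unfolding err_def[abs_def] using ints by (simp_all add: exponential_law_moment(2) f4)
  have square: "integrable exponential_law (\<lambda>x. (1 - x)\<^sup>2)" "(LINT x|exponential_law. (1 - x)\<^sup>2) = 1"
  proof -
    have eq: "(1 - x)\<^sup>2 = 1 - 2 * x + x ^ 2" for x :: real by (simp add: power2_eq_square algebra_simps)
    show "integrable exponential_law (\<lambda>x. (1 - x)\<^sup>2)" "(LINT x|exponential_law. (1 - x)\<^sup>2) = 1"
      unfolding eq using ints by (simp_all add: exponential_law_moment(2))
  qed
  have near: "\<bar>(1 + K x)\<^sup>2 - (1 - x)\<^sup>2\<bar> \<le> err x" if x: "0 \<le> x" for x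
  proof -
    have "(1 + K x)\<^sup>2 - (1 - x)\<^sup>2 = (K x + x) * (2 + K x - x)"
      by (simp add: power2_eq_square algebra_simps)
    then have "\<bar>(1 + K x)\<^sup>2 - (1 - x)\<^sup>2\<bar> = \<bar>K x + x\<bar> * \<bar>2 + K x - x\<bar>" by (simp add: abs_mult)
    also have "\<dots> \<le> (\<epsilon> + x\<^sup>2 / lam) * (3 + 2 * x)"
      using K_dist[OF x] K_abs[OF x] x \<epsilon> by (intro mult_mono) auto
    also have "\<dots> = err x"
      by (simp add: err_def power2_eq_square power3_eq_cube algebra_simps)
    finally show ?thesis .
  qed
  have near': "(1 + K x)\<^sup>2 \<le> (1 - x)\<^sup>2 + err x" "- (1 + K x)\<^sup>2 \<le> err x - (1 - x)\<^sup>2" if "0 \<le> x" for x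
    using near[OF that] by linarith+
  have "expectation (\<lambda>\<omega>. (1 + gap \<epsilon> \<omega>)\<^sup>2) \<le> (LINT x|exponential_law. (1 - x)\<^sup>2 + err x)"
    by (rule le[of "\<lambda>y. (1 + y)\<^sup>2"]) (use square err near' in \<open>auto intro!: continuous_intros\<close>)
  moreover have "expectation (\<lambda>\<omega>. - (1 + gap \<epsilon> \<omega>)\<^sup>2) \<le> (LINT x|exponential_law. err x - (1 - x)\<^sup>2)"
    by (rule le[of "\<lambda>y. - (1 + y)\<^sup>2"]) (use square err near' in \<open>auto intro!: continuous_intros\<close>)
  ultimately show "\<bar>expectation (\<lambda>\<omega>. (1 + gap \<epsilon> \<omega>)\<^sup>2) - 1\<bar> \<le> 5 * \<epsilon> + 18 / lam"
    using square err by (simp add: abs_le_iff)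
  have "expectation (\<lambda>\<omega>. \<bar>1 + gap \<epsilon> \<omega>\<bar> ^ 3) \<le> (LINT x|exponential_law. 8 + 12 * x + 6 * x ^ 2 + x ^ 3)"
  proof (rule le[of "\<lambda>y. \<bar>1 + y\<bar> ^ 3"])
    fix x :: real assume x: "0 \<le> x"
    \<comment> \<open>The constant 38 is the expectation of the cube of \<open>2 + X\<close>.\<close>
    have "\<bar>1 + K x\<bar> ^ 3 \<le> (2 + x) ^ 3"
      using K_abs[OF x] \<epsilon> by (intro power_mono) auto
    also have "\<dots> = 8 + 12 * x + 6 * x ^ 2 + x ^ 3"
      by (simp add: power2_eq_square power3_eq_cube algebra_simps)
    finally show "\<bar>1 + K x\<bar> ^ 3 \<le> 8 + 12 * x + 6 * x ^ 2 + x ^ 3" .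
  qed (use ints in \<open>auto intro!: continuous_intros\<close>)
  also have "\<dots> = 38" using ints by (simp add: exponential_law_moment(2) f4)
  finally show "expectation (\<lambda>\<omega>. \<bar>1 + gap \<epsilon> \<omega>\<bar> ^ 3) \<le> 38" .
  have "expectation (\<lambda>\<omega>. (\<bar>gap \<epsilon> \<omega>\<bar> + 2) ^ 4) \<le>
      (LINT x|exponential_law. 81 + 108 * x + 54 * x ^ 2 + 12 * x ^ 3 + x ^ 4)"
  proof (rule le[of "\<lambda>y. (\<bar>y\<bar> + 2) ^ 4"])
    fix x :: real assume x: "0 \<le> x"
    \<comment> \<open>The constant 393 is the fourth moment of \<open>3 + X\<close>.\<close>
    have "(\<bar>K x\<bar> + 2) ^ 4 \<le> (x + 3) ^ 4"
      using K_abs[OF x] \<epsilon> by (intro power_mono) auto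
    also have "\<dots> = 81 + 108 * x + 54 * x ^ 2 + 12 * x ^ 3 + x ^ 4"
      by (simp add: power2_eq_square power3_eq_cube power4_eq_xxxx algebra_simps)
    finally show "(\<bar>K x\<bar> + 2) ^ 4 \<le> 81 + 108 * x + 54 * x ^ 2 + 12 * x ^ 3 + x ^ 4" .
  qed (use ints in \<open>auto intro!: continuous_intros\<close>)
  also have "\<dots> = 393" using ints by (simp add: exponential_law_moment(2) f4)
  finally show "expectation (\<lambda>\<omega>. (\<bar>gap \<epsilon> \<omega>\<bar> + 2) ^ 4) \<le> 393" .
qed

definition "remainder \<epsilon> \<omega> = zeta \<omega> - 1 - gap \<epsilon> \<omega>"

lemma remainder_measurable [measurable]: "remainder \<epsilon> \<in> borel_measurable M"
  unfolding remainder_def[abs_def] by measurable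

text \<open>On a nonempty cell the remainder is \<open>(lam - N) / N - T / N\<close> with \<open>T = a (f - Y)\<close>, up to the error of the
  capping, which is at most \<open>2 \<epsilon>\<close>. On an empty cell it equals \<open>- 1\<close>.\<close>

lemma remainder_square_le:
  assumes \<epsilon>: "0 \<le> \<epsilon>" "\<epsilon> \<le> 1" "1 \<le> lam" "a * (hi - lo) \<le> \<epsilon>"
    and \<omega>: "\<omega> \<in> space M" "Y \<omega> \<le> hi"
  shows "(remainder \<epsilon> \<omega>)\<^sup>2 \<le> indicator {\<omega> \<in> space M. N \<omega> = real 0} \<omega> + 3 * ((lam - N \<omega>)\<^sup>2 / (N \<omega>)\<^sup>2)
      + 3 / 2 * ((\<bar>gap \<epsilon> \<omega>\<bar> + 2) ^ 4 / lam + lam * (1 / (N \<omega>)\<^sup>2)) + 12 * \<epsilon>\<^sup>2"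
proof (cases "N \<omega> = 0")
  case True
  then have Y: "Y \<omega> = 0" using Y_zero \<omega> by simp
  have "remainder \<epsilon> \<omega> = -1"
    using \<epsilon> by (simp add: remainder_def zeta_def gap_def True Y lam_def)
  then have "(remainder \<epsilon> \<omega>)\<^sup>2 = 1" by simp
  moreover have "0 \<le> 3 / 2 * ((\<bar>gap \<epsilon> \<omega>\<bar> + 2) ^ 4 / lam)" using lam_pos by simp
  moreover have "0 \<le> 12 * \<epsilon>\<^sup>2" by simp
  ultimately show ?thesis using True \<omega> by simp
next
  case False
  obtain i where i: "N \<omega> = real i" using N_nat[OF \<omega>(1)] by (auto elim: Nats_cases)
  have N1: "1 \<le> N \<omega>" using False i by simp
  define T where "T = lam - a * Y \<omega>"
  have gap: "gap \<epsilon> \<omega> \<le> - T" "- T - gap \<epsilon> \<omega> \<le> 2 * \<epsilon>"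
  proof -
    have "a * Y \<omega> \<le> a * hi" using \<omega> a_pos by simp
    moreover have "a * lo \<le> lam" using lo_le a_pos by (simp add: lam_def)
    ultimately have "- T \<le> \<epsilon>" using \<epsilon>(4) unfolding T_def right_diff_distrib by linarith
    moreover have "gap \<epsilon> \<omega> = min (- \<epsilon>) (- T)" by (simp add: gap_def T_def lam_def right_diff_distrib)
    ultimately show "gap \<epsilon> \<omega> \<le> - T" "- T - gap \<epsilon> \<omega> \<le> 2 * \<epsilon>" using \<epsilon>(1) by auto
  qed
  have T: "\<bar>T\<bar> \<le> \<bar>gap \<epsilon> \<omega>\<bar> + 2" using gap \<epsilon> by linarith
  define A B C where Ad: "A = (lam - N \<omega>) / N \<omega>" and Bd: "B = - (T / N \<omega>)" and Cd: "C = - T - gap \<epsilon> \<omega>"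
  have R: "remainder \<epsilon> \<omega> = A + B + C"
    using N1 by (simp add: remainder_def zeta_def Ad Bd Cd T_def lam_def field_simps)
  have "(A + B + C)\<^sup>2 \<le> 3 * A\<^sup>2 + 3 * B\<^sup>2 + 3 * C\<^sup>2"
    using sum_squares_bound[of A B] sum_squares_bound[of B C] sum_squares_bound[of A C]
    by (simp add: power2_eq_square algebra_simps)
  moreover have "A\<^sup>2 = (lam - N \<omega>)\<^sup>2 / (N \<omega>)\<^sup>2" by (simp add: Ad power_divide)
  moreover have "C\<^sup>2 \<le> (2 * \<epsilon>)\<^sup>2" using gap unfolding Cd by (intro power_mono) auto
  then have C2: "3 * C\<^sup>2 \<le> 12 * \<epsilon>\<^sup>2" by (simp add: power_mult_distrib)
  moreover have "B\<^sup>2 \<le> 1 / 2 * ((\<bar>gap \<epsilon> \<omega>\<bar> + 2) ^ 4 / lam + lam * (1 / (N \<omega>)\<^sup>2))"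
  proof -
    define x where "x = T\<^sup>2"
    define y where "y = 1 / (N \<omega>)\<^sup>2"
    have y: "0 \<le> y" "y \<le> 1" using N1 by (auto simp: y_def divide_le_eq)
    have "B\<^sup>2 = x * y" by (simp add: Bd x_def y_def power_divide)
    also have "\<dots> \<le> 1 / 2 * (x\<^sup>2 / lam + lam * y\<^sup>2)"
    proof -
      have "0 \<le> (x - lam * y)\<^sup>2 / lam" using lam_pos by simp
      also have "\<dots> = x\<^sup>2 / lam + lam * y\<^sup>2 - 2 * (x * y)"
        using lam_pos by (simp add: power2_eq_square field_simps)
      finally show ?thesis by simp
    qed
    also have "\<dots> \<le> 1 / 2 * ((\<bar>gap \<epsilon> \<omega>\<bar> + 2) ^ 4 / lam + lam * y)"
    proof (intro mult_left_mono add_mono divide_right_mono)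
      have "x\<^sup>2 = \<bar>T\<bar> ^ 4" by (simp add: x_def power_even_abs flip: power_mult)
      also have "\<dots> \<le> (\<bar>gap \<epsilon> \<omega>\<bar> + 2) ^ 4" using T by (intro power_mono) auto
      finally show "x\<^sup>2 \<le> (\<bar>gap \<epsilon> \<omega>\<bar> + 2) ^ 4" .
      show "y\<^sup>2 \<le> y" using y by (simp add: power2_eq_square mult_left_le)
    qed (use lam_pos in auto)
    finally show ?thesis unfolding y_def .
  qed
  moreover have "indicator {\<omega> \<in> space M. N \<omega> = real 0} \<omega> = (0::real)" using False by simp
  ultimately show ?thesis using C2 unfolding R by linarith
qed

text \<open>The constant collects the expectations of the terms in \<open>remainder_square_le\<close>: 1 for the empty cell, 90 for
  the relative deviation of the count and less than 600 for the rest, all divided by \<open>lam\<close>.\<close>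

lemma remainder_second_moment:
  assumes \<epsilon>: "0 \<le> \<epsilon>" "\<epsilon> \<le> 1" "1 \<le> lam" "a * (hi - lo) \<le> \<epsilon>"
  shows "integrable M (\<lambda>\<omega>. (remainder \<epsilon> \<omega>)\<^sup>2)"
    and "expectation (\<lambda>\<omega>. (remainder \<epsilon> \<omega>)\<^sup>2) \<le> 700 / lam + 12 * \<epsilon>\<^sup>2"
proof -
  let ?b = "\<lambda>\<omega>. indicator {\<omega> \<in> space M. N \<omega> = real 0} \<omega> + 3 * ((lam - N \<omega>)\<^sup>2 / (N \<omega>)\<^sup>2)
      + 3 / 2 * ((\<bar>gap \<epsilon> \<omega>\<bar> + 2) ^ 4 / lam + lam * (1 / (N \<omega>)\<^sup>2)) + 12 * \<epsilon>\<^sup>2"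
  have ig: "integrable M (\<lambda>\<omega>. (\<bar>gap \<epsilon> \<omega>\<bar> + 2) ^ 4)"
  proof (rule integrable_const_bound[where B="(lam + 2) ^ 4"])
    show "AE \<omega> in M. norm ((\<bar>gap \<epsilon> \<omega>\<bar> + 2) ^ 4) \<le> (lam + 2) ^ 4"
    proof (rule AE_I2)
      fix \<omega> assume "\<omega> \<in> space M"
      from gap_bounds[OF this \<epsilon>(1)] \<epsilon> have "\<bar>gap \<epsilon> \<omega>\<bar> \<le> lam" by auto
      then have "(\<bar>gap \<epsilon> \<omega>\<bar> + 2) ^ 4 \<le> (lam + 2) ^ 4" by (intro power_mono) auto
      then show "norm ((\<bar>gap \<epsilon> \<omega>\<bar> + 2) ^ 4) \<le> (lam + 2) ^ 4" by simp
    qed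
  qed measurable
  have ib: "integrable M ?b"
    using ig expectation_centred_ratio_le(1) expectation_inverse_square_le(1)
    by (intro Bochner_Integration.integrable_add integrable_mult_right integrable_divide_zero integrable_real_indicator)
      (auto simp: less_top[symmetric])
  have le: "AE \<omega> in M. (remainder \<epsilon> \<omega>)\<^sup>2 \<le> ?b \<omega>"
    using AE_Y_le_hi AE_space
    by eventually_elim (rule remainder_square_le[OF \<epsilon>])
  show i: "integrable M (\<lambda>\<omega>. (remainder \<epsilon> \<omega>)\<^sup>2)"
  proof (rule Bochner_Integration.integrable_bound[OF ib])
    show "AE \<omega> in M. norm ((remainder \<epsilon> \<omega>)\<^sup>2) \<le> norm (?b \<omega>)"
      using le by eventually_elim (smt (verit) real_norm_def zero_le_power2)
  qed measurable
  have "expectation (\<lambda>\<omega>. (remainder \<epsilon> \<omega>)\<^sup>2) \<le> expectation ?b"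
    using i ib le by (rule integral_mono_AE)
  also have "expectation ?b = exp (- lam) + 3 * expectation (\<lambda>\<omega>. (lam - N \<omega>)\<^sup>2 / (N \<omega>)\<^sup>2)
     + 3 / 2 * (expectation (\<lambda>\<omega>. (\<bar>gap \<epsilon> \<omega>\<bar> + 2) ^ 4) / lam + lam * expectation (\<lambda>\<omega>. 1 / (N \<omega>)\<^sup>2)) + 12 * \<epsilon>\<^sup>2"
  proof -
    have 0: "expectation (\<lambda>\<omega>. indicator {\<omega> \<in> space M. N \<omega> = real 0} \<omega>) = exp (- lam)"
      using prob_N[of 0] by (simp add: poisson_weight_def lam_def)
    have 1: "integrable M (\<lambda>\<omega>. indicator {\<omega> \<in> space M. N \<omega> = real 0} \<omega> :: real)"
      by (intro integrable_real_indicator) (auto simp: less_top[symmetric])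
    have 2: "integrable M (\<lambda>\<omega>. 3 * ((lam - N \<omega>)\<^sup>2 / (N \<omega>)\<^sup>2))"
      by (rule integrable_mult_right, rule expectation_centred_ratio_le(1))
    have 3: "integrable M (\<lambda>\<omega>. (\<bar>gap \<epsilon> \<omega>\<bar> + 2) ^ 4 / lam)" "integrable M (\<lambda>\<omega>. lam * (1 / (N \<omega>)\<^sup>2))"
      by (rule integrable_divide_zero, rule ig) (rule integrable_mult_right, rule expectation_inverse_square_le(1))
    have 4: "integrable M (\<lambda>\<omega>. 3 / 2 * ((\<bar>gap \<epsilon> \<omega>\<bar> + 2) ^ 4 / lam + lam * (1 / (N \<omega>)\<^sup>2)))"
      by (rule integrable_mult_right, rule Bochner_Integration.integrable_add[OF 3])
    have 5: "expectation (\<lambda>\<omega>. (\<bar>gap \<epsilon> \<omega>\<bar> + 2) ^ 4 / lam + lam * (1 / (N \<omega>)\<^sup>2)) =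
       expectation (\<lambda>\<omega>. (\<bar>gap \<epsilon> \<omega>\<bar> + 2) ^ 4) / lam + lam * expectation (\<lambda>\<omega>. 1 / (N \<omega>)\<^sup>2)"
      unfolding Bochner_Integration.integral_add[OF 3] integral_mult_right_zero integral_divide_zero ..
    have "expectation ?b = expectation (\<lambda>\<omega>. indicator {\<omega> \<in> space M. N \<omega> = real 0} \<omega> + 3 * ((lam - N \<omega>)\<^sup>2 / (N \<omega>)\<^sup>2)
       + 3 / 2 * ((\<bar>gap \<epsilon> \<omega>\<bar> + 2) ^ 4 / lam + lam * (1 / (N \<omega>)\<^sup>2))) + 12 * \<epsilon>\<^sup>2"
      by (subst Bochner_Integration.integral_add[OF Bochner_Integration.integrable_add[OF Bochner_Integration.integrable_add[OF 1 2] 4]])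
         (simp_all add: prob_space)
    then show ?thesis
      unfolding Bochner_Integration.integral_add[OF Bochner_Integration.integrable_add[OF 1 2] 4]
        Bochner_Integration.integral_add[OF 1 2] 0 integral_mult_right_zero 5 .
  qed
  also have "\<dots> \<le> 1 / lam + 3 * (6 / lam\<^sup>2 * (lam + 4)) + 3 / 2 * (393 / lam + lam * (6 / lam\<^sup>2)) + 12 * \<epsilon>\<^sup>2"
  proof (intro add_mono mult_left_mono divide_right_mono)
    have "lam \<le> exp lam" using exp_ge_add_one_self[of lam] by linarith
    then show "exp (- lam) \<le> 1 / lam" using lam_pos by (simp add: exp_minus field_simps)
  qed (use \<epsilon> lam_pos expectation_centred_ratio_le(2) expectation_inverse_square_le(2) gap_moments(3)[OF \<epsilon>] in auto)
  also have "\<dots> \<le> 700 / lam + 12 * \<epsilon>\<^sup>2"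
  proof -
    have "6 / lam\<^sup>2 * (lam + 4) \<le> 6 / lam\<^sup>2 * (5 * lam)" using \<epsilon>(3) by (intro mult_left_mono) auto
    also have "\<dots> = 30 * (1 / lam)" using lam_pos by (simp add: power2_eq_square)
    finally have 1: "6 / lam\<^sup>2 * (lam + 4) \<le> 30 * (1 / lam)" .
    have 2: "lam * (6 / lam\<^sup>2) = 6 * (1 / lam)" using lam_pos by (simp add: power2_eq_square)
    have 3: "393 / lam = 393 * (1 / lam)" "700 / lam = 700 * (1 / lam)" by simp_all
    have arith: "x + 3 * q + 3 / 2 * (393 * x + 6 * x) + e \<le> 700 * x + e" if "0 \<le> x" "q \<le> 30 * x" for x q e :: real
      using that by (simp add: algebra_simps)
    have "0 \<le> 1 / lam" using lam_pos by simp
    from arith[OF this 1] show ?thesis unfolding 2 3 .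
  qed
  finally show "expectation (\<lambda>\<omega>. (remainder \<epsilon> \<omega>)\<^sup>2) \<le> 700 / lam + 12 * \<epsilon>\<^sup>2" .
qed

text \<open>The split of \<open>zeta\<close> is \<open>1 + gap \<epsilon>\<close>, with controlled second and third moments, plus the remainder.\<close>

lemma char_zeta_bound:
  assumes \<epsilon>: "0 \<le> \<epsilon>" "\<epsilon> \<le> 1" "1 \<le> lam" "a * (hi - lo) \<le> \<epsilon>"
    and \<beta>: "\<bar>expectation zeta\<bar> \<le> \<beta>"
    and \<eta>: "0 < \<eta>" "\<eta> \<le> 1" "5 * \<epsilon> + 18 / lam \<le> \<eta>" "2 * (700 / lam + 12 * \<epsilon>\<^sup>2) + 2 * \<beta>\<^sup>2 \<le> \<eta>\<^sup>2"
  shows "cmod (char (distr M borel (\<lambda>\<omega>. zeta \<omega> - expectation zeta)) s - exp (- s\<^sup>2 / 2))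
    \<le> s\<^sup>2 * (7 * \<eta> + 2 * 38 * \<bar>s\<bar> + s\<^sup>2)"
proof (rule char_approx_perturbed)
  let ?U = "\<lambda>\<omega>. 1 + gap \<epsilon> \<omega>" and ?V = "\<lambda>\<omega>. remainder \<epsilon> \<omega> - expectation zeta"
  show "?U \<in> borel_measurable M" "?V \<in> borel_measurable M" by measurable
  show "(\<lambda>\<omega>. zeta \<omega> - expectation zeta) = (\<lambda>\<omega>. ?U \<omega> + ?V \<omega>)"
    by (simp add: remainder_def)
  show "expectation (\<lambda>\<omega>. zeta \<omega> - expectation zeta) = 0"
    using integrable_zeta by (simp add: prob_space)
  have gap: "\<bar>?U \<omega>\<bar> \<le> 1 + lam" if "\<omega> \<in> space M" for \<omega>
    using gap_bounds[OF that \<epsilon>(1)] \<epsilon> by auto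
  show "integrable M (\<lambda>\<omega>. ?U \<omega> ^ 2)"
  proof (rule integrable_const_bound[where B="(1 + lam) ^ 2"])
    show "AE \<omega> in M. norm (?U \<omega> ^ 2) \<le> (1 + lam) ^ 2"
      using power_mono[OF gap, where n=2] by (intro AE_I2) simp
  qed measurable
  show "integrable M (\<lambda>\<omega>. \<bar>?U \<omega>\<bar> ^ 3)"
  proof (rule integrable_const_bound[where B="(1 + lam) ^ 3"])
    show "AE \<omega> in M. norm (\<bar>?U \<omega>\<bar> ^ 3) \<le> (1 + lam) ^ 3"
      using power_mono[OF gap, where n=3] by (intro AE_I2) simp
  qed measurable
  note R = remainder_second_moment[OF \<epsilon>]
  have V_le: "?V \<omega> ^ 2 \<le> 2 * (remainder \<epsilon> \<omega>)\<^sup>2 + 2 * \<beta>\<^sup>2" for \<omega>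
  proof -
    have "(x - y)\<^sup>2 \<le> 2 * x\<^sup>2 + 2 * y\<^sup>2" for x y :: real
      using sum_squares_bound[of x "- y"] by (simp add: power2_diff)
    moreover have "(expectation zeta)\<^sup>2 \<le> \<beta>\<^sup>2"
      using power_mono[OF \<beta>, of 2] by simp
    ultimately show ?thesis by (smt (verit))
  qed
  have iR: "integrable M (\<lambda>\<omega>. 2 * (remainder \<epsilon> \<omega>)\<^sup>2 + 2 * \<beta>\<^sup>2)" using R(1) by simp
  show iV: "integrable M (\<lambda>\<omega>. ?V \<omega> ^ 2)"
  proof (rule Bochner_Integration.integrable_bound[OF iR])
    show "AE \<omega> in M. norm (?V \<omega> ^ 2) \<le> norm (2 * (remainder \<epsilon> \<omega>)\<^sup>2 + 2 * \<beta>\<^sup>2)"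
      using V_le by (intro AE_I2) simp
  qed measurable
  have "expectation (\<lambda>\<omega>. ?V \<omega> ^ 2) \<le> expectation (\<lambda>\<omega>. 2 * (remainder \<epsilon> \<omega>)\<^sup>2 + 2 * \<beta>\<^sup>2)"
    using iV iR V_le by (rule integral_mono)
  also have "\<dots> = 2 * expectation (\<lambda>\<omega>. (remainder \<epsilon> \<omega>)\<^sup>2) + 2 * \<beta>\<^sup>2"
    using R(1) by (simp add: prob_space)
  also have "\<dots> \<le> 2 * (700 / lam + 12 * \<epsilon>\<^sup>2) + 2 * \<beta>\<^sup>2"
    using R(2) by (intro add_right_mono mult_left_mono) simp_all
  also note \<eta>(4)
  finally show "expectation (\<lambda>\<omega>. ?V \<omega> ^ 2) \<le> \<eta>\<^sup>2" .
  show "\<bar>expectation (\<lambda>\<omega>. ?U \<omega> ^ 2) - 1\<bar> \<le> \<eta>"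
    using gap_moments(1)[OF \<epsilon>] \<eta>(3) by linarith
  show "expectation (\<lambda>\<omega>. \<bar>?U \<omega>\<bar> ^ 3) \<le> 38" by (rule gap_moments(2)[OF \<epsilon>])
qed (use \<eta> in auto)

end


section \<open>Poisson processes under the graph of a function\<close>

definition upper_part :: "('e \<Rightarrow> real) \<Rightarrow> 'e set \<Rightarrow> real \<Rightarrow> ('e \<times> real) set" where
  "upper_part f A y = {(x, z). x \<in> A \<and> y < z \<and> z \<le> f x}"

definition lower_part :: "('e \<Rightarrow> real) \<Rightarrow> 'e set \<Rightarrow> real \<Rightarrow> ('e \<times> real) set" where
  "lower_part f A y = {(x, z). x \<in> A \<and> 0 \<le> z \<and> z \<le> min y (f x)}"

lemma hypograph_split:
  assumes "0 \<le> y"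
  shows "hypograph f A = upper_part f A y \<union> lower_part f A y"
    and "upper_part f A y \<inter> lower_part f A y = {}"
  using assms by (auto simp: hypograph_def upper_part_def lower_part_def)

text \<open>The mean height, over the cell, of the part of the region under the graph that lies below level \<open>y\<close>.\<close>

definition cell_floor :: "'e measure \<Rightarrow> ('e \<Rightarrow> real) \<Rightarrow> 'e set \<Rightarrow> real \<Rightarrow> real" where
  "cell_floor \<nu> f A y = (LINT x:A|\<nu>. min y (f x)) / measure \<nu> A"

locale hypograph_process = P: prob_space P + \<nu>: prob_space \<nu>
  for P :: "'w measure" and \<nu> :: "'e measure" +
  fixes f :: "'e \<Rightarrow> real" and t :: real and N :: "'w \<Rightarrow> ('e \<times> real) measure"
    and X :: "'w \<Rightarrow> nat \<Rightarrow> 'e" and Y :: "'w \<Rightarrow> nat \<Rightarrow> real"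
  assumes f_meas[measurable]: "f \<in> borel_measurable \<nu>" and f_nonneg: "\<And>x. x \<in> space \<nu> \<Longrightarrow> 0 \<le> f x"
    and f_int: "integrable \<nu> f" and t_pos: "0 < t"
    and ppp: "poisson_point_process P (intensity \<nu> f t) N"
    and enum: "\<And>\<omega>. \<omega> \<in> space P \<Longrightarrow> enumerates_points (N \<omega>) (hypograph f (space \<nu>)) (X \<omega>) (Y \<omega>)"
begin

definition "half_space = \<nu> \<Otimes>\<^sub>M restrict_space lborel {0::real..}"

lemma sets_intensity: "sets (intensity \<nu> f t) = sets half_space"
  by (simp add: intensity_def half_space_def)

lemma space_half_space: "space half_space = space \<nu> \<times> {0..}"
  by (simp add: half_space_def space_pair_measure space_restrict_space)

lemma fst_half_space [measurable]: "fst \<in> measurable half_space \<nu>"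
  unfolding half_space_def by measurable

lemma snd_half_space [measurable]: "snd \<in> borel_measurable half_space"
proof -
  have "(\<lambda>x. x) \<in> measurable (restrict_space lborel {0::real..}) borel"
    by (intro measurable_restrict_space1) simp
  from measurable_compose[OF measurable_snd this, of \<nu>] show ?thesis
    unfolding half_space_def by simp
qed

lemma upper_part_sets:
  assumes [measurable]: "A \<in> sets \<nu>" and "0 \<le> y"
  shows "upper_part f A y \<in> sets half_space"
proof -
  have "upper_part f A y = {p \<in> space half_space. fst p \<in> A \<and> y < snd p \<and> snd p \<le> f (fst p)}"
    using assms sets.sets_into_space[OF assms(1)] by (auto simp: upper_part_def space_half_space)
  also have "\<dots> \<in> sets half_space" by measurable
  finally show ?thesis .
qed

lemma lower_part_sets:
  assumes [measurable]: "A \<in> sets \<nu>"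
  shows "lower_part f A y \<in> sets half_space"
proof -
  have "lower_part f A y = {p \<in> space half_space. fst p \<in> A \<and> snd p \<le> min y (f (fst p))}"
    using sets.sets_into_space[OF assms(1)] by (auto simp: lower_part_def space_half_space)
  also have "\<dots> \<in> sets half_space" by measurable
  finally show ?thesis .
qed

lemma hypograph_sets:
  assumes "A \<in> sets \<nu>"
  shows "hypograph f A \<in> sets half_space"
  unfolding hypograph_split(1)[OF order_refl]
  using upper_part_sets[OF assms order_refl] lower_part_sets[OF assms] by blast

text \<open>Integration of the lengths of the vertical slices.\<close>

lemma emeasure_intensity:
  assumes B: "B \<in> sets half_space" "B \<subseteq> hypograph f (space \<nu>)"
    and h: "integrable \<nu> h" "\<And>x. x \<in> space \<nu> \<Longrightarrow> 0 \<le> h x"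
    and slice: "\<And>x. x \<in> space \<nu> \<Longrightarrow> emeasure lborel (Pair x -` B) = ennreal (h x)"
  shows "emeasure (intensity \<nu> f t) B = ennreal (t * (LINT x|\<nu>. h x))"
proof -
  have S: "hypograph f (space \<nu>) \<in> sets half_space" by (rule hypograph_sets) simp
  have sf: "sigma_finite_measure (restrict_space lborel {0::real..})"
    by (rule sigma_finite_measure_restrict_space) (auto intro: sigma_finite_lborel)
  have dens: "(\<lambda>z. ennreal t * indicator (hypograph f (space \<nu>)) z) \<in> borel_measurable half_space"
    using S by measurable
  have "emeasure (intensity \<nu> f t) B =
      (\<integral>\<^sup>+z. (ennreal t * indicator (hypograph f (space \<nu>)) z) * indicator B z \<partial>half_space)"
    unfolding intensity_def half_space_def[symmetric] using dens B(1) by (rule emeasure_density)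
  also have "\<dots> = (\<integral>\<^sup>+z. ennreal t * indicator B z \<partial>half_space)"
    using B(2) by (intro nn_integral_cong) (auto split: split_indicator)
  also have "\<dots> = ennreal t * emeasure half_space B"
    using B(1) by (rule nn_integral_cmult_indicator)
  also have "emeasure half_space B = (\<integral>\<^sup>+x. emeasure (restrict_space lborel {0::real..}) (Pair x -` B) \<partial>\<nu>)"
    using B(1) unfolding half_space_def by (rule sigma_finite_measure.emeasure_pair_measure_alt[OF sf])
  also have "\<dots> = (\<integral>\<^sup>+x. ennreal (h x) \<partial>\<nu>)"
  proof (rule nn_integral_cong)
    fix x assume x: "x \<in> space \<nu>"
    have "Pair x -` B \<subseteq> {0..}" using B(2) by (auto simp: hypograph_def)
    then show "emeasure (restrict_space lborel {0::real..}) (Pair x -` B) = ennreal (h x)"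
      using slice[OF x] by (subst emeasure_restrict_space) auto
  qed
  also have "\<dots> = ennreal (LINT x|\<nu>. h x)"
    using h by (intro nn_integral_eq_integral AE_I2) auto
  finally show ?thesis using t_pos h by (simp add: ennreal_mult integral_nonneg_AE)
qed

lemma integrable_min_f: "A \<in> sets \<nu> \<Longrightarrow> 0 \<le> y \<Longrightarrow> integrable \<nu> (\<lambda>x. indicator A x * min y (f x))"
  by (rule Bochner_Integration.integrable_bound[OF f_int])
     (auto intro!: AE_I2 split: split_indicator simp: f_nonneg)

lemma integrable_f_on: "A \<in> sets \<nu> \<Longrightarrow> integrable \<nu> (\<lambda>x. indicator A x * f x)"
  by (rule Bochner_Integration.integrable_bound[OF f_int]) (auto intro!: AE_I2 split: split_indicator)

context
  fixes A assumes A[measurable]: "A \<in> sets \<nu>" and A_pos: "0 < measure \<nu> A"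
begin

lemma lower_part_intensity:
  assumes y: "0 \<le> y"
  shows "emeasure (intensity \<nu> f t) (lower_part f A y) = ennreal (t * measure \<nu> A * cell_floor \<nu> f A y)"
proof -
  have "emeasure (intensity \<nu> f t) (lower_part f A y) = ennreal (t * (LINT x|\<nu>. indicator A x * min y (f x)))"
  proof (rule emeasure_intensity)
    fix x assume x: "x \<in> space \<nu>"
    have "Pair x -` lower_part f A y = (if x \<in> A then {0..min y (f x)} else {})"
      by (auto simp: lower_part_def)
    then show "emeasure lborel (Pair x -` lower_part f A y) = ennreal (indicator A x * min y (f x))"
      using y f_nonneg[OF x] by simp
  next
    show "lower_part f A y \<subseteq> hypograph f (space \<nu>)"
      using sets.sets_into_space[OF A] by (auto simp: lower_part_def hypograph_def)
  qed (use y A in \<open>auto simp: lower_part_sets integrable_min_f f_nonneg\<close>)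
  also have "t * (LINT x|\<nu>. indicator A x * min y (f x)) = t * measure \<nu> A * cell_floor \<nu> f A y"
    using A_pos by (simp add: cell_floor_def set_lebesgue_integral_def)
  finally show ?thesis .
qed

lemma upper_part_intensity:
  assumes y: "0 \<le> y"
  shows "emeasure (intensity \<nu> f t) (upper_part f A y) =
    ennreal (t * measure \<nu> A * (cell_mean \<nu> f A - cell_floor \<nu> f A y))"
proof -
  have eq: "indicator A x * (f x - min y (f x)) = indicator A x * f x - indicator A x * min y (f x)" for x
    by (simp add: right_diff_distrib)
  have "emeasure (intensity \<nu> f t) (upper_part f A y) =
      ennreal (t * (LINT x|\<nu>. indicator A x * (f x - min y (f x))))"
  proof (rule emeasure_intensity)
    fix x assume x: "x \<in> space \<nu>"
    have "Pair x -` upper_part f A y = (if x \<in> A then {y<..f x} else {})"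
      by (auto simp: upper_part_def)
    then show "emeasure lborel (Pair x -` upper_part f A y) = ennreal (indicator A x * (f x - min y (f x)))"
      by (cases "y \<le> f x") (auto simp: min_def)
  next
    show "upper_part f A y \<subseteq> hypograph f (space \<nu>)"
      using sets.sets_into_space[OF A] y by (auto simp: upper_part_def hypograph_def)
  qed (use y A in \<open>auto simp: upper_part_sets eq integrable_min_f integrable_f_on split: split_indicator\<close>)
  also have "t * (LINT x|\<nu>. indicator A x * (f x - min y (f x))) =
      t * measure \<nu> A * (cell_mean \<nu> f A - cell_floor \<nu> f A y)"
    using A_pos integrable_min_f[OF A y] integrable_f_on[OF A]
    by (simp add: cell_floor_def cell_mean_def set_lebesgue_integral_def eq
        diff_divide_distrib[symmetric])
  finally show ?thesis .
qed

end

abbreviation "tally B \<omega> \<equiv> emeasure (N \<omega>) B"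

lemma sets_N: "\<omega> \<in> space P \<Longrightarrow> sets (N \<omega>) = sets half_space"
  using ppp unfolding poisson_point_process_def sets_intensity by simp

lemma tally_measurable: "B \<in> sets half_space \<Longrightarrow> (\<lambda>\<omega>. tally B \<omega>) \<in> borel_measurable P"
  using ppp unfolding poisson_point_process_def sets_intensity by simp

lemma tally_values: "\<omega> \<in> space P \<Longrightarrow> B \<in> sets half_space \<Longrightarrow> tally B \<omega> = \<infinity> \<or> (\<exists>j::nat. tally B \<omega> = of_nat j)"
  using ppp unfolding poisson_point_process_def sets_intensity by fastforce

lemma prob_tally:
  assumes "B \<in> sets half_space" "emeasure (intensity \<nu> f t) B = ennreal l" "0 \<le> l"
  shows "P.prob {\<omega> \<in> space P. tally B \<omega> = of_nat j} = poisson_weight l j"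
  using ppp assms unfolding poisson_point_process_def sets_intensity
  by (auto simp: poisson_weight_def measure_def)

text \<open>The Poisson probabilities of the finite values add up to 1.\<close>

lemma AE_tally_finite:
  assumes B: "B \<in> sets half_space" "emeasure (intensity \<nu> f t) B = ennreal l" "0 \<le> l"
  shows "AE \<omega> in P. tally B \<omega> \<noteq> \<infinity>"
proof -
  note tally_measurable[OF B(1), measurable]
  let ?E = "\<lambda>j::nat. {\<omega> \<in> space P. tally B \<omega> = of_nat j}"
  have "(\<lambda>j. P.prob (?E j)) sums P.prob (\<Union>j. ?E j)"
    by (intro P.finite_measure_UNION) (auto simp: disjoint_family_on_def)
  then have "poisson_weight l sums P.prob (\<Union>j. ?E j)" unfolding prob_tally[OF B] .
  then have "P.prob (\<Union>j. ?E j) = 1" using poisson_weight_sums sums_unique2 by blast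
  moreover have "(\<Union>j. ?E j) \<in> P.events" by measurable
  ultimately have "AE \<omega> in P. \<omega> \<in> (\<Union>j. ?E j)" by (simp add: P.prob_eq_1)
  then show ?thesis by eventually_elim auto
qed

lemma indep_tallies:
  fixes B :: "nat \<Rightarrow> ('e \<times> real) set"
  assumes "\<And>i. B i \<in> sets half_space" "disjoint_family B"
  shows "P.indep_vars (\<lambda>_. borel) (\<lambda>i \<omega>. tally (B i) \<omega>) UNIV"
  using ppp assms unfolding poisson_point_process_def sets_intensity by (auto simp: image_subset_iff)

definition "cell_num A \<omega> = measure (N \<omega>) (hypograph f A)"
definition "cell_max A \<omega> = Y_star (N \<omega>) (hypograph f (space \<nu>)) (X \<omega>) (Y \<omega>) (hypograph f A)"

abbreviation "points \<omega> B \<equiv> point_indices (N \<omega>) (hypograph f (space \<nu>)) (X \<omega>) (Y \<omega>) B"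

lemma tally_points: "\<omega> \<in> space P \<Longrightarrow> B \<in> sets half_space \<Longrightarrow> tally B \<omega> = emeasure (count_space UNIV) (points \<omega> B)"
  using enum sets_N unfolding enumerates_points_def by blast

lemma cell_num_nat: "\<omega> \<in> space P \<Longrightarrow> A \<in> sets \<nu> \<Longrightarrow> cell_num A \<omega> \<in> \<nat>"
  using tally_values[OF _ hypograph_sets, of \<omega> A] by (auto simp: cell_num_def measure_def)

lemma points_in_cell:
  assumes "\<omega> \<in> space P" "A \<in> sets \<nu>" "cell_num A \<omega> \<noteq> 0"
  shows "finite (points \<omega> (hypograph f A))" "points \<omega> (hypograph f A) \<noteq> {}"
proof -
  have "tally (hypograph f A) \<omega> = emeasure (count_space UNIV) (points \<omega> (hypograph f A))"
    using assms by (intro tally_points hypograph_sets)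
  then show "finite (points \<omega> (hypograph f A))" "points \<omega> (hypograph f A) \<noteq> {}"
    using assms(3) by (auto simp: cell_num_def measure_def emeasure_count_space split: if_splits)
qed

lemma cell_max_nonneg:
  assumes "\<omega> \<in> space P" "A \<in> sets \<nu>"
  shows "0 \<le> cell_max A \<omega>"
proof (cases "cell_num A \<omega> = 0")
  case False
  from points_in_cell[OF assms False] obtain i where "i \<in> points \<omega> (hypograph f A)" by blast
  moreover from this have "0 \<le> Y \<omega> i" by (auto simp: point_indices_def hypograph_def)
  ultimately have "0 \<le> Max (Y \<omega> ` points \<omega> (hypograph f A))"
    using points_in_cell[OF assms False] by (subst Max_ge_iff) auto
  then show ?thesis by (simp add: cell_max_def Y_star_def)
qed (simp add: cell_max_def Y_star_def cell_num_def)

lemma cell_max_zero: "cell_num A \<omega> = 0 \<Longrightarrow> cell_max A \<omega> = 0"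
  by (simp add: cell_max_def Y_star_def cell_num_def)

text \<open>The maximum is expressed through a number of points, which makes its measurability and its law
  accessible. A cell whose number of points is 0 or infinite has \<open>cell_num\<close> equal to 0 and, by convention, maximum 0.\<close>

lemma cell_max_le_iff:
  assumes "\<omega> \<in> space P" "A \<in> sets \<nu>" "0 \<le> y"
  shows "cell_max A \<omega> \<le> y \<longleftrightarrow> cell_num A \<omega> = 0 \<or> tally (upper_part f A y) \<omega> = 0"
proof (cases "cell_num A \<omega> = 0")
  case False
  note pts = points_in_cell[OF assms(1,2) False]
  have "cell_max A \<omega> = Max (Y \<omega> ` points \<omega> (hypograph f A))"
    using False by (simp add: cell_max_def Y_star_def cell_num_def)
  then have "cell_max A \<omega> \<le> y \<longleftrightarrow> (\<forall>i\<in>points \<omega> (hypograph f A). Y \<omega> i \<le> y)"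
    using pts by simp
  also have "\<dots> \<longleftrightarrow> points \<omega> (upper_part f A y) = {}"
    using assms(3) by (force simp: point_indices_def hypograph_def upper_part_def)
  also have "\<dots> \<longleftrightarrow> tally (upper_part f A y) \<omega> = 0"
    using tally_points[OF assms(1) upper_part_sets[OF assms(2,3)]] by (simp add: emeasure_count_space_eq_0)
  finally show ?thesis using False by simp
qed (use assms in \<open>simp add: cell_max_zero\<close>)

lemma cell_num_eq:
  assumes "\<omega> \<in> space P" "A \<in> sets \<nu>" "0 \<le> y"
  shows "cell_num A \<omega> = enn2real (tally (upper_part f A y) \<omega> + tally (lower_part f A y) \<omega>)"
  using assms upper_part_sets lower_part_sets sets_N hypograph_split[OF assms(3), of f A]
  by (simp add: cell_num_def measure_def plus_emeasure)

lemma cell_num_measurable [measurable]: "A \<in> sets \<nu> \<Longrightarrow> cell_num A \<in> borel_measurable P"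
  unfolding cell_num_def[abs_def] measure_def using tally_measurable[OF hypograph_sets] by measurable

lemma cell_max_measurable [measurable]:
  assumes A: "A \<in> sets \<nu>"
  shows "cell_max A \<in> borel_measurable P"
proof (subst borel_measurable_iff_le, intro allI)
  fix y
  show "{\<omega> \<in> space P. cell_max A \<omega> \<le> y} \<in> P.events"
  proof (cases "0 \<le> y")
    case True
    note tally_measurable[OF upper_part_sets[OF A True], measurable] and A[measurable]
    have "{\<omega> \<in> space P. cell_max A \<omega> \<le> y} = {\<omega> \<in> space P. cell_num A \<omega> = 0 \<or> tally (upper_part f A y) \<omega> = 0}"
      using cell_max_le_iff[OF _ A True] by auto
    also have "\<dots> \<in> P.events" by measurable
    finally show ?thesis .
  next
    case False
    then have "{\<omega> \<in> space P. cell_max A \<omega> \<le> y} = {}" using cell_max_nonneg[OF _ A] by force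
    then show ?thesis by (simp only: sets.empty_sets)
  qed
qed

definition "cell_event A j y = {\<omega> \<in> space P. cell_num A \<omega> = j \<and> cell_max A \<omega> \<le> y}"

text \<open>The condition on the numbers \<open>u\<close> and \<open>l\<close> of points above and below a level under which the cell has
  \<open>j\<close> points, all of them below the level. For \<open>j = 0\<close> the maximum is 0 by convention, so the level imposes
  no condition.\<close>

definition "tally_pairs j = {(u, l). enn2real (u + l) = (j::real) \<and> (j \<noteq> 0 \<longrightarrow> u = (0::ennreal))}"

lemma tally_pairs_sets: "tally_pairs j \<in> sets (borel \<Otimes>\<^sub>M borel)"
proof -
  have "tally_pairs j = {p \<in> space (borel \<Otimes>\<^sub>M borel). enn2real (fst p + snd p) = j \<and> (j \<noteq> 0 \<longrightarrow> fst p = 0)}"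
    by (auto simp: tally_pairs_def space_pair_measure)
  also have "\<dots> \<in> sets (borel \<Otimes>\<^sub>M borel)" by measurable
  finally show ?thesis .
qed

lemma cell_event_eq:
  assumes A: "A \<in> sets \<nu>" and y: "0 \<le> y"
  shows "cell_event A j y =
    (\<lambda>\<omega>. (tally (upper_part f A y) \<omega>, tally (lower_part f A y) \<omega>)) -` tally_pairs j \<inter> space P"
proof -
  have "cell_num A \<omega> = j \<and> cell_max A \<omega> \<le> y \<longleftrightarrow>
    (tally (upper_part f A y) \<omega>, tally (lower_part f A y) \<omega>) \<in> tally_pairs j" if "\<omega> \<in> space P" for \<omega>
    using that cell_max_le_iff[OF that A y] cell_num_eq[OF that A y] by (auto simp: tally_pairs_def)
  then show ?thesis by (auto simp: cell_event_def)
qed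

lemma cell_event_empty: "A \<in> sets \<nu> \<Longrightarrow> y < 0 \<Longrightarrow> cell_event A j y = {}"
  using cell_max_nonneg by (force simp: cell_event_def)

lemma cell_event_sets:
  assumes A: "A \<in> sets \<nu>"
  shows "cell_event A j y \<in> P.events"
proof -
  note cell_num_measurable[OF A, measurable] cell_max_measurable[OF A, measurable]
  show ?thesis unfolding cell_event_def by measurable
qed

text \<open>A choice of one level per cell cuts the cells into upper and lower parts. These are disjoint, so their
  numbers of points are independent, and each event depends on the two parts of its own cell only.\<close>

lemma indep_cells:
  assumes A: "\<And>r. r \<in> R \<Longrightarrow> A r \<in> sets \<nu>" "disjoint_family_on A R"
  shows "P.indep_sets (\<lambda>r. {cell_event (A r) j y | j y. True}) (R :: nat set)"
proof (rule P.indep_setsI)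
  fix r assume "r \<in> R"
  then show "{cell_event (A r) j y | j y. True} \<subseteq> P.events" using A by (auto intro: cell_event_sets)
next
  fix C J assume J: "J \<noteq> {}" "J \<subseteq> R" "finite J" and C: "\<forall>r\<in>J. C r \<in> {cell_event (A r) j y | j y. True}"
  then have "\<forall>r\<in>J. \<exists>p. C r = cell_event (A r) (fst p) (snd p)" by auto
  then obtain p where p: "\<And>r. r \<in> J \<Longrightarrow> C r = cell_event (A r) (fst (p r)) (snd (p r))"
    unfolding bchoice_iff by blast
  define j y where jy: "j r = fst (p r)" "y r = snd (p r)" for r
  have C: "C r = cell_event (A r) (j r) (y r)" if "r \<in> J" for r using p[OF that] by (simp add: jy)
  show "P.prob (\<Inter>r\<in>J. C r) = (\<Prod>r\<in>J. P.prob (C r))"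
  proof (cases "\<forall>r\<in>J. 0 \<le> y r")
    case False
    then obtain r where r: "r \<in> J" "y r < 0" by (auto simp: not_le)
    then have "C r = {}" using C cell_event_empty A J by (metis subsetD)
    then have "(\<Inter>r\<in>J. C r) = {}" using r by auto
    moreover have "(\<Prod>r\<in>J. P.prob (C r)) = 0"
      using J(3) r(1) \<open>C r = {}\<close> by (intro prod_zero bexI[of _ r]) simp_all
    ultimately have "(\<Inter>r\<in>J. C r) = {}" "(\<Prod>r\<in>J. P.prob (C r)) = 0" by auto
    then show ?thesis by (simp only: measure_empty)
  next
    case True
    \<comment> \<open>The upper part of cell \<open>r\<close> has index \<open>2 r\<close> and its lower part \<open>2 r + 1\<close>; the independence property
      concerns sequences of sets.\<close>
    define B where "B i = (if i div 2 \<in> J then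
        if even i then upper_part f (A (i div 2)) (y (i div 2)) else lower_part f (A (i div 2)) (y (i div 2))
      else {})" for i
    have B_sets: "B i \<in> sets half_space" for i
      using True J A(1) by (auto simp: B_def intro!: upper_part_sets lower_part_sets)
    have B_disj: "disjoint_family B"
    proof -
      have "B i \<inter> B i' = {}" if "i \<noteq> i'" for i i'
      proof (cases "i div 2 = i' div 2")
        case True
        then have "even i \<noteq> even i'" using \<open>i \<noteq> i'\<close> by (metis div_mult_mod_eq even_iff_mod_2_eq_zero odd_iff_mod_2_eq_one)
        then show ?thesis using True by (auto simp: B_def upper_part_def lower_part_def)
      next
        case False
        then have "A (i div 2) \<inter> A (i' div 2) = {}" if "i div 2 \<in> J" "i' div 2 \<in> J"
          using A(2) J that by (auto simp: disjoint_family_on_def)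
        then show ?thesis by (auto simp: B_def upper_part_def lower_part_def)
      qed
      then show ?thesis by (auto simp: disjoint_family_on_def)
    qed
    define K where "K r = {2 * r, Suc (2 * r)}" for r :: nat
    have "P.indep_vars (\<lambda>r. Pi\<^sub>M (K r) (\<lambda>_. borel)) (\<lambda>r \<omega>. restrict (\<lambda>i. tally (B i) \<omega>) (K r)) J"
    proof (rule P.indep_vars_restrict[OF indep_tallies[OF B_sets B_disj]])
      have K_div: "i div 2 = r" if "i \<in> K r" for i r using that by (auto simp: K_def)
      show "disjoint_family_on K J"
        unfolding disjoint_family_on_def disjoint_iff using K_div by metis
    qed auto
    then have "P.indep_vars (\<lambda>_. borel \<Otimes>\<^sub>M borel)
        (\<lambda>r \<omega>. (\<lambda>z. (z (2 * r), z (Suc (2 * r)))) (restrict (\<lambda>i. tally (B i) \<omega>) (K r))) J"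
    proof (rule P.indep_vars_compose2)
      fix r
      have "2 * r \<in> K r" "Suc (2 * r) \<in> K r" by (auto simp: K_def)
      then show "(\<lambda>z. (z (2 * r), z (Suc (2 * r)))) \<in> Pi\<^sub>M (K r) (\<lambda>_. borel) \<rightarrow>\<^sub>M borel \<Otimes>\<^sub>M borel"
        by (intro measurable_Pair measurable_component_singleton)
    qed
    then have ind: "P.indep_vars (\<lambda>_. borel \<Otimes>\<^sub>M borel) (\<lambda>r \<omega>. (tally (B (2 * r)) \<omega>, tally (B (Suc (2 * r))) \<omega>)) J"
      by (simp add: K_def)
    have ev: "C r = (\<lambda>\<omega>. (tally (B (2 * r)) \<omega>, tally (B (Suc (2 * r))) \<omega>)) -` tally_pairs (j r) \<inter> space P"
      if r: "r \<in> J" for r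
    proof -
      have "B (2 * r) = upper_part f (A r) (y r)" "B (Suc (2 * r)) = lower_part f (A r) (y r)"
        using r by (simp_all add: B_def)
      moreover have "A r \<in> sets \<nu>" using A(1) J r by blast
      ultimately show ?thesis
        unfolding C[OF r] using cell_event_eq[of "A r" "y r" "j r"] True r by simp
    qed
    show ?thesis
      using P.indep_varsD_finite[OF ind J(1,3), of "\<lambda>r. tally_pairs (j r)"] tally_pairs_sets
      by (simp add: ev cong: INF_cong prod.cong)
  qed
qed

text \<open>The events of the previous lemma are closed under intersection and generate the \<open>\<sigma>\<close>-algebra of the pair
  of count and maximum.\<close>

lemma indep_cell_estimates:
  assumes A: "\<And>r. r \<in> R \<Longrightarrow> A r \<in> sets \<nu>" "disjoint_family_on A R"
  shows "P.indep_vars (\<lambda>_. borel) (\<lambda>r \<omega>. (1 + 1 / cell_num (A r) \<omega>) * cell_max (A r) \<omega>) (R :: nat set)"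
  unfolding P.indep_vars_def2
proof (intro conjI ballI)
  fix r assume r: "r \<in> R"
  then have [measurable]: "A r \<in> sets \<nu>" by (rule A)
  show "(\<lambda>\<omega>. (1 + 1 / cell_num (A r) \<omega>) * cell_max (A r) \<omega>) \<in> borel_measurable P" by measurable
next
  let ?F = "\<lambda>r. {cell_event (A r) j y | j y. True}"
  have "P.indep_sets (\<lambda>r. sigma_sets (space P) (?F r)) R"
  proof (rule P.indep_sets_sigma[OF indep_cells[OF A]])
    fix r assume r: "r \<in> R"
    show "Int_stable (?F r)"
    proof (rule Int_stableI)
      fix a b assume "a \<in> ?F r" "b \<in> ?F r"
      then obtain j y j' y' where ab: "a = cell_event (A r) j y" "b = cell_event (A r) j' y'" by blast
      \<comment> \<open>No maximum is negative, so the second alternative is the empty set in the required form.\<close>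
      have "a \<inter> b = (if j = j' then cell_event (A r) j (min y y') else cell_event (A r) 0 (-1))"
        unfolding ab using cell_event_empty[OF A(1)[OF r], of "-1" 0] by (auto simp: cell_event_def)
      then show "a \<inter> b \<in> ?F r" by auto
    qed
  qed
  then show "P.indep_sets (\<lambda>r. {(\<lambda>\<omega>. (1 + 1 / cell_num (A r) \<omega>) * cell_max (A r) \<omega>) -` B \<inter> space P | B. B \<in> sets borel}) R"
  proof (rule P.indep_sets_mono_sets)
    fix r assume r: "r \<in> R"
    define S where "S = sigma (space P) (?F r)"
    have F_sub: "?F r \<subseteq> Pow (space P)" by (auto simp: cell_event_def)
    have sp: "space S = space P" unfolding S_def using F_sub by (rule space_measure_of)
    have ss: "sets S = sigma_sets (space P) (?F r)" unfolding S_def using F_sub by (rule sets_measure_of)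
    have ev: "cell_event (A r) j y \<in> sets S" for j y unfolding ss by blast
    have num: "cell_num (A r) \<in> borel_measurable S"
    proof (subst borel_measurable_iff_le, intro allI)
      fix c
      have "{\<omega> \<in> space S. cell_num (A r) \<omega> \<le> c} = (\<Union>j\<in>{j. real j \<le> c}. \<Union>m::nat. cell_event (A r) (real j) (real m))"
        unfolding sp
      proof (intro equalityI subsetI)
        fix \<omega> assume "\<omega> \<in> {\<omega> \<in> space P. cell_num (A r) \<omega> \<le> c}"
        then have \<omega>: "\<omega> \<in> space P" "cell_num (A r) \<omega> \<le> c" by auto
        from cell_num_nat[OF \<omega>(1) A(1)[OF r]] obtain j where "cell_num (A r) \<omega> = real j" by (auto elim: Nats_cases)
        moreover obtain m :: nat where "cell_max (A r) \<omega> \<le> real m" using real_arch_simple by blast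
        ultimately show "\<omega> \<in> (\<Union>j\<in>{j. real j \<le> c}. \<Union>m::nat. cell_event (A r) (real j) (real m))"
          using \<omega> by (auto simp: cell_event_def)
      qed (auto simp: cell_event_def)
      also have "\<dots> \<in> sets S" by (intro sets.countable_UN'' ev) auto
      finally show "{\<omega> \<in> space S. cell_num (A r) \<omega> \<le> c} \<in> sets S" .
    qed
    have top: "cell_max (A r) \<in> borel_measurable S"
    proof (subst borel_measurable_iff_le, intro allI)
      fix y
      have "{\<omega> \<in> space S. cell_max (A r) \<omega> \<le> y} = (\<Union>j::nat. cell_event (A r) (real j) y)"
        unfolding sp using cell_num_nat[OF _ A(1)[OF r]] by (auto simp: cell_event_def elim!: Nats_cases)
      also have "\<dots> \<in> sets S" by (intro sets.countable_UN'' ev) auto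
      finally show "{\<omega> \<in> space S. cell_max (A r) \<omega> \<le> y} \<in> sets S" .
    qed
    have "(\<lambda>\<omega>. (1 + 1 / cell_num (A r) \<omega>) * cell_max (A r) \<omega>) \<in> borel_measurable S"
      using num top by measurable
    from measurable_sets[OF this]
    show "{(\<lambda>\<omega>. (1 + 1 / cell_num (A r) \<omega>) * cell_max (A r) \<omega>) -` B \<inter> space P | B. B \<in> sets borel} \<subseteq> sigma_sets (space P) (?F r)"
      unfolding sp ss by auto
  qed
qed

text \<open>On the almost sure event that the cell has finitely many points, the events about count and maximum
  become events about the independent Poisson numbers of points in the upper and the lower part.\<close>

lemma cell_is_poisson_cell:
  assumes A: "A \<in> sets \<nu>" "0 < measure \<nu> A"
    and lo: "0 < lo" "AE x in \<nu>. x \<in> A \<longrightarrow> lo \<le> f x"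
    and hi: "lo \<le> hi" "AE x in \<nu>. x \<in> A \<longrightarrow> f x \<le> hi"
  shows "poisson_cell P (cell_num A) (cell_max A) (t * measure \<nu> A) (cell_mean \<nu> f A) lo hi
    (\<lambda>y. cell_floor \<nu> f A (max 0 y))"
proof -
  let ?v = "measure \<nu> A" and ?g = "cell_floor \<nu> f A" and ?f = "cell_mean \<nu> f A"
  have iA: "integrable \<nu> (indicator A :: 'e \<Rightarrow> real)" using A(1) by (intro integrable_real_indicator) (auto simp: less_top[symmetric])
  have g_eq: "?g y = (LINT x|\<nu>. indicator A x * min y (f x)) / ?v" for y
    by (simp add: cell_floor_def set_lebesgue_integral_def)
  have f_eq: "?f = (LINT x|\<nu>. indicator A x * f x) / ?v"
    by (simp add: cell_mean_def set_lebesgue_integral_def)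
  have const: "(LINT x|\<nu>. indicator A x * (y::real)) / ?v = y" for y
    using A by simp
  have mono: "(LINT x|\<nu>. indicator A x * h x) / ?v \<le> (LINT x|\<nu>. indicator A x * h' x) / ?v"
    if "integrable \<nu> (\<lambda>x. indicator A x * h x)" "integrable \<nu> (\<lambda>x. indicator A x * h' x)"
      "AE x in \<nu>. x \<in> A \<longrightarrow> h x \<le> h' x" for h h' :: "'e \<Rightarrow> real"
    using that A by (intro divide_right_mono integral_mono_AE) (auto split: split_indicator elim: AE_mp)
  have ic: "integrable \<nu> (\<lambda>x. indicator A x * (y::real))" for y using iA by simp
  note i = integrable_min_f[OF A(1)] integrable_f_on[OF A(1)] ic
  have lo_le: "lo \<le> ?f"
    using mono[OF ic[of lo] i(2)] lo unfolding const f_eq by simp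
  have le_hi: "?f \<le> hi"
    using mono[OF i(2) ic[of hi]] hi unfolding const f_eq by simp
  have g_nonneg: "0 \<le> ?g y" if "0 \<le> y" for y
    using mono[OF ic[of 0] i(1)[OF that]] that f_nonneg unfolding const g_eq by (simp add: AE_I2)
  have g_le1: "?g y \<le> y" if "0 \<le> y" for y
    using mono[OF i(1)[OF that] ic[of y]] unfolding const g_eq by simp
  have g_le2: "?g y \<le> ?f" if "0 \<le> y" for y
    using mono[OF i(1)[OF that] i(2)] unfolding g_eq f_eq by simp
  have g_mono: "?g y \<le> ?g y'" if "0 \<le> y" "y \<le> y'" for y y'
    using mono[OF i(1)[OF that(1)] i(1)[of y']] that unfolding g_eq by (simp add: min_le_iff_disj)
  have g_lo: "?g y = y" if "0 \<le> y" "y \<le> lo" for y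
  proof -
    have "AE x in \<nu>. x \<in> A \<longrightarrow> y \<le> min y (f x)" using lo(2) that by (auto elim!: AE_mp)
    from mono[OF ic[of y] i(1)[OF that(1)] this] have "y \<le> ?g y" unfolding const g_eq .
    then show ?thesis using g_le1[OF that(1)] by simp
  qed
  have g_hi: "?g y = ?f" if "hi \<le> y" for y
  proof -
    have y: "0 \<le> y" using lo hi that by simp
    have "AE x in \<nu>. x \<in> A \<longrightarrow> f x \<le> min y (f x)" using hi(2) that by (auto elim!: AE_mp)
    from mono[OF i(2) i(1)[OF y] this] have "?f \<le> ?g y" unfolding f_eq g_eq .
    then show ?thesis using g_le2[OF y] by simp
  qed
  have f_pos: "0 < ?f" using lo lo_le by simp
  let ?a = "t * ?v"
  have a: "0 < ?a" using t_pos A by simp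
  note D = hypograph_sets[OF A(1)]
  have D_int: "emeasure (intensity \<nu> f t) (hypograph f A) = ennreal (?a * ?f)"
  proof -
    have "emeasure (intensity \<nu> f t) (hypograph f A) =
      emeasure (intensity \<nu> f t) (upper_part f A 0) + emeasure (intensity \<nu> f t) (lower_part f A 0)"
      using hypograph_split[OF order_refl, of f A] upper_part_sets[OF A(1) order_refl] lower_part_sets[OF A(1)]
      by (simp add: plus_emeasure sets_intensity)
    also have "\<dots> = ennreal (?a * (?f - ?g 0)) + ennreal (?a * ?g 0)"
      using upper_part_intensity[OF A order_refl] lower_part_intensity[OF A order_refl] by simp
    also have "\<dots> = ennreal (?a * (?f - ?g 0) + ?a * ?g 0)"
      using a g_nonneg[of 0] g_le2[of 0] by (intro ennreal_plus[symmetric]) auto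
    finally show ?thesis by (simp add: algebra_simps)
  qed
  have af: "0 \<le> ?a * ?f" using a f_pos by simp
  note finite = AE_tally_finite[OF D D_int af]
  note nm = cell_num_measurable[OF A(1), measurable] and tm = cell_max_measurable[OF A(1), measurable]
    and dm = tally_measurable[OF D, measurable]
  have split: "tally (hypograph f A) \<omega> = tally (upper_part f A y) \<omega> + tally (lower_part f A y) \<omega>"
    if "\<omega> \<in> space P" "0 \<le> y" for \<omega> y
    using hypograph_split[OF that(2), of f A] upper_part_sets[OF A(1) that(2)] lower_part_sets[OF A(1)] sets_N[OF that(1)]
    by (simp add: plus_emeasure)
  have cell_num_iff: "cell_num A \<omega> = real j \<longleftrightarrow> tally (hypograph f A) \<omega> = of_nat j"
    if \<omega>: "\<omega> \<in> space P" "tally (hypograph f A) \<omega> \<noteq> \<infinity>" for \<omega> j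
    using tally_values[OF \<omega>(1) D] \<omega>(2) by (auto simp: cell_num_def measure_def)
  show ?thesis
  proof unfold_locales
    show "cell_num A \<in> borel_measurable P" "cell_max A \<in> borel_measurable P" by measurable
    show "\<omega> \<in> space P \<Longrightarrow> cell_num A \<omega> \<in> \<nat>" for \<omega> by (rule cell_num_nat[OF _ A(1)])
    show "\<omega> \<in> space P \<Longrightarrow> 0 \<le> cell_max A \<omega>" for \<omega> by (rule cell_max_nonneg[OF _ A(1)])
    show "cell_num A \<omega> = 0 \<Longrightarrow> cell_max A \<omega> = 0" for \<omega> by (rule cell_max_zero)
    show "(\<lambda>y. ?g (max 0 y)) \<in> borel_measurable borel"
      by (intro borel_measurable_mono monoI g_mono) auto
    show "min y ?f - (hi - lo) \<le> ?g (max 0 y)" if y: "0 \<le> y" for y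
    proof (cases "y \<le> lo")
      case True
      then show ?thesis using y g_lo[of y] hi by simp
    next
      case False
      then have "lo \<le> ?g y" using g_mono[of lo y] g_lo[of lo] lo by simp
      then show ?thesis using y le_hi by simp
    qed
    show "P.prob {\<omega> \<in> space P. cell_num A \<omega> = real j} = poisson_weight (?a * ?f) j" for j
    proof -
      have "P.prob {\<omega> \<in> space P. cell_num A \<omega> = real j} = P.prob {\<omega> \<in> space P. tally (hypograph f A) \<omega> = of_nat j}"
      proof (rule measure_eq_AE)
        show "AE \<omega> in P. \<omega> \<in> {\<omega> \<in> space P. cell_num A \<omega> = real j} \<longleftrightarrow> \<omega> \<in> {\<omega> \<in> space P. tally (hypograph f A) \<omega> = of_nat j}"
          using finite AE_space by eventually_elim (use cell_num_iff in auto)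
      qed measurable
      then show ?thesis using prob_tally[OF D D_int af] by simp
    qed
    fix y :: real assume y: "0 \<le> y"
    note U = upper_part_sets[OF A(1) y] and L = lower_part_sets[OF A(1), of y]
    note um = tally_measurable[OF U, measurable] and lm = tally_measurable[OF L, measurable]
    have iU: "0 \<le> ?a * (?f - ?g y)" and iL: "0 \<le> ?a * ?g y" using a g_nonneg[OF y] g_le2[OF y] by auto
    note pU = prob_tally[OF U upper_part_intensity[OF A y] iU, of 0] and pL = prob_tally[OF L lower_part_intensity[OF A y] iL]
    have max0: "max 0 y = y" using y by simp
    show "P.prob {\<omega> \<in> space P. cell_max A \<omega> \<le> y} = exp (- (?a * (?f - ?g (max 0 y))))"
    proof -
      have "P.prob {\<omega> \<in> space P. cell_max A \<omega> \<le> y} = P.prob {\<omega> \<in> space P. tally (upper_part f A y) \<omega> = of_nat 0}"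
      proof (rule measure_eq_AE)
        show "AE \<omega> in P. \<omega> \<in> {\<omega> \<in> space P. cell_max A \<omega> \<le> y} \<longleftrightarrow> \<omega> \<in> {\<omega> \<in> space P. tally (upper_part f A y) \<omega> = of_nat 0}"
          using finite AE_space
        proof eventually_elim
          case (elim \<omega>)
          show ?case
            using cell_max_le_iff[OF elim(2) A(1) y] cell_num_iff[OF elim(2,1), of 0] split[OF elim(2) y] elim(2) by auto
        qed
      qed measurable
      then show ?thesis using pU by (simp add: poisson_weight_def max0)
    qed
    show "P.prob {\<omega> \<in> space P. cell_num A \<omega> = real j \<and> cell_max A \<omega> \<le> y} =
      poisson_weight (?a * ?f) j * (?g (max 0 y) / ?f) ^ j" for j
    proof -
      define B where "B i = (if i = 0 then upper_part f A y else if i = 1 then lower_part f A y else {})" for i :: nat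
      have ind: "P.indep_vars (\<lambda>_. borel) (\<lambda>i \<omega>. tally (B i) \<omega>) UNIV"
        using U L hypograph_split(2)[OF y, of f A] by (intro indep_tallies) (auto simp: B_def disjoint_family_on_def)
      let ?U = "\<lambda>\<omega>. tally (upper_part f A y) \<omega>" and ?L = "\<lambda>\<omega>. tally (lower_part f A y) \<omega>"
      let ?E = "{\<omega> \<in> space P. ?U \<omega> = of_nat 0 \<and> ?L \<omega> = of_nat j}"
      have "P.prob {\<omega> \<in> space P. cell_num A \<omega> = real j \<and> cell_max A \<omega> \<le> y} = P.prob ?E"
      proof (rule measure_eq_AE)
        show "AE \<omega> in P. \<omega> \<in> {\<omega> \<in> space P. cell_num A \<omega> = real j \<and> cell_max A \<omega> \<le> y} \<longleftrightarrow> \<omega> \<in> ?E"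
          using finite AE_space
        proof eventually_elim
          case (elim \<omega>)
          have zero: "cell_num A \<omega> = 0 \<longleftrightarrow> ?U \<omega> = 0 \<and> ?L \<omega> = 0"
            using cell_num_iff[OF elim(2,1), of 0] split[OF elim(2) y] by simp
          have eq_j: "cell_num A \<omega> = real j \<longleftrightarrow> ?U \<omega> + ?L \<omega> = of_nat j"
            using cell_num_iff[OF elim(2,1), of j] split[OF elim(2) y] by simp
          show ?case
          proof (cases "?U \<omega> = 0")
            case True
            then show ?thesis using cell_max_le_iff[OF elim(2) A(1) y] eq_j elim(2) by simp
          next
            case False
            then show ?thesis using cell_max_le_iff[OF elim(2) A(1) y] zero by simp
          qed
        qed
      qed measurable
      also have "?E = (\<Inter>i\<in>{0, 1}. (\<lambda>\<omega>. tally (B i) \<omega>) -` {of_nat (if i = 0 then 0 else j)} \<inter> space P)"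
        by (auto simp: B_def)
      also have "P.prob \<dots> = (\<Prod>i\<in>{0, 1}. P.prob ((\<lambda>\<omega>. tally (B i) \<omega>) -` {of_nat (if i = 0 then 0 else j)} \<inter> space P))"
        by (rule P.indep_varsD[OF ind]) auto
      also have "\<dots> = P.prob {\<omega> \<in> space P. ?U \<omega> = of_nat 0} * P.prob {\<omega> \<in> space P. ?L \<omega> = of_nat j}"
      proof -
        have "(\<lambda>\<omega>. tally (B 0) \<omega>) -` {of_nat 0} \<inter> space P = {\<omega> \<in> space P. ?U \<omega> = of_nat 0}"
          "(\<lambda>\<omega>. tally (B 1) \<omega>) -` {of_nat j} \<inter> space P = {\<omega> \<in> space P. ?L \<omega> = of_nat j}"
          by (auto simp: B_def)
        then show ?thesis by simp
      qed
      also have "\<dots> = exp (- (?a * (?f - ?g y))) * poisson_weight (?a * ?g y) j"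
        unfolding pU pL by (simp add: poisson_weight_def)
      also have "\<dots> = poisson_weight (?a * ?f) j * (?g y / ?f) ^ j"
      proof -
        have e: "exp (- (?a * (?f - ?g y))) * exp (- (?a * ?g y)) = exp (- (?a * ?f))"
          unfolding exp_add[symmetric] by (simp add: right_diff_distrib)
        have p: "(?a * ?g y) ^ j = (?a * ?f) ^ j * (?g y / ?f) ^ j"
          using f_pos unfolding power_mult_distrib[symmetric] by (simp add: mult.assoc)
        have "exp (- (?a * (?f - ?g y))) * poisson_weight (?a * ?g y) j =
          (exp (- (?a * (?f - ?g y))) * exp (- (?a * ?g y))) * (?a * ?g y) ^ j / fact j"
          by (simp only: poisson_weight_def times_divide_eq_right mult.assoc)
        also have "\<dots> = poisson_weight (?a * ?f) j * (?g y / ?f) ^ j"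
          unfolding e p poisson_weight_def by (simp only: times_divide_eq_left mult.assoc)
        finally show ?thesis .
      qed
      finally show ?thesis by (simp only: max0)
    qed
  qed (use A a lo hi lo_le le_hi g_nonneg g_le1 g_le2 g_lo g_hi t_pos in \<open>auto simp: max_def\<close>)
qed

end


section \<open>Essential bounds\<close>

text \<open>The essential infimum is attained as a bound, because countably many rational levels suffice.\<close>

lemma null_below_ess_inf_on:
  assumes "A \<in> sets \<nu>" "f \<in> borel_measurable \<nu>"
  shows "emeasure \<nu> ({x\<in>space \<nu>. ennreal (f x) < ess_inf_on \<nu> f A \<and> 0 \<le> f x} \<inter> A) = 0"
proof -
  note [measurable] = assms
  have *: "{x\<in>space \<nu>. ennreal (f x) < ess_inf_on \<nu> f A \<and> 0 \<le> f x} \<inter> A \<subseteq>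
    (\<Union>q\<in>{q\<in>\<rat>. emeasure \<nu> ({x\<in>space \<nu>. f x < q} \<inter> A) = 0}. {x\<in>space \<nu>. f x < q} \<inter> A)"
  proof
    fix x assume "x \<in> {x\<in>space \<nu>. ennreal (f x) < ess_inf_on \<nu> f A \<and> 0 \<le> f x} \<inter> A"
    then have x: "x \<in> space \<nu>" "x \<in> A" "ennreal (f x) < ess_inf_on \<nu> f A" "0 \<le> f x" by auto
    from x(3) obtain \<alpha> where \<alpha>: "ennreal (f x) < ennreal \<alpha>" "\<alpha> > 0"
      "emeasure \<nu> ({x\<in>space \<nu>. f x < \<alpha>} \<inter> A) = 0"
      unfolding ess_inf_on_def less_Sup_iff by auto
    then have "f x < \<alpha>" using x(4) by (simp add: ennreal_less_iff)
    then obtain q where q: "q \<in> \<rat>" "f x < q" "q < \<alpha>" using Rats_dense_in_real by blast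
    have "emeasure \<nu> ({x\<in>space \<nu>. f x < q} \<inter> A) \<le> emeasure \<nu> ({x\<in>space \<nu>. f x < \<alpha>} \<inter> A)"
      using q by (intro emeasure_mono) auto
    then show "x \<in> (\<Union>q\<in>{q\<in>\<rat>. emeasure \<nu> ({x\<in>space \<nu>. f x < q} \<inter> A) = 0}. {x\<in>space \<nu>. f x < q} \<inter> A)"
      using q x \<alpha>(3) by auto
  qed
  have "(\<Union>q\<in>{q\<in>\<rat>. emeasure \<nu> ({x\<in>space \<nu>. f x < q} \<inter> A) = 0}. {x\<in>space \<nu>. f x < q} \<inter> A) \<in> null_sets \<nu>"
    by (rule null_sets_UN') (auto intro: countable_subset[OF _ countable_rat])
  from null_sets_subset[OF this _ *] show ?thesis by auto
qed

lemma AE_ess_inf_on_le: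
  assumes "A \<in> sets \<nu>" "f \<in> borel_measurable \<nu>" "\<And>x. x \<in> space \<nu> \<Longrightarrow> 0 \<le> f x"
    and "ess_inf_on \<nu> f A < \<infinity>"
  shows "AE x in \<nu>. x \<in> A \<longrightarrow> enn2real (ess_inf_on \<nu> f A) \<le> f x"
proof (rule AE_I)
  note [measurable] = assms(1,2)
  show "{x\<in>space \<nu>. \<not> (x \<in> A \<longrightarrow> enn2real (ess_inf_on \<nu> f A) \<le> f x)} \<subseteq>
     {x\<in>space \<nu>. ennreal (f x) < ess_inf_on \<nu> f A \<and> 0 \<le> f x} \<inter> A"
  proof safe
    fix x assume x: "x \<in> space \<nu>" "\<not> enn2real (ess_inf_on \<nu> f A) \<le> f x"
    then have "ennreal (f x) < ennreal (enn2real (ess_inf_on \<nu> f A))"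
      using assms(3)[of x] by (simp add: ennreal_less_iff)
    then show "ennreal (f x) < ess_inf_on \<nu> f A" using assms(4) by (simp add: less_top)
    show "0 \<le> f x" using x assms(3) by simp
  qed
  show "emeasure \<nu> ({x\<in>space \<nu>. ennreal (f x) < ess_inf_on \<nu> f A \<and> 0 \<le> f x} \<inter> A) = 0"
    using assms(1,2) by (rule null_below_ess_inf_on)
  show "{x\<in>space \<nu>. ennreal (f x) < ess_inf_on \<nu> f A \<and> 0 \<le> f x} \<inter> A \<in> sets \<nu>" by measurable
qed

lemma AE_le_ess_sup_on:
  assumes "A \<in> sets \<nu>" "f \<in> borel_measurable \<nu>"
    and fin: "ess_sup_on \<nu> f A < \<infinity>"
  shows "AE x in \<nu>. x \<in> A \<longrightarrow> f x \<le> enn2real (ess_sup_on \<nu> f A)"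
proof (rule AE_I')
  note [measurable] = assms(1,2)
  let ?U = "\<Union>q\<in>{q\<in>\<rat>. emeasure \<nu> ({x\<in>space \<nu>. f x > q} \<inter> A) = 0}. {x\<in>space \<nu>. f x > q} \<inter> A"
  show "?U \<in> null_sets \<nu>"
    by (rule null_sets_UN') (auto intro: countable_subset[OF _ countable_rat])
  show "{x\<in>space \<nu>. \<not> (x \<in> A \<longrightarrow> f x \<le> enn2real (ess_sup_on \<nu> f A))} \<subseteq> ?U"
  proof
    fix x assume "x \<in> {x\<in>space \<nu>. \<not> (x \<in> A \<longrightarrow> f x \<le> enn2real (ess_sup_on \<nu> f A))}"
    then have x: "x \<in> space \<nu>" "x \<in> A" "\<not> f x \<le> enn2real (ess_sup_on \<nu> f A)" by auto
    have "ess_sup_on \<nu> f A = ennreal (enn2real (ess_sup_on \<nu> f A))" using fin by (simp add: less_top)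
    also have "\<dots> < ennreal (f x)"
      using x(3) enn2real_nonneg[of "ess_sup_on \<nu> f A"] by (simp add: ennreal_less_iff)
    finally have "ess_sup_on \<nu> f A < ennreal (f x)" .
    then obtain \<alpha> where \<alpha>: "ennreal \<alpha> < ennreal (f x)" "\<alpha> > 0"
      "emeasure \<nu> ({x\<in>space \<nu>. f x > \<alpha>} \<inter> A) = 0"
      unfolding ess_sup_on_def Inf_less_iff by auto
    then have "\<alpha> < f x" by (simp add: ennreal_less_iff)
    then obtain q where q: "q \<in> \<rat>" "\<alpha> < q" "q < f x" using Rats_dense_in_real by blast
    have "emeasure \<nu> ({x\<in>space \<nu>. f x > q} \<inter> A) \<le> emeasure \<nu> ({x\<in>space \<nu>. f x > \<alpha>} \<inter> A)"
      using q by (intro emeasure_mono) auto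
    then show "x \<in> ?U" using q x \<alpha>(3) by auto
  qed
qed

lemma ess_inf_on_antimono:
  assumes "A \<subseteq> B" "A \<in> sets \<nu>" "B \<in> sets \<nu>" "f \<in> borel_measurable \<nu>"
  shows "ess_inf_on \<nu> f B \<le> ess_inf_on \<nu> f A"
  unfolding ess_inf_on_def
proof (rule Sup_subset_mono, safe)
  note [measurable] = assms(2-4)
  fix \<alpha> :: real assume \<alpha>: "0 < \<alpha>" "emeasure \<nu> ({x\<in>space \<nu>. f x < \<alpha>} \<inter> B) = 0"
  have "emeasure \<nu> ({x\<in>space \<nu>. f x < \<alpha>} \<inter> A) \<le> emeasure \<nu> ({x\<in>space \<nu>. f x < \<alpha>} \<inter> B)"
    using assms(1) by (intro emeasure_mono) auto
  then show "\<exists>\<alpha>'. ennreal \<alpha> = ennreal \<alpha>' \<and> \<alpha>' > 0 \<and> emeasure \<nu> ({x\<in>space \<nu>. f x < \<alpha>'} \<inter> A) = 0"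
    using \<alpha> by (intro exI[of _ \<alpha>]) auto
qed

lemma ess_sup_on_mono:
  assumes "A \<subseteq> B" "A \<in> sets \<nu>" "B \<in> sets \<nu>" "f \<in> borel_measurable \<nu>"
  shows "ess_sup_on \<nu> f A \<le> ess_sup_on \<nu> f B"
  unfolding ess_sup_on_def
proof (rule Inf_superset_mono, safe)
  note [measurable] = assms(2-4)
  fix \<alpha> :: real assume \<alpha>: "0 < \<alpha>" "emeasure \<nu> ({x\<in>space \<nu>. f x > \<alpha>} \<inter> B) = 0"
  have "emeasure \<nu> ({x\<in>space \<nu>. f x > \<alpha>} \<inter> A) \<le> emeasure \<nu> ({x\<in>space \<nu>. f x > \<alpha>} \<inter> B)"
    using assms(1) by (intro emeasure_mono) auto
  then show "\<exists>\<alpha>'. ennreal \<alpha> = ennreal \<alpha>' \<and> \<alpha>' > 0 \<and> emeasure \<nu> ({x\<in>space \<nu>. f x > \<alpha>'} \<inter> A) = 0"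
    using \<alpha> by (intro exI[of _ \<alpha>]) auto
qed

lemma ess_inf_on_le_ess_sup_on:
  assumes "A \<in> sets \<nu>" "f \<in> borel_measurable \<nu>" "emeasure \<nu> A \<noteq> 0"
  shows "ess_inf_on \<nu> f A \<le> ess_sup_on \<nu> f A"
  unfolding ess_inf_on_def ess_sup_on_def
proof (intro Sup_least Inf_greatest, safe)
  note [measurable] = assms(1,2)
  fix \<alpha> \<beta> :: real
  assume \<alpha>: "0 < \<alpha>" "emeasure \<nu> ({x\<in>space \<nu>. f x < \<alpha>} \<inter> A) = 0"
    and \<beta>: "0 < \<beta>" "emeasure \<nu> ({x\<in>space \<nu>. f x > \<beta>} \<inter> A) = 0"
  show "ennreal \<alpha> \<le> ennreal \<beta>"
  proof (rule ccontr)
    assume "\<not> ennreal \<alpha> \<le> ennreal \<beta>"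
    then have lt: "\<beta> < \<alpha>" using \<beta> by (simp add: ennreal_le_iff not_le ennreal_less_iff)
    have "emeasure \<nu> A \<le> emeasure \<nu> (({x\<in>space \<nu>. f x < \<alpha>} \<inter> A) \<union> ({x\<in>space \<nu>. f x > \<beta>} \<inter> A))"
      using lt sets.sets_into_space[OF assms(1)] by (intro emeasure_mono) auto
    also have "\<dots> \<le> emeasure \<nu> ({x\<in>space \<nu>. f x < \<alpha>} \<inter> A) + emeasure \<nu> ({x\<in>space \<nu>. f x > \<beta>} \<inter> A)"
      by (intro emeasure_subadditive) measurable
    finally show False using \<alpha> \<beta> assms(3) by simp
  qed
qed


section \<open>Errors of the cells and of the estimator\<close>

lemma mult_exp_minus_antimono:
  fixes x y :: real
  assumes "1 \<le> x" "x \<le> y"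
  shows "y * exp (- y) \<le> x * exp (- x)"
proof -
  have "y \<le> x * (1 + (y - x))"
    using assms mult_left_mono[of 1 x "y - x"] by (simp add: algebra_simps)
  also have "\<dots> \<le> x * exp (y - x)"
    using assms exp_ge_add_one_self[of "y - x"] by (intro mult_left_mono) auto
  finally have "y * exp (- y) \<le> x * exp (y - x) * exp (- y)"
    by (intro mult_right_mono) auto
  also have "\<dots> = x * exp (- x)" by (simp add: mult.assoc exp_add[symmetric])
  finally show ?thesis .
qed

lemma cell_essential_bounds:
  assumes \<nu>: "prob_space \<nu>" and f: "f \<in> borel_measurable \<nu>" "\<And>x. x \<in> space \<nu> \<Longrightarrow> 0 \<le> f x"
    and inf: "0 < ess_inf_on \<nu> f (space \<nu>)" and sup: "ess_sup_on \<nu> f (space \<nu>) < \<infinity>"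
    and A: "A \<in> sets \<nu>" "0 < measure \<nu> A"
  defines "lo \<equiv> enn2real (ess_inf_on \<nu> f A)" and "hi \<equiv> enn2real (ess_sup_on \<nu> f A)"
  shows "0 < enn2real (ess_inf_on \<nu> f (space \<nu>))" "enn2real (ess_inf_on \<nu> f (space \<nu>)) \<le> lo" "lo \<le> hi"
    "AE x in \<nu>. x \<in> A \<longrightarrow> lo \<le> f x" "AE x in \<nu>. x \<in> A \<longrightarrow> f x \<le> hi"
proof -
  interpret prob_space \<nu> by fact
  have sub: "A \<subseteq> space \<nu>" using A(1) by (rule sets.sets_into_space)
  have nz: "emeasure \<nu> A \<noteq> 0" using A(2) by (simp add: emeasure_eq_measure)
  have le1: "ess_inf_on \<nu> f (space \<nu>) \<le> ess_inf_on \<nu> f A"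
    by (rule ess_inf_on_antimono[OF sub A(1) _ f(1)]) simp
  have le2: "ess_inf_on \<nu> f A \<le> ess_sup_on \<nu> f A"
    by (rule ess_inf_on_le_ess_sup_on[OF A(1) f(1) nz])
  have le3: "ess_sup_on \<nu> f A \<le> ess_sup_on \<nu> f (space \<nu>)"
    by (rule ess_sup_on_mono[OF sub A(1) _ f(1)]) simp
  have sA: "ess_sup_on \<nu> f A < \<infinity>" using le3 sup by (rule order_le_less_trans)
  have iA: "ess_inf_on \<nu> f A < \<infinity>" using le2 sA by (rule order_le_less_trans)
  have iS: "ess_inf_on \<nu> f (space \<nu>) < \<infinity>" using le1 iA by (rule order_le_less_trans)
  show "0 < enn2real (ess_inf_on \<nu> f (space \<nu>))"
    using inf iS by (simp add: enn2real_positive_iff)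
  show "enn2real (ess_inf_on \<nu> f (space \<nu>)) \<le> lo"
    unfolding lo_def using le1 iA by (intro enn2real_mono) auto
  show "lo \<le> hi" unfolding lo_def hi_def using le2 sA by (intro enn2real_mono) auto
  show "AE x in \<nu>. x \<in> A \<longrightarrow> lo \<le> f x"
    unfolding lo_def using A(1) f iA by (rule AE_ess_inf_on_le)
  show "AE x in \<nu>. x \<in> A \<longrightarrow> f x \<le> hi"
    unfolding hi_def using A(1) f(1) sA by (rule AE_le_ess_sup_on)
qed

context hypograph_process begin

definition "cell_error A \<omega> = t * measure \<nu> A * ((1 + 1 / cell_num A \<omega>) * cell_max A \<omega> - cell_mean \<nu> f A)"

lemma cell_error_measurable:
  assumes A: "A \<in> sets \<nu>"
  shows "cell_error A \<in> borel_measurable P"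
  unfolding cell_error_def[abs_def]
  by (intro borel_measurable_times borel_measurable_diff borel_measurable_add borel_measurable_divide
      borel_measurable_const cell_num_measurable[OF A] cell_max_measurable[OF A])

lemma indep_centred_cell_errors:
  assumes A: "\<And>r. r \<in> R \<Longrightarrow> A r \<in> sets \<nu>" "disjoint_family_on A R"
  shows "P.indep_vars (\<lambda>_. borel) (\<lambda>r \<omega>. cell_error (A r) \<omega> - P.expectation (cell_error (A r))) (R :: nat set)"
  unfolding cell_error_def
  by (rule P.indep_vars_compose2[OF indep_cell_estimates[OF A],
        where Y="\<lambda>r x. t * measure \<nu> (A r) * (x - cell_mean \<nu> f (A r)) - b r" for b]) simp_all

text \<open>The bounds for a single cell, made uniform over all cells: the mean \<open>lam\<close> of each count is at least \<open>L\<close>, and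
  \<open>x exp (- x)\<close> decreases for \<open>x \<ge> 1\<close>.\<close>

lemma cell_error_bounds:
  assumes r: "r \<in> {1..K}"
    and A: "\<And>r. r \<in> {1..K} \<Longrightarrow> A r \<in> sets \<nu>" "\<And>r. r \<in> {1..K} \<Longrightarrow> 0 < measure \<nu> (A r)"
    and inf: "0 < ess_inf_on \<nu> f (space \<nu>)" and sup: "ess_sup_on \<nu> f (space \<nu>) < \<infinity>"
    and \<epsilon>: "\<epsilon> = t * delta_max \<nu> f K A" "\<epsilon> \<le> 1"
    and L: "L = enn2real (ess_inf_on \<nu> f (space \<nu>)) * t * nu_min \<nu> K A" "1 \<le> L"
    and \<beta>: "\<beta> = L * exp (- L) + 2 * \<epsilon>\<^sup>2"
  shows "\<bar>P.expectation (cell_error (A r))\<bar> \<le> \<beta>"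
    and "0 < \<eta> \<Longrightarrow> \<eta> \<le> 1 \<Longrightarrow> 5 * \<epsilon> + 18 / L \<le> \<eta> \<Longrightarrow> 2 * (700 / L + 12 * \<epsilon>\<^sup>2) + 2 * \<beta>\<^sup>2 \<le> \<eta>\<^sup>2 \<Longrightarrow>
      cmod (char (distr P borel (\<lambda>\<omega>. cell_error (A r) \<omega> - P.expectation (cell_error (A r)))) s - exp (- s\<^sup>2 / 2))
        \<le> s\<^sup>2 * (7 * \<eta> + 2 * 38 * \<bar>s\<bar> + s\<^sup>2)"
proof -
  let ?lo = "enn2real (ess_inf_on \<nu> f (A r))" and ?hi = "enn2real (ess_sup_on \<nu> f (A r))"
  let ?m = "enn2real (ess_inf_on \<nu> f (space \<nu>))"
  note b = cell_essential_bounds[OF \<nu>.prob_space_axioms f_meas f_nonneg inf sup A(1)[OF r] A(2)[OF r]]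
  interpret C: poisson_cell P "cell_num (A r)" "cell_max (A r)" "t * measure \<nu> (A r)" "cell_mean \<nu> f (A r)" ?lo ?hi
    "\<lambda>y. cell_floor \<nu> f (A r) (max 0 y)"
    using A[OF r] b by (intro cell_is_poisson_cell) auto
  have z: "C.zeta = cell_error (A r)" by (simp add: fun_eq_iff C.zeta_def cell_error_def)
  have osc: "t * measure \<nu> (A r) * (?hi - ?lo) \<le> \<epsilon>"
  proof -
    have "measure \<nu> (A r) * ess_osc \<nu> f (A r) \<le> delta_max \<nu> f K A"
      unfolding delta_max_def using r by (intro Max_ge) auto
    then have "t * (measure \<nu> (A r) * ess_osc \<nu> f (A r)) \<le> \<epsilon>"
      unfolding \<epsilon>(1) using t_pos by (intro mult_left_mono) auto
    then show ?thesis by (simp add: ess_osc_def mult.assoc)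
  qed
  have osc0: "0 \<le> t * measure \<nu> (A r) * (?hi - ?lo)" using t_pos b(3) by simp
  have \<epsilon>0: "0 \<le> \<epsilon>" using osc osc0 by linarith
  have L_le: "L \<le> C.lam"
  proof -
    have "nu_min \<nu> K A \<le> measure \<nu> (A r)"
      unfolding nu_min_def using r by (intro Min_le) auto
    moreover have "?m \<le> cell_mean \<nu> f (A r)" using b(2) C.lo_le by linarith
    ultimately have "(?m * t) * nu_min \<nu> K A \<le> (cell_mean \<nu> f (A r) * t) * measure \<nu> (A r)"
    proof (intro mult_mono)
      show "0 \<le> nu_min \<nu> K A" unfolding nu_min_def using r by (subst Min_ge_iff) auto
    qed (use t_pos b(1) C.f_pos in auto)
    then show ?thesis unfolding L(1) C.lam_def by (simp add: mult_ac)
  qed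
  have lam1: "1 \<le> C.lam" using L_le L(2) by linarith
  have "\<bar>P.expectation C.zeta\<bar> \<le> C.lam * exp (- C.lam) + 2 * (t * measure \<nu> (A r) * (?hi - ?lo))\<^sup>2"
    by (rule C.bias_bound[OF lam1])
  also have "\<dots> \<le> L * exp (- L) + 2 * \<epsilon>\<^sup>2"
    using mult_exp_minus_antimono[OF L(2) L_le] power_mono[OF osc osc0, of 2] by linarith
  finally show bias: "\<bar>P.expectation (cell_error (A r))\<bar> \<le> \<beta>" unfolding z \<beta> .
  have inv: "18 / C.lam \<le> 18 / L" "700 / C.lam \<le> 700 / L"
    using L_le L(2) by (auto intro!: divide_left_mono mult_pos_pos)
  assume \<eta>: "0 < \<eta>" "\<eta> \<le> 1" "5 * \<epsilon> + 18 / L \<le> \<eta>" "2 * (700 / L + 12 * \<epsilon>\<^sup>2) + 2 * \<beta>\<^sup>2 \<le> \<eta>\<^sup>2"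
  have "cmod (char (distr P borel (\<lambda>\<omega>. C.zeta \<omega> - P.expectation C.zeta)) s - exp (- s\<^sup>2 / 2))
        \<le> s\<^sup>2 * (7 * \<eta> + 2 * 38 * \<bar>s\<bar> + s\<^sup>2)"
    using inv \<eta> by (intro C.char_zeta_bound[OF \<epsilon>0 \<epsilon>(2) lam1 osc, of \<beta>]) (auto simp: z bias)
  then show "cmod (char (distr P borel (\<lambda>\<omega>. cell_error (A r) \<omega> - P.expectation (cell_error (A r)))) s - exp (- s\<^sup>2 / 2))
        \<le> s\<^sup>2 * (7 * \<eta> + 2 * 38 * \<bar>s\<bar> + s\<^sup>2)" unfolding z .
qed

lemma estimator_eq_sum_cell_errors:
  assumes "0 < kappa_norm K \<kappa> x"
  shows "t / kappa_norm K \<kappa> x * (estimator \<nu> f K A \<kappa> (N \<omega>) (X \<omega>) (Y \<omega>) x - f x) =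
    (\<Sum>r=1..K. weight K \<kappa> r x * cell_error (A r) \<omega>) +
    t / kappa_norm K \<kappa> x * ((\<Sum>r=1..K. measure \<nu> (A r) * \<kappa> r x * cell_mean \<nu> f (A r)) - f x)"
proof -
  have "(\<Sum>r=1..K. weight K \<kappa> r x * cell_error (A r) \<omega>) =
    t / kappa_norm K \<kappa> x * ((\<Sum>r=1..K. measure \<nu> (A r) * \<kappa> r x * ((1 + 1 / cell_num (A r) \<omega>) * cell_max (A r) \<omega>))
      - (\<Sum>r=1..K. measure \<nu> (A r) * \<kappa> r x * cell_mean \<nu> f (A r)))"
    unfolding sum_subtractf[symmetric] sum_distrib_left
    by (intro sum.cong refl) (simp add: weight_def cell_error_def right_diff_distrib mult_ac)
  then show ?thesis
    unfolding estimator_def cell_num_def cell_max_def by (simp add: right_diff_distrib)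
qed

end

theorem theorem1:
  fixes \<nu> :: "'e measure" and f :: "'e \<Rightarrow> real" and c :: real
    and P :: "nat \<Rightarrow> 'w measure"
    and N :: "nat \<Rightarrow> 'w \<Rightarrow> ('e \<times> real) measure"
    and X :: "nat \<Rightarrow> nat \<Rightarrow> 'w \<Rightarrow> 'e" and Y :: "nat \<Rightarrow> nat \<Rightarrow> 'w \<Rightarrow> real"
    and k :: "nat \<Rightarrow> nat" and I :: "nat \<Rightarrow> nat \<Rightarrow> 'e set"
    and \<kappa> :: "nat \<Rightarrow> nat \<Rightarrow> 'e \<Rightarrow> real"
    and F :: "'e set" and \<sigma> :: "'e \<Rightarrow> 'e \<Rightarrow> real"
  assumes nu: "prob_space \<nu>"
    and f: "f \<in> borel_measurable \<nu>" "\<forall>x\<in>space \<nu>. 0 \<le> f x"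
    and c: "c > 0"
    and P: "\<forall>n\<ge>1. prob_space (P n)"
    and N: "\<forall>n\<ge>1. poisson_point_process (P n) (intensity \<nu> f (real n * c)) (N n)"
    and XY: "\<forall>n\<ge>1. \<forall>\<omega>\<in>space (P n).
        enumerates_points (N n \<omega>) (hypograph f (space \<nu>)) (\<lambda>i. X n i \<omega>) (\<lambda>i. Y n i \<omega>)"
    and k: "\<forall>n\<ge>1. k n \<ge> 1"
    and I: "\<forall>n\<ge>1. \<forall>r\<in>{1..k n}. I n r \<in> sets \<nu>"
      "\<forall>n\<ge>1. disjoint_family_on (I n) {1..k n}"
      "\<forall>n\<ge>1. (\<Union>r\<in>{1..k n}. I n r) = space \<nu>"
      "\<forall>n\<ge>1. \<forall>r\<in>{1..k n}. measure \<nu> (I n r) > 0"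
    and F: "F \<subseteq> space \<nu>"
    and kappa_pos: "\<forall>n\<ge>1. \<forall>x\<in>F. kappa_norm (k n) (\<kappa> n) x > 0"
    and H1: "mono_on {1..} k" "filterlim k at_top sequentially"
      "filterlim (\<lambda>n. real n * nu_min \<nu> (k n) (I n)) at_top sequentially"
    and H2: "0 < ess_inf_on \<nu> f (space \<nu>)"
      "ess_inf_on \<nu> f (space \<nu>) \<le> ess_sup_on \<nu> f (space \<nu>)"
      "ess_sup_on \<nu> f (space \<nu>) < \<infinity>"
      "(\<lambda>n. delta_max \<nu> f (k n) (I n)) \<in> o(\<lambda>n. 1 / real n)"
    and H3: "\<forall>x :: 'p::finite \<Rightarrow> 'e. range x \<subseteq> F \<longrightarrow>
        covariance_matrix (\<chi> i j. \<sigma> (x i) (x j)) \<and>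
        (\<forall>i j. (\<lambda>n. \<Sum>r=1..k n. weight (k n) (\<kappa> n) r (x i) * weight (k n) (\<kappa> n) r (x j))
                 \<longlonglongrightarrow> \<sigma> (x i) (x j))"
    and H4: "\<forall>x\<in>F. (\<lambda>n. Max ((\<lambda>r. \<bar>weight (k n) (\<kappa> n) r x\<bar>) ` {1..k n})) \<longlonglongrightarrow> 0"
    and H5: "\<forall>x\<in>F.
        (\<lambda>n. \<bar>(\<Sum>r=1..k n. measure \<nu> (I n r) * \<kappa> n r x * cell_mean \<nu> f (I n r)) - f x\<bar>)
          \<in> o(\<lambda>n. kappa_norm (k n) (\<kappa> n) x / real n)"
    and H6: "\<forall>x\<in>F.
        (\<lambda>n. (\<Sum>r=1..k n. \<bar>weight (k n) (\<kappa> n) r x\<bar>) *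
           Max {(real n * delta_max \<nu> f (k n) (I n))\<^sup>2,
                real n * nu_min \<nu> (k n) (I n) *
                  exp (- (enn2real (ess_inf_on \<nu> f (space \<nu>)) * c * real n
                          * nu_min \<nu> (k n) (I n))),
                Delta_max \<nu> f (k n) (I n)}) \<longlonglongrightarrow> 0"
  shows "\<forall>x :: 'p \<Rightarrow> 'e. range x \<subseteq> F \<longrightarrow>
    (\<exists>G. centered_gaussian (\<chi> i j. \<sigma> (x i) (x j)) G \<and>
      converges_in_distribution P
        (\<lambda>n \<omega>. \<chi> j. real n * c / kappa_norm (k n) (\<kappa> n) (x j) *
           (estimator \<nu> f (k n) (I n) (\<kappa> n) (N n \<omega>) (\<lambda>i. X n i \<omega>) (\<lambda>i. Y n i \<omega>) (x j)
              - f (x j)))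
        G)"
proof (intro allI impI)
  fix x :: "'p \<Rightarrow> 'e" assume x: "range x \<subseteq> F"
  then have xF: "x j \<in> F" for j by auto
  define A :: "real^'p^'p" where "A = (\<chi> i j. \<sigma> (x i) (x j))"
  define w where "w n r j = weight (k n) (\<kappa> n) r (x j)" for n r j
  define m where "m = enn2real (ess_inf_on \<nu> f (space \<nu>))"
  define \<epsilon> where "\<epsilon> n = real n * c * delta_max \<nu> f (k n) (I n)" for n
  define L where "L n = m * (real n * c) * nu_min \<nu> (k n) (I n)" for n
  define \<beta> where "\<beta> n = L n * exp (- L n) + 2 * (\<epsilon> n)\<^sup>2" for n
  \<comment> \<open>Large enough for both closeness conditions of \<open>cell_error_bounds\<close>; \<open>40\<^sup>2\<close> exceeds the constants there.\<close>
  define \<eta> where "\<eta> n = 40 * sqrt (1 / L n + (\<epsilon> n)\<^sup>2 + (\<beta> n)\<^sup>2) + (5 * \<bar>\<epsilon> n\<bar> + 18 / L n)" for n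
  interpret \<nu>: prob_space \<nu> by fact
  have fn: "\<And>x. x \<in> space \<nu> \<Longrightarrow> 0 \<le> f x" using f(2) by auto
  have nu_space: "0 < measure \<nu> (space \<nu>)" by (simp add: \<nu>.prob_space)
  note global = cell_essential_bounds[OF nu f(1) fn H2(1,3) sets.top nu_space]
  have m: "0 < m" using global(1) by (simp add: m_def)
  have f_int: "integrable \<nu> f"
  proof (rule \<nu>.integrable_const_bound[where B="enn2real (ess_sup_on \<nu> f (space \<nu>))"])
    show "AE y in \<nu>. norm (f y) \<le> enn2real (ess_sup_on \<nu> f (space \<nu>))"
      using global(5) by (rule AE_mp) (auto intro!: AE_I2 simp: fn)
  qed fact
  have H: "hypograph_process (P n) \<nu> f (real n * c) (N n) (\<lambda>\<omega> i. X n i \<omega>) (\<lambda>\<omega> i. Y n i \<omega>)" if n: "n \<ge> 1" for n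
    using P N XY f f_int c n nu
    by (auto simp: hypograph_process_def hypograph_process_axioms_def)
  define err where "err n r = hypograph_process.cell_error \<nu> f (real n * c) (N n) (\<lambda>\<omega> i. X n i \<omega>) (\<lambda>\<omega> i. Y n i \<omega>) (I n r)" for n r
  define mean where "mean n r = (LINT \<omega>|P n. err n r \<omega>)" for n r
  define bias where "bias n j = real n * c / kappa_norm (k n) (\<kappa> n) (x j) *
     ((\<Sum>r=1..k n. measure \<nu> (I n r) * \<kappa> n r (x j) * cell_mean \<nu> f (I n r)) - f (x j))" for n j
  define Z :: "nat \<Rightarrow> 'w \<Rightarrow> real^'p" where "Z n \<omega> = (\<chi> j. real n * c / kappa_norm (k n) (\<kappa> n) (x j) *
           (estimator \<nu> f (k n) (I n) (\<kappa> n) (N n \<omega>) (\<lambda>i. X n i \<omega>) (\<lambda>i. Y n i \<omega>) (x j) - f (x j)))" for n \<omega>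
  have Z_eq: "Z n \<omega> $ j = (\<Sum>r=1..k n. w n r j * err n r \<omega>) + bias n j" if "n \<ge> 1" for n \<omega> j
    using hypograph_process.estimator_eq_sum_cell_errors[OF H[OF that], of "k n" "\<kappa> n" "x j" "I n" \<omega>] kappa_pos xF that
    by (simp add: Z_def w_def err_def bias_def)
  have err_meas: "err n r \<in> borel_measurable (P n)" if "n \<ge> 1" "r \<in> {1..k n}" for n r
    unfolding err_def using I(1) that by (intro hypograph_process.cell_error_measurable[OF H]) auto
  have Z_meas: "Z n \<in> borel_measurable (P n)" if n: "n \<ge> 1" for n
  proof (subst borel_measurable_euclidean_space, intro ballI)
    fix b :: "real^'p" assume "b \<in> Basis"
    then obtain j where b: "b = axis j 1" unfolding Basis_vec_def by auto
    have "(\<lambda>\<omega>. Z n \<omega> \<bullet> b) = (\<lambda>\<omega>. (\<Sum>r=1..k n. w n r j * err n r \<omega>) + bias n j)"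
      unfolding b using Z_eq[OF n] by (simp add: inner_axis)
    also have "\<dots> \<in> borel_measurable (P n)"
      using err_meas[OF n] by (intro borel_measurable_add borel_measurable_sum borel_measurable_times) auto
    finally show "(\<lambda>\<omega>. Z n \<omega> \<bullet> b) \<in> borel_measurable (P n)" .
  qed

  have cov: "(\<lambda>n. \<Sum>r=1..k n. w n r i * w n r j) \<longlonglongrightarrow> A $ i $ j" for i j
    using H3 x unfolding w_def A_def by simp
  have quad: "(\<lambda>n. \<Sum>r=1..k n. (\<Sum>j\<in>UNIV. a $ j * w n r j)\<^sup>2) \<longlonglongrightarrow> a \<bullet> (A *v a)" for a :: "real^'p"
  proof -
    have "(\<Sum>r=1..k n. (\<Sum>j\<in>UNIV. a $ j * w n r j)\<^sup>2) =
      (\<Sum>i\<in>UNIV. \<Sum>j\<in>UNIV. a $ i * (a $ j * (\<Sum>r=1..k n. w n r i * w n r j)))" for n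
    proof -
      have "(\<Sum>r=1..k n. (\<Sum>j\<in>UNIV. a $ j * w n r j)\<^sup>2) =
        (\<Sum>r=1..k n. \<Sum>i\<in>UNIV. \<Sum>j\<in>UNIV. a $ i * (a $ j * (w n r i * w n r j)))"
        unfolding power2_eq_square sum_product by (intro sum.cong refl) (simp add: mult_ac)
      also have "\<dots> = (\<Sum>i\<in>UNIV. \<Sum>j\<in>UNIV. \<Sum>r=1..k n. a $ i * (a $ j * (w n r i * w n r j)))"
        by (subst sum.swap) (intro sum.cong refl sum.swap)
      finally show ?thesis by (simp add: sum_distrib_left)
    qed
    moreover have "(\<lambda>n. \<Sum>i\<in>UNIV. \<Sum>j\<in>UNIV. a $ i * (a $ j * (\<Sum>r=1..k n. w n r i * w n r j))) \<longlonglongrightarrow>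
      (\<Sum>i\<in>UNIV. \<Sum>j\<in>UNIV. a $ i * (a $ j * A $ i $ j))"
      by (intro tendsto_sum tendsto_mult_left cov)
    moreover have "(\<Sum>i\<in>UNIV. \<Sum>j\<in>UNIV. a $ i * (a $ j * A $ i $ j)) = a \<bullet> (A *v a)"
      by (simp add: inner_vec_def matrix_vector_mult_def sum_distrib_left mult_ac)
    ultimately show ?thesis by simp
  qed
  have sym: "A $ i $ j = A $ j $ i" for i j
    using LIMSEQ_unique[OF cov[of i j]] cov[of j i] by (simp add: mult.commute)
  have psd: "0 \<le> a \<bullet> (A *v a)" for a
    using quad[of a] by (rule LIMSEQ_le_const) (auto intro!: sum_nonneg)
  obtain G where G: "prob_space G" "sets G = sets borel"
    "\<And>t. (LINT v|G. iexp (t \<bullet> v)) = complex_of_real (exp (- (t \<bullet> (A *v t)) / 2))"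
    using exists_measure_with_gaussian_char[OF sym psd] by blast
  have gauss: "centered_gaussian A G" by (rule centered_gaussian_if_char[OF G(1,2) sym psd G(3)])

  define mx where "mx n = Max {(real n * delta_max \<nu> f (k n) (I n))\<^sup>2,
                real n * nu_min \<nu> (k n) (I n) * exp (- (m * c * real n * nu_min \<nu> (k n) (I n))),
                Delta_max \<nu> f (k n) (I n)}" for n
  have \<epsilon>_lim: "\<epsilon> \<longlonglongrightarrow> 0"
  proof -
    have "(\<lambda>n. delta_max \<nu> f (k n) (I n) / (1 / real n)) \<longlonglongrightarrow> 0" by (rule smalloD_tendsto[OF H2(4)])
    from tendsto_mult_left[OF this, of c] show ?thesis by (simp add: \<epsilon>_def[abs_def] mult_ac)
  qed
  have L_lim: "filterlim L at_top sequentially"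
  proof -
    have "filterlim (\<lambda>n. (m * c) * (real n * nu_min \<nu> (k n) (I n))) at_top sequentially"
      using m c by (intro filterlim_tendsto_pos_mult_at_top[OF tendsto_const _ H1(3)]) simp
    then show ?thesis by (simp add: L_def[abs_def] mult_ac)
  qed
  have invL: "(\<lambda>n. a / L n) \<longlonglongrightarrow> 0" for a :: real
    by (rule real_tendsto_divide_at_top[OF tendsto_const L_lim])
  have \<beta>_lim: "\<beta> \<longlonglongrightarrow> 0"
  proof -
    have "((\<lambda>y::real. y ^ 1 / exp y) \<longlongrightarrow> 0) at_top" by (rule tendsto_power_div_exp_0)
    from filterlim_compose[OF this L_lim]
    have "(\<lambda>n. L n * exp (- L n)) \<longlonglongrightarrow> 0" by (simp add: exp_minus divide_inverse)
    moreover have "(\<lambda>n. 2 * (\<epsilon> n)\<^sup>2) \<longlonglongrightarrow> 2 * 0\<^sup>2" by (intro tendsto_intros \<epsilon>_lim)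
    ultimately show ?thesis unfolding \<beta>_def[abs_def] using tendsto_add by fastforce
  qed
  have \<eta>_lim: "\<eta> \<longlonglongrightarrow> 0"
  proof -
    have "\<eta> \<longlonglongrightarrow> 40 * sqrt (0 + 0\<^sup>2 + 0\<^sup>2) + (5 * \<bar>0\<bar> + 0)"
      unfolding \<eta>_def[abs_def] by (intro tendsto_intros invL \<epsilon>_lim \<beta>_lim)
    then show ?thesis by simp
  qed
  have ev: "\<forall>\<^sub>F n in sequentially. n \<ge> 1 \<and> 1 \<le> L n \<and> \<epsilon> n \<le> 1 \<and> \<eta> n \<le> 1"
  proof -
    have "\<forall>\<^sub>F n in sequentially. 1 \<le> L n" using L_lim by (simp add: filterlim_at_top)
    moreover have "\<forall>\<^sub>F n in sequentially. \<epsilon> n < 1" "\<forall>\<^sub>F n in sequentially. \<eta> n < 1"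
      using \<epsilon>_lim \<eta>_lim by (auto intro: order_tendstoD)
    ultimately show ?thesis using eventually_ge_at_top[of "1::nat"] by eventually_elim auto
  qed
  have mean_bound: "\<forall>\<^sub>F n in sequentially. \<forall>r\<in>{1..k n}. \<bar>mean n r\<bar> \<le> \<beta> n"
    using ev
  proof eventually_elim
    case (elim n)
    then have n: "n \<ge> 1" by simp
    show ?case
      unfolding mean_def err_def
      using I(1,4) n elim H2(1,3)
      by (intro ballI hypograph_process.cell_error_bounds(1)[OF H[OF n], where K="k n" and \<epsilon>="\<epsilon> n" and L="L n"])
         (auto simp: \<epsilon>_def L_def \<beta>_def m_def)
  qed
  have char_bound: "\<forall>\<^sub>F n in sequentially. \<forall>r\<in>{1..k n}. \<forall>s.
     cmod (char (distr (P n) borel (\<lambda>\<omega>. err n r \<omega> - mean n r)) s - exp (- s\<^sup>2 / 2)) \<le> s\<^sup>2 * (7 * \<eta> n + 76 * \<bar>s\<bar> + s\<^sup>2)"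
    using ev
  proof eventually_elim
    case (elim n)
    then have n: "n \<ge> 1" by simp
    have L0: "0 < 1 / L n" using elim by simp
    have sq: "0 < sqrt (1 / L n + (\<epsilon> n)\<^sup>2 + (\<beta> n)\<^sup>2)"
      using L0 by (intro real_sqrt_gt_zero add_pos_nonneg) auto
    have \<eta>1: "40 * sqrt (1 / L n + (\<epsilon> n)\<^sup>2 + (\<beta> n)\<^sup>2) \<le> \<eta> n" using L0 by (simp add: \<eta>_def)
    have \<eta>2: "5 * \<epsilon> n + 18 / L n \<le> \<eta> n" using sq unfolding \<eta>_def by linarith
    have "(40 * sqrt (1 / L n + (\<epsilon> n)\<^sup>2 + (\<beta> n)\<^sup>2))\<^sup>2 \<le> (\<eta> n)\<^sup>2"
      using \<eta>1 sq by (intro power_mono) auto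
    moreover have "(40 * sqrt (1 / L n + (\<epsilon> n)\<^sup>2 + (\<beta> n)\<^sup>2))\<^sup>2 = 1600 * (1 / L n + (\<epsilon> n)\<^sup>2 + (\<beta> n)\<^sup>2)"
      using L0 by (simp add: power_mult_distrib)
    moreover have "2 * (700 * y + 12 * e) + 2 * b \<le> 1600 * (y + e + b)" if "0 \<le> y" "0 \<le> e" "0 \<le> b" for y e b :: real
      using that by (simp add: algebra_simps)
    from this[of "1 / L n" "(\<epsilon> n)\<^sup>2" "(\<beta> n)\<^sup>2"] L0
    have "2 * (700 / L n + 12 * (\<epsilon> n)\<^sup>2) + 2 * (\<beta> n)\<^sup>2 \<le> 1600 * (1 / L n + (\<epsilon> n)\<^sup>2 + (\<beta> n)\<^sup>2)" by simp
    ultimately have \<eta>3: "2 * (700 / L n + 12 * (\<epsilon> n)\<^sup>2) + 2 * (\<beta> n)\<^sup>2 \<le> (\<eta> n)\<^sup>2" by linarith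
    have \<eta>0: "0 < \<eta> n" using \<eta>1 sq by linarith
    show ?case
    proof (intro ballI allI)
      fix r s assume r: "r \<in> {1..k n}"
      have "cmod (char (distr (P n) borel (\<lambda>\<omega>. err n r \<omega> - mean n r)) s - exp (- s\<^sup>2 / 2)) \<le> s\<^sup>2 * (7 * \<eta> n + 2 * 38 * \<bar>s\<bar> + s\<^sup>2)"
        unfolding mean_def err_def
        using I(1,4) n r elim H2(1,3) \<eta>0 \<eta>2 \<eta>3
        by (intro hypograph_process.cell_error_bounds(2)[OF H[OF n], where K="k n" and \<epsilon>="\<epsilon> n" and L="L n" and \<beta>="\<beta> n"])
           (auto simp: \<epsilon>_def L_def \<beta>_def m_def)
      then show "cmod (char (distr (P n) borel (\<lambda>\<omega>. err n r \<omega> - mean n r)) s - exp (- s\<^sup>2 / 2)) \<le> s\<^sup>2 * (7 * \<eta> n + 76 * \<bar>s\<bar> + s\<^sup>2)"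
        by simp
    qed
  qed
  have w_mean_lim: "(\<lambda>n. \<Sum>r=1..k n. w n r j * mean n r) \<longlonglongrightarrow> 0" for j
  proof (rule Lim_null_comparison)
    define C where "C = m * c + 2 * c\<^sup>2"
    have H6': "(\<lambda>n. (\<Sum>r=1..k n. \<bar>w n r j\<bar>) * mx n) \<longlonglongrightarrow> 0"
      using H6 xF unfolding w_def mx_def m_def by blast
    show "(\<lambda>n. C * ((\<Sum>r=1..k n. \<bar>w n r j\<bar>) * mx n)) \<longlonglongrightarrow> 0"
      using tendsto_mult_left[OF H6', of C] by simp
    show "\<forall>\<^sub>F n in sequentially. norm (\<Sum>r=1..k n. w n r j * mean n r) \<le> C * ((\<Sum>r=1..k n. \<bar>w n r j\<bar>) * mx n)"
      using mean_bound
    proof eventually_elim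
      case (elim n)
      \<comment> \<open>The first two entries of the maximum are, up to constants, the two parts of the bias bound.\<close>
      have mx1: "(real n * delta_max \<nu> f (k n) (I n))\<^sup>2 \<le> mx n"
        and mx2: "real n * nu_min \<nu> (k n) (I n) * exp (- (m * c * real n * nu_min \<nu> (k n) (I n))) \<le> mx n"
        unfolding mx_def by (auto intro!: Max_ge)
      have "\<beta> n = (m * c) * (real n * nu_min \<nu> (k n) (I n) * exp (- (m * c * real n * nu_min \<nu> (k n) (I n))))
           + 2 * c\<^sup>2 * (real n * delta_max \<nu> f (k n) (I n))\<^sup>2"
        by (simp add: \<beta>_def L_def \<epsilon>_def power_mult_distrib mult_ac)
      also have "\<dots> \<le> (m * c) * mx n + 2 * c\<^sup>2 * mx n"
        using m c mx1 mx2 by (intro add_mono mult_left_mono) auto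
      finally have \<beta>: "\<beta> n \<le> C * mx n" by (simp add: C_def algebra_simps)
      have "norm (\<Sum>r=1..k n. w n r j * mean n r) \<le> (\<Sum>r=1..k n. \<bar>w n r j\<bar> * \<bar>mean n r\<bar>)"
        unfolding real_norm_def abs_mult[symmetric] by (rule sum_abs)
      also have "\<dots> \<le> (\<Sum>r=1..k n. \<bar>w n r j\<bar> * (C * mx n))"
        using elim \<beta> by (intro sum_mono mult_left_mono) (auto intro: order_trans)
      also have "\<dots> = C * ((\<Sum>r=1..k n. \<bar>w n r j\<bar>) * mx n)"
        by (simp add: sum_distrib_right sum_distrib_left mult_ac)
      finally show ?case .
    qed
  qed
  have bias_lim: "(\<lambda>n. bias n j) \<longlonglongrightarrow> 0" for j
  proof -
    let ?b = "\<lambda>n. (\<Sum>r=1..k n. measure \<nu> (I n r) * \<kappa> n r (x j) * cell_mean \<nu> f (I n r)) - f (x j)"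
    have "(\<lambda>n. \<bar>?b n\<bar>) \<in> o(\<lambda>n. kappa_norm (k n) (\<kappa> n) (x j) / real n)"
      using H5 xF by blast
    from smalloD_tendsto[OF this]
    have "(\<lambda>n. \<bar>?b n\<bar> / (kappa_norm (k n) (\<kappa> n) (x j) / real n)) \<longlonglongrightarrow> 0" .
    from tendsto_mult_left[OF this, of c]
    have "(\<lambda>n. c * (\<bar>?b n\<bar> / (kappa_norm (k n) (\<kappa> n) (x j) / real n))) \<longlonglongrightarrow> 0" by simp
    moreover have "\<forall>\<^sub>F n in sequentially. norm (bias n j) \<le> c * (\<bar>?b n\<bar> / (kappa_norm (k n) (\<kappa> n) (x j) / real n))"
      using eventually_ge_at_top[of 1]
    proof eventually_elim
      case (elim n)
      have "0 < kappa_norm (k n) (\<kappa> n) (x j)" using kappa_pos xF elim by blast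
      then have "\<bar>bias n j\<bar> = real n * c / kappa_norm (k n) (\<kappa> n) (x j) * \<bar>?b n\<bar>"
        using c unfolding bias_def abs_mult by simp
      then show ?case by (simp add: mult_ac)
    qed
    ultimately show ?thesis by (rule Lim_null_comparison[rotated])
  qed

  \<comment> \<open>The model starts at sample size 1, so all sequences are shifted by one.\<close>
  have char_lim: "(\<lambda>n. LINT \<omega>|P (Suc n). iexp (a \<bullet> Z (Suc n) \<omega>)) \<longlonglongrightarrow> (LINT v|G. iexp (a \<bullet> v))" for a
  proof -
    define u where "u n r = (\<Sum>j\<in>UNIV. a $ j * w n r j)" for n r
    define d where "d n = (\<Sum>j\<in>UNIV. a $ j * ((\<Sum>r=1..k n. w n r j * mean n r) + bias n j))" for n
    have d_lim: "d \<longlonglongrightarrow> 0"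
    proof -
      have "d \<longlonglongrightarrow> (\<Sum>j\<in>UNIV. a $ j * (0 + 0))"
        unfolding d_def[abs_def] by (intro tendsto_intros w_mean_lim bias_lim)
      then show ?thesis by simp
    qed
    define \<mu> where "\<mu> n = (\<Sum>j\<in>UNIV. \<bar>a $ j\<bar> * Max ((\<lambda>r. \<bar>w n r j\<bar>) ` {1..k n}))" for n
    have \<mu>_lim: "\<mu> \<longlonglongrightarrow> 0"
    proof -
      have "(\<lambda>n. Max ((\<lambda>r. \<bar>w n r j\<bar>) ` {1..k n})) \<longlonglongrightarrow> 0" for j
        using H4 xF unfolding w_def by blast
      then have "\<mu> \<longlonglongrightarrow> (\<Sum>j\<in>UNIV. \<bar>a $ j\<bar> * 0)"
        unfolding \<mu>_def[abs_def] by (intro tendsto_sum tendsto_mult_left)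
      then show ?thesis by simp
    qed
    have u_le: "\<bar>u n r\<bar> \<le> \<mu> n" if "r \<in> {1..k n}" for n r
    proof -
      have "\<bar>u n r\<bar> \<le> (\<Sum>j\<in>UNIV. \<bar>a $ j\<bar> * \<bar>w n r j\<bar>)"
        unfolding u_def abs_mult[symmetric] by (rule sum_abs)
      also have "\<dots> \<le> \<mu> n"
        unfolding \<mu>_def using that by (intro sum_mono mult_left_mono Max_ge) auto
      finally show ?thesis .
    qed
    have expand: "a \<bullet> Z n \<omega> = (\<Sum>r=1..k n. u n r * (err n r \<omega> - mean n r)) + d n" if "n \<ge> 1" for n \<omega>
    proof -
      have "(\<Sum>r=1..k n. u n r * (err n r \<omega> - mean n r)) =
        (\<Sum>r=1..k n. \<Sum>j\<in>UNIV. a $ j * (w n r j * err n r \<omega> - w n r j * mean n r))"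
        unfolding u_def sum_distrib_right by (intro sum.cong refl) (simp add: algebra_simps)
      also have "\<dots> = (\<Sum>j\<in>UNIV. a $ j * ((\<Sum>r=1..k n. w n r j * err n r \<omega>) - (\<Sum>r=1..k n. w n r j * mean n r)))"
        by (subst sum.swap) (simp add: sum_distrib_left sum_subtractf right_diff_distrib)
      finally show ?thesis
        unfolding inner_vec_def d_def by (simp add: Z_eq[OF that] sum.distrib[symmetric] algebra_simps)
    qed
    have clt: "(\<lambda>n. LINT \<omega>|P (Suc n). iexp (\<Sum>r=1..k (Suc n). u (Suc n) r * (err (Suc n) r \<omega> - mean (Suc n) r)))
       \<longlonglongrightarrow> complex_of_real (exp (- (a \<bullet> (A *v a)) / 2))"
    proof (rule weighted_sum_clt)
      show "prob_space (P (Suc n))" for n using P by auto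
      show "prob_space.indep_vars (P (Suc n)) (\<lambda>_. borel) (\<lambda>r \<omega>. err (Suc n) r \<omega> - mean (Suc n) r) {1..k (Suc n)}" for n
        unfolding err_def mean_def
        using I(1,2) by (intro hypograph_process.indep_centred_cell_errors[OF H]) auto
      show "\<forall>\<^sub>F n in sequentially. \<forall>r\<in>{1..k (Suc n)}. \<forall>s.
         cmod (char (distr (P (Suc n)) borel (\<lambda>\<omega>. err (Suc n) r \<omega> - mean (Suc n) r)) s - exp (- s\<^sup>2 / 2))
           \<le> s\<^sup>2 * (7 * \<eta> (Suc n) + 76 * \<bar>s\<bar> + s\<^sup>2)"
        using char_bound by (rule eventually_compose_filterlim[OF _ filterlim_Suc])
      show "(\<lambda>n. 7 * \<eta> (Suc n)) \<longlonglongrightarrow> 0"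
        using tendsto_mult_left[OF LIMSEQ_Suc[OF \<eta>_lim], of 7] by simp
      show "r \<in> {1..k (Suc n)} \<Longrightarrow> \<bar>u (Suc n) r\<bar> \<le> \<mu> (Suc n)" for n r by (rule u_le)
      show "(\<lambda>n. \<mu> (Suc n)) \<longlonglongrightarrow> 0" by (rule LIMSEQ_Suc[OF \<mu>_lim])
      show "(\<lambda>n. \<Sum>r=1..k (Suc n). (u (Suc n) r)\<^sup>2) \<longlonglongrightarrow> a \<bullet> (A *v a)"
        using LIMSEQ_Suc[OF quad[of a]] unfolding u_def .
    qed simp
    have "(LINT \<omega>|P (Suc n). iexp (a \<bullet> Z (Suc n) \<omega>)) =
      iexp (d (Suc n)) * (LINT \<omega>|P (Suc n). iexp (\<Sum>r=1..k (Suc n). u (Suc n) r * (err (Suc n) r \<omega> - mean (Suc n) r)))" for n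
    proof -
      have "iexp (a \<bullet> Z (Suc n) \<omega>) = iexp (d (Suc n)) * iexp (\<Sum>r=1..k (Suc n). u (Suc n) r * (err (Suc n) r \<omega> - mean (Suc n) r))" for \<omega>
      proof -
        have "iexp (p + q) = iexp q * iexp p" for p q :: real
          by (simp add: distrib_left exp_add mult.commute)
        moreover have "1 \<le> Suc n" by simp
        ultimately show ?thesis by (simp only: expand)
      qed
      then show ?thesis by (simp only: integral_mult_right_zero)
    qed
    moreover have "(\<lambda>n. iexp (d (Suc n))) \<longlonglongrightarrow> iexp 0"
      by (intro tendsto_intros LIMSEQ_Suc[OF d_lim])
    ultimately have "(\<lambda>n. LINT \<omega>|P (Suc n). iexp (a \<bullet> Z (Suc n) \<omega>)) \<longlonglongrightarrow> iexp 0 * complex_of_real (exp (- (a \<bullet> (A *v a)) / 2))"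
      using clt by (simp only:) (intro tendsto_mult)
    then show ?thesis unfolding G(3) by simp
  qed
  have "converges_in_distribution P Z G"
    unfolding converges_in_distribution_def
  proof (intro conjI allI impI)
    show "\<forall>\<^sub>F n in sequentially. Z n \<in> borel_measurable (P n)"
      using eventually_ge_at_top[of 1] by eventually_elim (rule Z_meas)
    fix g :: "real^'p \<Rightarrow> real" assume g: "continuous_on UNIV g" "bounded (range g)"
    have "(\<lambda>n. LINT \<omega>|P (Suc n). g (Z (Suc n) \<omega>)) \<longlonglongrightarrow> (LINT v|G. g v)"
      using P by (intro multivariate_levy_continuity[OF _ Z_meas G(1,2) char_lim g]) auto
    then show "(\<lambda>n. LINT \<omega>|P n. g (Z n \<omega>)) \<longlonglongrightarrow> (LINT v|G. g v)" by (rule LIMSEQ_imp_Suc)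
  qed
  with gauss show "\<exists>G. centered_gaussian (\<chi> i j. \<sigma> (x i) (x j)) G \<and>
      converges_in_distribution P
        (\<lambda>n \<omega>. \<chi> j. real n * c / kappa_norm (k n) (\<kappa> n) (x j) *
           (estimator \<nu> f (k n) (I n) (\<kappa> n) (N n \<omega>) (\<lambda>i. X n i \<omega>) (\<lambda>i. Y n i \<omega>) (x j)
              - f (x j)))
        G"
    unfolding A_def Z_def[abs_def] by blast
qed

end
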